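(* Let $L\subset\mathbb{C}^3$ be a connected special Lagrangian $3$-fold such that, at each point $x\in L$, the $SO(T_xL)$-stabilizer of the fundamental cubic $C_x$ contains a subgroup isomorphic to the group $A_4$ of order $12$. Then $L$ is an open subset of a special Lagrangian (affine) $3$-plane.
   Context: On $\mathbb{C}^3$ use the standard structure $\omega=\frac{i}{2}\sum_k dz_k\wedge d\bar z_k$, $\Upsilon=dz_1\wedge dz_2\wedge dz_3$, the flat metric $g=\sum_k|dz_k|^2$ and the complex structure $J$ (multiplication by $i$). A (smooth) $3$-dimensional submanifold $L\subset\mathbb{C}^3$ is special Lagrangian if $\omega$ and $\operatorname{Im}\Upsilon$ pull back to $0$ on $L$; it is oriented so that $\operatorname{Re}\Upsilon$ is a positive volume form. The fundamental cubic $C$ of $L$ is the symmetric cubic form on $L$ given by $C_x(a,b,c)=g(\mathrm{II}_x(a,b),Jc)$ for $a,b,c\in T_xL$, where $\mathrm{II}$ is the second fundamental form of $L$. It is totally symmetric and traceless with respect to the induced metric, hence is a harmonic homogeneous cubic polynomial on $T_xL$. The group $SO(T_xL)\cong SO(3)$ acts on such cubics by pullback, and the stabilizer of $C_x$ is the subgroup fixing $C_x$. *)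

theory Defs
  imports "HOL-Analysis.Analysis" "HOL-Algebra.Bij" "HOL-Algebra.Sym_Groups"
begin

(* On an open set of a finite-dimensional space, f is of class C^(k+1) iff it is differentiable
   and all its directional derivatives are of class C^k. *)
primrec Ck_on :: "nat \<Rightarrow> 'a set \<Rightarrow> ('a::euclidean_space \<Rightarrow> 'b::real_normed_vector) \<Rightarrow> bool" where
  "Ck_on 0 U f \<longleftrightarrow> continuous_on U f"
| "Ck_on (Suc k) U f \<longleftrightarrow>
     (\<forall>x\<in>U. f differentiable (at x)) \<and> (\<forall>v. Ck_on k U (\<lambda>x. frechet_derivative f (at x) v))"

definition smooth_on :: "'a set \<Rightarrow> ('a::euclidean_space \<Rightarrow> 'b::real_normed_vector) \<Rightarrow> bool" where
  "smooth_on U f \<longleftrightarrow> open U \<and> (\<forall>k. Ck_on k U f)"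

(* Embedded 3-dimensional submanifold, by local parametrizations. *)
definition submanifold3 :: "(complex^3) set \<Rightarrow> bool" where
  "submanifold3 L \<longleftrightarrow>
     (\<forall>x\<in>L. \<exists>W V (\<phi> :: real^3 \<Rightarrow> complex^3) \<psi>.
        x \<in> W \<and> openin (top_of_set L) W \<and> smooth_on V \<phi> \<and>
        (\<forall>q\<in>V. inj (frechet_derivative \<phi> (at q))) \<and> homeomorphism V W \<phi> \<psi>)"

definition tangent_space :: "(complex^3) set \<Rightarrow> complex^3 \<Rightarrow> (complex^3) set" where
  "tangent_space L x =
     {vector_derivative \<gamma> (at 0) |\<gamma> \<epsilon>. 0 < (\<epsilon>::real) \<and> smooth_on {-\<epsilon><..<\<epsilon>} \<gamma> \<and>
        \<gamma> ` {-\<epsilon><..<\<epsilon>} \<subseteq> L \<and> \<gamma> 0 = x}"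

(* The flat metric g is the real inner product of complex^3, that is, Re (\<Sum>k. u$k * cnj (v$k)). *)

definition J :: "complex^3 \<Rightarrow> complex^3" where
  "J v = \<i> *s v"

definition omega :: "complex^3 \<Rightarrow> complex^3 \<Rightarrow> complex" where
  "omega u v = \<i> / 2 * (\<Sum>k\<in>UNIV. u$k * cnj (v$k) - v$k * cnj (u$k))"

definition Upsilon :: "complex^3 \<Rightarrow> complex^3 \<Rightarrow> complex^3 \<Rightarrow> complex" where
  "Upsilon u v w = det (vector [u, v, w] :: complex^3^3)"

definition special_lagrangian :: "(complex^3) set \<Rightarrow> bool" where
  "special_lagrangian L \<longleftrightarrow> submanifold3 L \<and>
     (\<forall>x\<in>L. (\<forall>u\<in>tangent_space L x. \<forall>v\<in>tangent_space L x. omega u v = 0) \<and>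
            (\<forall>u\<in>tangent_space L x. \<forall>v\<in>tangent_space L x. \<forall>w\<in>tangent_space L x.
               Im (Upsilon u v w) = 0))"

(* Orthogonal projection onto the orthogonal complement of a linear subspace T. *)
definition normal_part :: "(complex^3) set \<Rightarrow> complex^3 \<Rightarrow> complex^3" where
  "normal_part T v = (THE n. n \<in> orthogonal_comp T \<and> v - n \<in> T)"

(* II_x(a,b) is the normal part of the flat derivative, in the direction a, of a tangent vector
   field Y of L with Y = b at x. This derivative only involves the values of Y along a curve \<gamma>
   in L with velocity a at x, so Y is taken along \<gamma>. For a submanifold and a, b tangent at x
   the value exists and does not depend on the choice of \<gamma> and Y. *)
definition second_fundamental_form ::
    "(complex^3) set \<Rightarrow> complex^3 \<Rightarrow> complex^3 \<Rightarrow> complex^3 \<Rightarrow> complex^3" where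
  "second_fundamental_form L x a b =
     (THE n. \<exists>\<gamma> Y \<epsilon>. 0 < (\<epsilon>::real) \<and>
        smooth_on {-\<epsilon><..<\<epsilon>} \<gamma> \<and> \<gamma> ` {-\<epsilon><..<\<epsilon>} \<subseteq> L \<and> \<gamma> 0 = x \<and>
        vector_derivative \<gamma> (at 0) = a \<and>
        smooth_on {-\<epsilon><..<\<epsilon>} Y \<and> (\<forall>t\<in>{-\<epsilon><..<\<epsilon>}. Y t \<in> tangent_space L (\<gamma> t)) \<and> Y 0 = b \<and>
        n = normal_part (tangent_space L x) (vector_derivative Y (at 0)))"

(* Only meaningful for a, b, c in the tangent space at x. *)
definition fundamental_cubic ::
    "(complex^3) set \<Rightarrow> complex^3 \<Rightarrow> complex^3 \<Rightarrow> complex^3 \<Rightarrow> complex^3 \<Rightarrow> real" where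
  "fundamental_cubic L x a b c = inner (second_fundamental_form L x a b) (J c)"

(* SO(T) for a 3-dimensional linear subspace T. Its elements are maps on T, made extensional as
   in BijGroup. The determinant condition is independent of the orthonormal basis e of T. *)
definition SO_group :: "(complex^3) set \<Rightarrow> (complex^3 \<Rightarrow> complex^3) monoid" where
  "SO_group T = (BijGroup T)\<lparr>carrier := {h \<in> Bij T.
     (\<forall>u\<in>T. \<forall>v\<in>T. h (u + v) = h u + h v) \<and>
     (\<forall>r::real. \<forall>u\<in>T. h (r *\<^sub>R u) = r *\<^sub>R h u) \<and>
     (\<forall>u\<in>T. \<forall>v\<in>T. inner (h u) (h v) = inner u v) \<and>
     (\<forall>e :: 3 \<Rightarrow> complex^3.
        (\<forall>i j. inner (e i) (e j) = (if i = j then 1 else 0)) \<and> span (range e) = T \<longrightarrow>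
        det (\<chi> i j. inner (e i) (h (e j)) :: real^3^3) = 1)}\<rparr>"

definition cubic_stabilizer ::
    "(complex^3) set \<Rightarrow> (complex^3 \<Rightarrow> complex^3 \<Rightarrow> complex^3 \<Rightarrow> real) \<Rightarrow>
     (complex^3 \<Rightarrow> complex^3) set" where
  "cubic_stabilizer T C =
     {h \<in> carrier (SO_group T). \<forall>a\<in>T. \<forall>b\<in>T. \<forall>c\<in>T. C (h a) (h b) (h c) = C a b c}"

end

theory Submission
  imports Defs
begin

text \<open>Over its tangent plane at a point, \<open>L\<close> is the graph of a map with symmetric Jacobian \<open>F\<close>. In these
  coordinates the fundamental cubic is the derivative \<open>X\<close> of \<open>F\<close>, and the metric is \<open>g = 1 + F\<^sup>2\<close>. Symmetry
  under \<open>A\<^sub>4\<close>, or only under its Klein four-group, means that the cubic is \<open>r x\<^sub>1 x\<^sub>2 x\<^sub>3\<close> in some orthonormal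
  frame, hence that it is traceless and that its contraction with itself in two slots is a multiple of \<open>g\<close>.
  Suppose \<open>r \<noteq> 0\<close> at the centre. To first order there, these two identities force all first derivatives of
  \<open>X\<close> to vanish. To second order they give, with
  \<open>(A, B, C) = (\<partial>\<^sub>2\<partial>\<^sub>3X\<^sub>1\<^sub>1\<^sub>1, \<partial>\<^sub>1\<partial>\<^sub>3X\<^sub>2\<^sub>2\<^sub>2, \<partial>\<^sub>1\<partial>\<^sub>2X\<^sub>3\<^sub>3\<^sub>3)\<close>, the relations
  \<open>A + B = B + C = A + C = 2r\<^sup>3\<close> and \<open>A + B + C = 2r\<^sup>3\<close>, which contradict each other. So the cubic vanishes
  identically, the tangent planes are locally constant, and \<open>L\<close> lies in a plane by connectedness.\<close>

section \<open>Calculus of smooth functions\<close>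

text \<open>The symmetry group supplies an orthonormal frame at each point separately, and neither
  this frame nor the coefficient \<open>r\<close> is known to vary continuously. Only consequences
  that do not mention the frame can be compared at neighbouring points, and these involve an inverse
  metric built from it. Peano expansions along lines get around the lack of regularity: a bounded
  inverse matrix, chosen independently for each parameter, already has the second-order expansion
  dictated by that of \<open>g\<close>. Because \<open>F\<close> is zero at the centre,
  \<open>g\<close> departs from the identity only at second order. The first-order equations are
  therefore those of flat space, and the terms in the cube of \<open>r\<close> enter only with the
  second-order ones. Symmetry of \<open>F\<close> makes the graph map locally a gradient, so that
  \<open>X\<close> and its first and second derivatives are third, fourth and fifth derivatives of
  one potential. The obstruction thus reduces to linear algebra of totally symmetric
  tensors.\<close>

lemma has_derivative_cong_open:
  assumes "open U" "x \<in> U" "\<And>y. y \<in> U \<Longrightarrow> f y = g y"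
  shows "(f has_derivative D) (at x) \<longleftrightarrow> (g has_derivative D) (at x)"
proof
  show "(g has_derivative D) (at x)" if "(f has_derivative D) (at x)"
    using that assms(1,2) by (rule has_derivative_transform_within_open) (rule assms(3))
  show "(f has_derivative D) (at x)" if "(g has_derivative D) (at x)"
    using that assms(1,2) by (rule has_derivative_transform_within_open) (simp add: assms(3))
qed

lemma Ck_on_cong:
  assumes "open U" "\<And>x. x \<in> U \<Longrightarrow> f x = g x"
  shows "Ck_on k U f \<longleftrightarrow> Ck_on k U g"
  using assms(2)
proof (induction k arbitrary: f g)
  case 0
  then show ?case by (simp cong: continuous_on_cong)
next
  case (Suc k)
  have hd: "(f has_derivative D) (at x) \<longleftrightarrow> (g has_derivative D) (at x)" if "x \<in> U" for D x
    using has_derivative_cong_open[OF assms(1) that] Suc.prems by metis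
  have fr: "frechet_derivative f (at x) = frechet_derivative g (at x)" if "x \<in> U" for x
    unfolding frechet_derivative_def using hd[OF that] by simp
  have "Ck_on k U (\<lambda>x. frechet_derivative f (at x) v) \<longleftrightarrow> Ck_on k U (\<lambda>x. frechet_derivative g (at x) v)" for v
    by (rule Suc.IH) (simp add: fr)
  then show ?case
    using hd by (auto simp: differentiable_def)
qed

lemma Ck_on_SucI:
  assumes "open U" "\<And>x. x \<in> U \<Longrightarrow> (f has_derivative D x) (at x)" "\<And>v. Ck_on k U (\<lambda>x. D x v)"
  shows "Ck_on (Suc k) U f"
proof -
  have "frechet_derivative f (at x) = D x" if "x \<in> U" for x
    using frechet_derivative_at[OF assms(2)[OF that]] by simp
  then have "Ck_on k U (\<lambda>x. frechet_derivative f (at x) v)" for v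
    using Ck_on_cong[OF assms(1), of "\<lambda>x. frechet_derivative f (at x) v" "\<lambda>x. D x v"] assms(3)[of v] by simp
  then show ?thesis
    using assms(2) by (auto simp: differentiable_def)
qed

lemma Ck_on_Suc_has_derivative:
  assumes "Ck_on (Suc k) U f" "x \<in> U"
  shows "(f has_derivative frechet_derivative f (at x)) (at x)"
  using assms by (simp add: frechet_derivative_works)

lemma Ck_on_Suc_imp: "Ck_on (Suc k) U f \<Longrightarrow> Ck_on k U f"
proof (induction k arbitrary: f)
  case 0
  then show ?case
    by (auto intro!: differentiable_imp_continuous_on differentiable_at_imp_differentiable_on)
next
  case (Suc k)
  then show ?case by simp
qed

lemma Ck_on_const: "Ck_on k U (\<lambda>x. c)"
proof (induction k arbitrary: c)
  case (Suc k)
  then show ?case by simp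
qed simp

lemma Ck_on_add:
  assumes "open U" "Ck_on k U f" "Ck_on k U g"
  shows "Ck_on k U (\<lambda>x. f x + g x)"
  using assms(2,3)
proof (induction k arbitrary: f g)
  case 0
  then show ?case by (simp add: continuous_on_add)
next
  case (Suc k)
  show ?case
    by (rule Ck_on_SucI[OF assms(1) has_derivative_add[OF Ck_on_Suc_has_derivative Ck_on_Suc_has_derivative]])
       (use Suc in auto)
qed

lemma Ck_on_bounded_bilinear:
  assumes "bounded_bilinear B" "open U" "Ck_on k U f" "Ck_on k U g"
  shows "Ck_on k U (\<lambda>x. B (f x) (g x))"
  using assms(3,4)
proof (induction k arbitrary: f g)
  case 0
  then show ?case by (simp add: bounded_bilinear.continuous_on[OF assms(1)])
next
  case (Suc k)
  have "Ck_on k U f" "Ck_on k U g" using Suc.prems Ck_on_Suc_imp by blast+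
  then show ?case
    by (intro Ck_on_SucI[OF assms(2) bounded_bilinear.FDERIV[OF assms(1) Ck_on_Suc_has_derivative Ck_on_Suc_has_derivative]])
       (use Suc in \<open>auto intro!: Ck_on_add[OF assms(2)]\<close>)
qed

lemma Ck_on_bounded_linear:
  assumes "bounded_linear h" "open U" "Ck_on k U f"
  shows "Ck_on k U (\<lambda>x. h (f x))"
  using assms(3)
proof (induction k arbitrary: f)
  case 0
  then show ?case by (simp add: bounded_linear.continuous_on[OF assms(1)])
next
  case (Suc k)
  show ?case
    by (rule Ck_on_SucI[OF assms(2) bounded_linear.has_derivative[OF assms(1) Ck_on_Suc_has_derivative]])
       (use Suc in auto)
qed

lemma Ck_on_sum:
  assumes "open U" "\<And>i. i \<in> I \<Longrightarrow> Ck_on k U (f i)"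
  shows "Ck_on k U (\<lambda>x. \<Sum>i\<in>I. f i x)"
  using assms(2)
  by (induction I rule: infinite_finite_induct) (auto intro: Ck_on_const Ck_on_add[OF assms(1)])

lemma Ck_on_prod:
  fixes f :: "'i \<Rightarrow> 'a::euclidean_space \<Rightarrow> real"
  assumes "open U" "\<And>i. i \<in> I \<Longrightarrow> Ck_on k U (f i)"
  shows "Ck_on k U (\<lambda>x. \<Prod>i\<in>I. f i x)"
  using assms(2)
  by (induction I rule: infinite_finite_induct)
     (auto intro: Ck_on_const Ck_on_bounded_bilinear[OF bounded_bilinear_mult assms(1)])

lemma Ck_on_compose:
  fixes f :: "'a::euclidean_space \<Rightarrow> 'b::euclidean_space"
  assumes "open U" "Ck_on k U f" "Ck_on k V g" "f ` U \<subseteq> V"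
  shows "Ck_on k U (\<lambda>x. g (f x))"
  using assms(2,3)
proof (induction k arbitrary: g)
  case 0
  then show ?case using assms(4) by (auto intro: continuous_on_compose2)
next
  case (Suc k)
  \<comment> \<open>\<open>Ck_on\<close> controls derivatives in fixed directions only, whereas the
    chain rule differentiates \<open>g\<close> in the moving direction
    \<open>frechet_derivative f (at x) v\<close>. Expanding that direction in \<open>Basis\<close>
    leaves fixed directions with scalar coefficients, to which the induction hypothesis
    applies.\<close>
  let ?D = "\<lambda>x v. \<Sum>b\<in>Basis. (frechet_derivative f (at x) v \<bullet> b) *\<^sub>R frechet_derivative g (at (f x)) b"
  show ?case
  proof (rule Ck_on_SucI[where D = ?D, OF assms(1)])
    fix x assume x: "x \<in> U"
    have f: "(f has_derivative frechet_derivative f (at x)) (at x)"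
      using Ck_on_Suc_has_derivative[OF Suc.prems(1) x] .
    have g: "(g has_derivative frechet_derivative g (at (f x))) (at (f x))"
      using Ck_on_Suc_has_derivative[OF Suc.prems(2)] x assms(4) by auto
    have lin: "linear (frechet_derivative g (at (f x)))"
      using g has_derivative_linear by blast
    have "?D x v = frechet_derivative g (at (f x)) (frechet_derivative f (at x) v)" for v
    proof -
      have "frechet_derivative g (at (f x)) (\<Sum>b\<in>Basis. (frechet_derivative f (at x) v \<bullet> b) *\<^sub>R b) = ?D x v"
        using lin by (simp add: linear_sum linear_scale)
      then show ?thesis by (simp add: euclidean_representation)
    qed
    then have eq: "?D x = (\<lambda>v. frechet_derivative g (at (f x)) (frechet_derivative f (at x) v))"
      by (intro ext)
    show "((\<lambda>x. g (f x)) has_derivative ?D x) (at x)"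
      unfolding eq using diff_chain_at[OF f g] by (simp only: o_def)
  next
    fix v
    have f': "Ck_on k U f" using Suc.prems(1) by (rule Ck_on_Suc_imp)
    have fv: "Ck_on k U (\<lambda>x. frechet_derivative f (at x) v)" using Suc.prems(1) by simp
    show "Ck_on k U (\<lambda>x. ?D x v)"
    proof (rule Ck_on_sum[OF assms(1)])
      fix b :: 'b
      have gb: "Ck_on k V (\<lambda>y. frechet_derivative g (at y) b)" using Suc.prems(2) by simp
      show "Ck_on k U (\<lambda>x. (frechet_derivative f (at x) v \<bullet> b) *\<^sub>R frechet_derivative g (at (f x)) b)"
        by (rule Ck_on_bounded_bilinear[OF bounded_bilinear_scaleR assms(1)
              Ck_on_bounded_linear[OF bounded_linear_inner_left assms(1) fv] Suc.IH[OF f' gb]])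
    qed
  qed
qed

text \<open>The derivative of the reciprocal is a product of reciprocals and a derivative of
  \<open>f\<close>, so each class already known for the reciprocal gives the next one.\<close>

lemma Ck_on_inverse:
  fixes f :: "'a::euclidean_space \<Rightarrow> real"
  assumes "open U" "Ck_on k U f" "\<And>x. x \<in> U \<Longrightarrow> f x \<noteq> 0"
  shows "Ck_on k U (\<lambda>x. inverse (f x))"
  using assms(2)
proof (induction k)
  case 0
  then show ?case using assms(3) by (auto intro!: continuous_on_inverse)
next
  case (Suc k)
  have "Ck_on k U f" using Suc.prems Ck_on_Suc_imp by blast
  then have inv: "Ck_on k U (\<lambda>x. inverse (f x))" by (rule Suc.IH)
  have "Ck_on k U (\<lambda>x. - (inverse (f x) * frechet_derivative f (at x) v * inverse (f x)))" for v
    by (intro Ck_on_bounded_linear[OF bounded_linear_minus[OF bounded_linear_ident] assms(1)]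
        Ck_on_bounded_bilinear[OF bounded_bilinear_mult assms(1)] inv) (use Suc.prems in simp)
  moreover have "((\<lambda>x. inverse (f x)) has_derivative
      (\<lambda>v. - (inverse (f x) * frechet_derivative f (at x) v * inverse (f x)))) (at x)" if "x \<in> U" for x
    using Deriv.has_derivative_inverse[of f x, OF assms(3)[OF that] Ck_on_Suc_has_derivative[OF Suc.prems that]] .
  ultimately show ?case by (intro Ck_on_SucI[OF assms(1)])
qed

section \<open>Directional derivatives and the algebra of smooth maps\<close>

definition dir_deriv :: "'a \<Rightarrow> ('a::euclidean_space \<Rightarrow> 'b::real_normed_vector) \<Rightarrow> 'a \<Rightarrow> 'b" where
  "dir_deriv v f x = frechet_derivative f (at x) v"

lemma has_dir_deriv:
  assumes "smooth_on U f" "x \<in> U"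
  shows "(f has_derivative (\<lambda>v. dir_deriv v f x)) (at x)"
proof -
  have "Ck_on (Suc 0) U f" using assms by (simp add: smooth_on_def del: Ck_on.simps)
  then show ?thesis using Ck_on_Suc_has_derivative[of 0 U f x] assms by (simp add: dir_deriv_def[abs_def] del: Ck_on.simps)
qed

lemma dir_deriv_unique:
  assumes "(f has_derivative D) (at x)"
  shows "dir_deriv v f x = D v"
  using frechet_derivative_at[OF assms] by (simp add: dir_deriv_def)

lemma linear_dir_deriv:
  assumes "smooth_on U f" "x \<in> U"
  shows "linear (\<lambda>v. dir_deriv v f x)"
  by (rule has_derivative_linear[OF has_dir_deriv[OF assms]])

lemma smooth_on_open: "smooth_on U f \<Longrightarrow> open U"
  by (simp add: smooth_on_def)

lemma smooth_on_Ck: "smooth_on U f \<Longrightarrow> Ck_on k U f"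
  by (simp add: smooth_on_def)

lemma smooth_on_continuous: "smooth_on U f \<Longrightarrow> continuous_on U f"
  using smooth_on_Ck[of U f 0] by simp

lemma smooth_on_dir_deriv:
  assumes "smooth_on U f"
  shows "smooth_on U (dir_deriv v f)"
  unfolding smooth_on_def
proof (intro conjI allI)
  fix k
  have "Ck_on (Suc k) U f" using assms by (rule smooth_on_Ck)
  then show "Ck_on k U (dir_deriv v f)" by (simp add: dir_deriv_def[abs_def])
qed (rule smooth_on_open[OF assms])

lemma smooth_on_bounded_linear:
  "bounded_linear h \<Longrightarrow> smooth_on U f \<Longrightarrow> smooth_on U (\<lambda>x. h (f x))"
  by (simp add: smooth_on_def Ck_on_bounded_linear)

lemma smooth_on_add:
  "smooth_on U f \<Longrightarrow> smooth_on U g \<Longrightarrow> smooth_on U (\<lambda>x. f x + g x)"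
  by (simp add: smooth_on_def Ck_on_add)

lemma smooth_on_const: "open U \<Longrightarrow> smooth_on U (\<lambda>x. c)"
  by (simp add: smooth_on_def Ck_on_const)

lemma smooth_on_ident: "open U \<Longrightarrow> smooth_on U (\<lambda>x. x)"
proof -
  assume U: "open U"
  have "Ck_on k U (\<lambda>x. x)" for k
  proof (cases k)
    case (Suc k)
    then show ?thesis
      using Ck_on_SucI[OF U has_derivative_ident Ck_on_const] by simp
  qed simp
  then show ?thesis using U by (simp add: smooth_on_def)
qed

lemma smooth_on_compose:
  fixes f :: "'a::euclidean_space \<Rightarrow> 'b::euclidean_space"
  assumes "smooth_on U f" "smooth_on V g" "f ` U \<subseteq> V"
  shows "smooth_on U (\<lambda>x. g (f x))"
  unfolding smooth_on_def
  using Ck_on_compose[OF smooth_on_open smooth_on_Ck smooth_on_Ck, OF assms(1,1,2,3)] smooth_on_open[OF assms(1)]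
  by simp

lemma has_vector_derivative_line:
  assumes "smooth_on U f" "x + t *\<^sub>R v \<in> U"
  shows "((\<lambda>t. f (x + t *\<^sub>R v)) has_vector_derivative dir_deriv v f (x + t *\<^sub>R v)) (at t)"
proof -
  have 1: "((\<lambda>t. x + t *\<^sub>R v) has_vector_derivative v) (at t)"
    by (auto intro!: derivative_eq_intros)
  have "((f \<circ> (\<lambda>t. x + t *\<^sub>R v)) has_vector_derivative dir_deriv v f (x + t *\<^sub>R v)) (at t)"
    by (rule vector_derivative_diff_chain_within[OF 1])
       (rule has_derivative_at_withinI[OF has_dir_deriv[OF assms]])
  then show ?thesis by (simp add: o_def)
qed

lemma DERIV_line:
  fixes f :: "'a::euclidean_space \<Rightarrow> real"
  assumes "smooth_on U f" "x + t *\<^sub>R v \<in> U"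
  shows "((\<lambda>t. f (x + t *\<^sub>R v)) has_field_derivative dir_deriv v f (x + t *\<^sub>R v)) (at t)"
  using has_vector_derivative_line[OF assms] by (simp add: has_real_derivative_iff_has_vector_derivative)

section \<open>Symmetry of second derivatives\<close>

lemma second_difference_dir_deriv:
  fixes f :: "'a::euclidean_space \<Rightarrow> real"
  assumes f: "smooth_on U f" and x: "x \<in> U" and e: "e > 0"
  shows "\<exists>d>0. \<forall>t. 0 < t \<and> t < d \<longrightarrow>
     \<bar>f (x + t *\<^sub>R u + t *\<^sub>R v) - f (x + t *\<^sub>R u) - f (x + t *\<^sub>R v) + f x
        - t * t * dir_deriv v (dir_deriv u f) x\<bar> \<le> e * (t * t)"
proof -
  let ?h = "dir_deriv v (dir_deriv u f)"
  have U: "open U" using f by (rule smooth_on_open)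
  have fu: "smooth_on U (dir_deriv u f)" using f by (rule smooth_on_dir_deriv)
  have "continuous_on U ?h" using fu smooth_on_dir_deriv smooth_on_continuous by blast
  then obtain d1 where d1: "d1 > 0" "\<And>y. y \<in> U \<Longrightarrow> dist y x < d1 \<Longrightarrow> dist (?h y) (?h x) < e"
    using x e unfolding continuous_on_iff by metis
  obtain d2 where d2: "d2 > 0" "ball x d2 \<subseteq> U" using U x open_contains_ball by blast
  define d where "d = min d1 d2 / (norm u + norm v + 1)"
  have np: "norm u + norm v + 1 > 0" by (simp add: add_nonneg_pos)
  have d: "d > 0" using d1 d2 np by (simp add: d_def)
  have near: "norm (s *\<^sub>R u + r *\<^sub>R v) < min d1 d2" if "0 \<le> s" "s < d" "0 \<le> r" "r < d" for s r
  proof -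
    have "norm (s *\<^sub>R u + r *\<^sub>R v) \<le> s * norm u + r * norm v"
      using norm_triangle_ineq[of "s *\<^sub>R u" "r *\<^sub>R v"] that by simp
    also have "\<dots> \<le> d * norm u + d * norm v"
      using that by (intro add_mono mult_right_mono) auto
    also have "\<dots> < d * (norm u + norm v + 1)" using d by (simp add: algebra_simps)
    also have "\<dots> = min d1 d2" using np by (simp add: d_def)
    finally show ?thesis .
  qed
  have inU: "x + s *\<^sub>R u + r *\<^sub>R v \<in> U" and inB: "dist (x + s *\<^sub>R u + r *\<^sub>R v) x < d1"
    if "0 \<le> s" "s < d" "0 \<le> r" "r < d" for s r
    using near[OF that] d2(2) by (auto simp: dist_norm add.assoc subset_iff norm_minus_commute)
  have "\<bar>f (x + t *\<^sub>R u + t *\<^sub>R v) - f (x + t *\<^sub>R u) - f (x + t *\<^sub>R v) + f x - t * t * ?h x\<bar> \<le> e * (t * t)"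
    if t: "0 < t" "t < d" for t
  proof -
    \<comment> \<open>The mean value theorem is applied twice: in direction \<open>u\<close> to the
      difference over the step along \<open>v\<close>, then in direction \<open>v\<close> to the
      derivative obtained. What remains is the mixed derivative at an intermediate point, close to
      its value at \<open>x\<close> by continuity.\<close>
    let ?p = "\<lambda>s. f (x + s *\<^sub>R u + t *\<^sub>R v) - f (x + s *\<^sub>R u)"
    let ?p' = "\<lambda>s. dir_deriv u f (x + s *\<^sub>R u + t *\<^sub>R v) - dir_deriv u f (x + s *\<^sub>R u)"
    have "\<exists>z. 0 < z \<and> z < t \<and> ?p t - ?p 0 = (t - 0) * ?p' z"
    proof (rule MVT2[OF t(1)])
      fix s assume s: "0 \<le> s" "s \<le> t"
      have a: "x + s *\<^sub>R u + t *\<^sub>R v = x + t *\<^sub>R v + s *\<^sub>R u" for s by simp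
      show "(?p has_field_derivative ?p' s) (at s)"
        unfolding a
        by (intro DERIV_diff DERIV_line[OF f]) (use inU[of s t] inU[of s 0] s t in \<open>auto simp: a\<close>)
    qed
    then obtain z where z: "0 < z" "z < t" "?p t - ?p 0 = t * ?p' z" by auto
    have "\<exists>w. 0 < w \<and> w < t \<and> dir_deriv u f (x + z *\<^sub>R u + t *\<^sub>R v) - dir_deriv u f (x + z *\<^sub>R u + 0 *\<^sub>R v)
              = (t - 0) * ?h (x + z *\<^sub>R u + w *\<^sub>R v)"
      by (rule MVT2[OF t(1) DERIV_line[OF fu]]) (use inU z t in auto)
    then obtain w where w: "0 < w" "w < t" "?p' z = t * ?h (x + z *\<^sub>R u + w *\<^sub>R v)" by auto
    have "f (x + t *\<^sub>R u + t *\<^sub>R v) - f (x + t *\<^sub>R u) - f (x + t *\<^sub>R v) + f x = t * t * ?h (x + z *\<^sub>R u + w *\<^sub>R v)"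
      using z(3) w(3) by simp
    moreover have "\<bar>?h (x + z *\<^sub>R u + w *\<^sub>R v) - ?h x\<bar> < e"
      using d1(2)[OF inU[of z w] inB[of z w]] z w t by (simp add: dist_real_def)
    ultimately have "\<bar>f (x + t *\<^sub>R u + t *\<^sub>R v) - f (x + t *\<^sub>R u) - f (x + t *\<^sub>R v) + f x - t * t * ?h x\<bar>
        = (t * t) * \<bar>?h (x + z *\<^sub>R u + w *\<^sub>R v) - ?h x\<bar>"
      using t by (simp add: abs_mult flip: right_diff_distrib)
    also have "\<dots> \<le> (t * t) * e"
      using \<open>\<bar>?h (x + z *\<^sub>R u + w *\<^sub>R v) - ?h x\<bar> < e\<close> by (intro mult_left_mono) auto
    finally show ?thesis by (simp add: mult.commute)
  qed
  then show ?thesis using d by blast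
qed

text \<open>The second difference over a parallelogram does not change when \<open>u\<close> and
  \<open>v\<close> are swapped, and divided by the square of the step it approximates both mixed
  derivatives. A third of their supposed distance is taken as error, since two such errors cannot
  bridge the gap.\<close>

lemma dir_deriv_commute:
  fixes f :: "'a::euclidean_space \<Rightarrow> real"
  assumes f: "smooth_on U f" and x: "x \<in> U"
  shows "dir_deriv u (dir_deriv v f) x = dir_deriv v (dir_deriv u f) x"
proof (rule ccontr)
  let ?a = "dir_deriv v (dir_deriv u f) x" and ?b = "dir_deriv u (dir_deriv v f) x"
  assume ne: "?b \<noteq> ?a"
  define e where "e = \<bar>?a - ?b\<bar> / 3"
  have e: "e > 0" using ne by (simp add: e_def)
  obtain d1 where d1: "d1 > 0" "\<And>t. 0 < t \<and> t < d1 \<Longrightarrow>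
     \<bar>f (x + t *\<^sub>R u + t *\<^sub>R v) - f (x + t *\<^sub>R u) - f (x + t *\<^sub>R v) + f x - t * t * ?a\<bar> \<le> e * (t * t)"
    using second_difference_dir_deriv[OF f x e] by metis
  obtain d2 where d2: "d2 > 0" "\<And>t. 0 < t \<and> t < d2 \<Longrightarrow>
     \<bar>f (x + t *\<^sub>R v + t *\<^sub>R u) - f (x + t *\<^sub>R v) - f (x + t *\<^sub>R u) + f x - t * t * ?b\<bar> \<le> e * (t * t)"
    using second_difference_dir_deriv[OF f x e] by metis
  define t where "t = min d1 d2 / 2"
  have t: "0 < t" "t < d1" "t < d2" using d1(1) d2(1) by (auto simp: t_def)
  have "x + t *\<^sub>R v + t *\<^sub>R u = x + t *\<^sub>R u + t *\<^sub>R v" by simp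
  then have "\<bar>t * t * ?a - t * t * ?b\<bar> \<le> 2 * e * (t * t)"
    using d1(2)[of t] d2(2)[of t] t by (auto simp: abs_le_iff algebra_simps)
  then have "\<bar>?a - ?b\<bar> * (t * t) \<le> 2 * e * (t * t)"
    by (simp add: abs_mult mult.commute flip: right_diff_distrib)
  then have "\<bar>?a - ?b\<bar> \<le> 2 * e"
    by (rule mult_right_le_imp_le) (simp add: t)
  then show False using e by (simp add: e_def)
qed

section \<open>Smooth local inverses\<close>

lemma Ck_on_vec_lambda:
  fixes h :: "'n::finite \<Rightarrow> 'a::euclidean_space \<Rightarrow> real"
  assumes "open U" "\<And>i. Ck_on k U (h i)"
  shows "Ck_on k U (\<lambda>x. \<chi> i. h i x)"
proof -
  have eq: "(\<chi> i. h i x) = (\<Sum>i\<in>UNIV. h i x *\<^sub>R axis i 1)" for x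
    by (simp add: vec_eq_iff axis_def if_distrib cong: if_cong)
  show ?thesis
    unfolding eq
    by (rule Ck_on_sum[OF assms(1) Ck_on_bounded_bilinear[OF bounded_bilinear_scaleR assms(1) assms(2) Ck_on_const]])
qed

lemma Ck_on_det:
  fixes A :: "'a::euclidean_space \<Rightarrow> real^'n^'n"
  assumes "open U" "\<And>i j. Ck_on k U (\<lambda>x. A x $ i $ j)"
  shows "Ck_on k U (\<lambda>x. det (A x))"
  unfolding det_def
  by (rule Ck_on_sum[OF assms(1) Ck_on_bounded_bilinear[OF bounded_bilinear_mult assms(1) Ck_on_const
        Ck_on_prod[OF assms(1) assms(2)]]])

text \<open>Smoothness of the inverse follows inductively from Cramer's rule for its derivative.\<close>

lemma smooth_on_inverse_function:
  fixes f :: "real^'n \<Rightarrow> real^'n"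
  assumes f: "smooth_on U f" and x0: "x0 \<in> U" and inj: "inj (\<lambda>v. dir_deriv v f x0)"
  obtains U' V g where "open U'" "U' \<subseteq> U" "x0 \<in> U'" "homeomorphism U' V f g" "smooth_on V g"
proof -
  define f' where "f' x = Blinfun (\<lambda>v. dir_deriv v f x)" for x
  have U: "open U" using f by (rule smooth_on_open)
  have f': "blinfun_apply (f' x) = (\<lambda>v. dir_deriv v f x)" if "x \<in> U" for x
    unfolding f'_def
    by (rule bounded_linear_Blinfun_apply[OF has_derivative_bounded_linear[OF has_dir_deriv[OF f that]]])
  have der: "(f has_derivative blinfun_apply (f' x)) (at x)" if "x \<in> U" for x
    using has_dir_deriv[OF f that] by (simp add: f'[OF that])
  have cont: "continuous_on U f'"
  proof (rule continuous_on_blinfun_componentwise)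
    fix i
    have "continuous_on U (dir_deriv i f)"
      using smooth_on_continuous smooth_on_dir_deriv[OF f] by blast
    then show "continuous_on U (\<lambda>x. blinfun_apply (f' x) i)"
      by (rule continuous_on_eq) (simp add: f')
  qed
  have "linear (\<lambda>v. dir_deriv v f x0)" using linear_dir_deriv[OF f x0] .
  then obtain h where h: "linear h" "\<And>v. h (dir_deriv v f x0) = v"
    using linear_injective_isomorphism[OF _ inj] by auto
  have "Blinfun h o\<^sub>L f' x0 = id_blinfun"
    by (rule blinfun_eqI) (simp add: f'[OF x0] bounded_linear_Blinfun_apply linear_conv_bounded_linear[THEN iffD1, OF h(1)] h(2))
  then obtain U' V g g' where *: "open U'" "U' \<subseteq> U" "x0 \<in> U'" "open V" "f x0 \<in> V" "homeomorphism U' V f g"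
    "\<And>y. y \<in> V \<Longrightarrow> (g has_derivative (g' y)) (at y)"
    "\<And>y. y \<in> V \<Longrightarrow> g' y = inv_into UNIV (blinfun_apply (f'(g y)))"
    "\<And>y. y \<in> V \<Longrightarrow> bij (blinfun_apply (f'(g y)))"
    using inverse_function_theorem[OF U der cont x0] by metis
  have gU: "g ` V \<subseteq> U" using *(2,6) by (auto simp: homeomorphism_def)
  define M where "M y = matrix (\<lambda>v. dir_deriv v f (g y))" for y
  have Mentry: "M y $ i $ j = dir_deriv (axis j 1) f (g y) $ i" for y i j
    by (simp add: M_def matrix_def)
  have lin: "linear (\<lambda>v. dir_deriv v f (g y))" if "y \<in> V" for y
    using linear_dir_deriv[OF f] gU that by blast
  have Mnz: "det (M y) \<noteq> 0" if "y \<in> V" for y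
  proof -
    have "g y \<in> U" using gU that by blast
    then have "inj (\<lambda>v. dir_deriv v f (g y))" using *(9)[OF that] f' bij_is_inj by metis
    then show ?thesis using det_nz_iff_inj[OF lin[OF that]] by (simp add: M_def)
  qed
  have Mg: "M y *v g' y v = v" if "y \<in> V" for y v
  proof -
    have "g y \<in> U" using gU that by blast
    then have "dir_deriv (g' y v) f (g y) = v"
      using *(8,9)[OF that] f'[of "g y"] surj_f_inv_f[OF bij_is_surj] by simp
    then show ?thesis using matrix_works[of "\<lambda>v. dir_deriv v f (g y)"] lin[OF that]
      by (simp add: M_def linear_matrix_vector_mul_eq)
  qed
  have g': "g' y v = (\<chi> k. det (\<chi> i j. if j = k then v $ i else M y $ i $ j) * inverse (det (M y)))"
    if "y \<in> V" for y v
    using cramer[OF Mnz[OF that]] Mg[OF that] by (simp add: divide_inverse)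
  have "Ck_on k V g" for k
  proof (induction k)
    case 0
    show ?case using *(6) by (simp add: homeomorphism_def)
  next
    case (Suc k)
    have Mk: "Ck_on k V (\<lambda>y. M y $ i $ j)" for i j
      unfolding Mentry
      by (rule Ck_on_bounded_linear[OF bounded_linear_vec_nth *(4)
            Ck_on_compose[OF *(4) Suc.IH smooth_on_Ck[OF smooth_on_dir_deriv[OF f]] gU]])
    have "Ck_on k V (\<lambda>y. (\<chi> k. det (\<chi> i j. if j = k then v $ i else M y $ i $ j) * inverse (det (M y))))" for v
    proof (rule Ck_on_vec_lambda[OF *(4) Ck_on_bounded_bilinear[OF bounded_bilinear_mult *(4)]])
      show "Ck_on k V (\<lambda>y. inverse (det (M y)))"
        using Ck_on_inverse[OF *(4) Ck_on_det[OF *(4) Mk] Mnz] .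
      show "Ck_on k V (\<lambda>y. det (\<chi> i j. if j = m then v $ i else M y $ i $ j))" for m
      proof (rule Ck_on_det[OF *(4)])
        fix i j
        show "Ck_on k V (\<lambda>y. (\<chi> i j. if j = m then v $ i else M y $ i $ j) $ i $ j)"
          using Mk[of i j] Ck_on_const[of k V "v $ i"] by (cases "j = m") simp_all
      qed
    qed
    then have "Ck_on k V (\<lambda>y. g' y v)" for v
      using Ck_on_cong[OF *(4) g'[where y = y for y]] by simp
    with *(7) show ?case by (intro Ck_on_SucI[OF *(4)])
  qed
  then have "smooth_on V g" using *(4) by (simp add: smooth_on_def)
  with *(1,2,3,6) show ?thesis using that by blast
qed

section \<open>Charts whose inverse is the restriction of a linear map\<close>

text \<open>In \<open>submanifold3\<close> the inverse of a parametrization is merely continuous. If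
  it is the restriction of a linear map, the coordinate expression \<open>P (\<gamma> t)\<close> of
  a smooth curve is smooth at once, and \<open>P\<close> also reads off the coordinates of tangent
  vectors.\<close>

locale linear_chart =
  fixes L :: "(complex^3) set" and P :: "complex^3 \<Rightarrow> real^3"
    and V :: "(real^3) set" and \<Phi> :: "real^3 \<Rightarrow> complex^3"
  assumes linear_P: "linear P" and smooth_chart: "smooth_on V \<Phi>"
    and P_chart: "\<And>y. y \<in> V \<Longrightarrow> P (\<Phi> y) = y"
    and open_image: "openin (top_of_set L) (\<Phi> ` V)"

text \<open>A given parametrization is composed with the local inverse of its composite with
  \<open>P\<close>. The map \<open>D\<close> is fixed before \<open>P\<close>, so that
  \<open>P\<close> may afterwards be any linear map injective on the range of \<open>D\<close>, for
  instance orthogonal coordinates on the tangent plane.\<close>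

lemma linear_chart_exists:
  assumes L: "submanifold3 L" and x: "x \<in> L"
  obtains D :: "real^3 \<Rightarrow> complex^3" where "linear D" "inj D"
    "\<And>P. linear P \<Longrightarrow> inj (\<lambda>v. P (D v)) \<Longrightarrow>
       \<exists>V \<Phi> y. linear_chart L P V \<Phi> \<and> y \<in> V \<and> \<Phi> y = x \<and> range (\<lambda>v. dir_deriv v \<Phi> y) = range D"
proof -
  obtain W V and \<phi> :: "real^3 \<Rightarrow> complex^3" and \<psi> where xW: "x \<in> W" and W: "openin (top_of_set L) W" and \<phi>: "smooth_on V \<phi>"
    and inj: "\<And>q. q \<in> V \<Longrightarrow> inj (frechet_derivative \<phi> (at q))" and hom: "homeomorphism V W \<phi> \<psi>"
    using bspec[OF L[unfolded submanifold3_def] x] by (elim exE conjE) blast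
  define q where "q = \<psi> x"
  have q: "q \<in> V" "\<phi> q = x" using hom xW by (auto simp: q_def homeomorphism_def)
  define D where "D = (\<lambda>v. dir_deriv v \<phi> q)"
  have linD: "linear D" unfolding D_def using linear_dir_deriv[OF \<phi> q(1)] .
  have injD: "inj D" using inj[OF q(1)] by (simp add: D_def dir_deriv_def)
  have "\<exists>V \<Phi> y. linear_chart L P V \<Phi> \<and> y \<in> V \<and> \<Phi> y = x \<and> range (\<lambda>v. dir_deriv v \<Phi> y) = range D"
    if P: "linear P" and inj: "inj (\<lambda>v. P (D v))" for P :: "complex^3 \<Rightarrow> real^3"
  proof -
    have bP: "bounded_linear P" using P linear_conv_bounded_linear by blast
    have sP: "smooth_on V (\<lambda>y. P (\<phi> y))" by (rule smooth_on_bounded_linear[OF bP \<phi>])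
    have der: "((\<lambda>y. P (\<phi> y)) has_derivative (\<lambda>v. P (D v))) (at q)"
      unfolding D_def by (rule bounded_linear.has_derivative[OF bP has_dir_deriv[OF \<phi> q(1)]])
    have "inj (\<lambda>v. dir_deriv v (\<lambda>y. P (\<phi> y)) q)"
      using inj dir_deriv_unique[OF der] by simp
    then obtain U' V' g where *: "open U'" "U' \<subseteq> V" "q \<in> U'" "homeomorphism U' V' (\<lambda>y. P (\<phi> y)) g" "smooth_on V' g"
      using smooth_on_inverse_function[OF sP q(1)] by metis
    have gV: "g ` V' = U'" using *(4) by (simp add: homeomorphism_def)
    define \<Phi> where "\<Phi> = (\<lambda>y. \<phi> (g y))"
    define y where "y = P (\<phi> q)"
    have y: "y \<in> V'" "g y = q" using *(3,4) by (auto simp: y_def homeomorphism_def)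
    have s: "smooth_on V' \<Phi>"
      unfolding \<Phi>_def using smooth_on_compose[OF *(5) \<phi>] gV *(2) by simp
    have im: "\<Phi> ` V' = \<phi> ` U'" using gV by (auto simp: \<Phi>_def)
    have "openin (top_of_set V) U'"
      using *(1,2) by (simp add: open_subset)
    then have "openin (top_of_set W) (\<phi> ` U')"
      using homeomorphism_imp_open_map[OF hom] by blast
    then have o: "openin (top_of_set L) (\<Phi> ` V')"
      unfolding im using W openin_trans by blast
    have PPhi: "P (\<Phi> z) = z" if "z \<in> V'" for z using *(4) that by (simp add: \<Phi>_def homeomorphism_def)
    have lc: "linear_chart L P V' \<Phi>"
      using P s PPhi o by (rule linear_chart.intro)
    define E where "E = (\<lambda>v. dir_deriv v g y)"
    have gder: "(g has_derivative E) (at y)"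
      unfolding E_def by (rule has_dir_deriv[OF *(5) y(1)])
    have "(\<Phi> has_derivative (\<lambda>v. D (E v))) (at y)"
      unfolding \<Phi>_def using diff_chain_at[OF gder, of \<phi> D] has_dir_deriv[OF \<phi> q(1)] y(2)
      by (simp add: o_def D_def)
    then have DE: "dir_deriv v \<Phi> y = D (E v)" for v
      by (rule dir_deriv_unique)
    have "((\<lambda>z. P (\<Phi> z)) has_derivative (\<lambda>v. v)) (at y)"
      using PPhi has_derivative_transform_within_open[OF has_derivative_ident smooth_on_open[OF *(5)] y(1)] by metis
    moreover have "((\<lambda>z. P (\<Phi> z)) has_derivative (\<lambda>v. P (D (E v)))) (at y)"
      by (rule bounded_linear.has_derivative[OF bP]) fact
    \<comment> \<open>This makes \<open>E\<close> injective, hence surjective by equality of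
      dimensions, so the change of parameters preserves the range of the derivative.\<close>
    ultimately have "P (D (E v)) = v" for v
      using has_derivative_unique by metis
    then have "inj E" by (metis injI)
    then have "surj E"
      using linear_injective_imp_surjective[of E] has_derivative_linear[OF gder] by simp
    then have "range (\<lambda>v. dir_deriv v \<Phi> y) = range D"
      unfolding DE using image_image[of D E UNIV] by simp
    moreover have "\<Phi> y = x" using y q by (simp add: \<Phi>_def)
    ultimately show ?thesis using lc y(1) by blast
  qed
  with linD injD that show ?thesis by blast
qed

section \<open>Smooth curves and orthogonal projection\<close>

lemma open_contains_line:
  fixes y v :: "'a::real_normed_vector"
  assumes "open U" "y \<in> U"
  obtains \<epsilon> :: real where "0 < \<epsilon>" "\<And>t. t \<in> {-\<epsilon><..<\<epsilon>} \<Longrightarrow> y + t *\<^sub>R v \<in> U"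
proof -
  have "open ((\<lambda>t::real. y + t *\<^sub>R v) -` U)"
    using assms(1) by (intro open_vimage continuous_intros)
  moreover have "0 \<in> (\<lambda>t::real. y + t *\<^sub>R v) -` U" using assms(2) by simp
  ultimately obtain \<epsilon> where "0 < \<epsilon>" "ball 0 \<epsilon> \<subseteq> (\<lambda>t::real. y + t *\<^sub>R v) -` U"
    using open_contains_ball by metis
  then show ?thesis by (intro that) (auto simp: subset_iff dist_real_def)
qed

lemma smooth_on_line:
  fixes \<epsilon> :: real
  assumes "smooth_on U f" "\<And>t. t \<in> {-\<epsilon><..<\<epsilon>} \<Longrightarrow> y + t *\<^sub>R v \<in> U"
  shows "smooth_on {-\<epsilon><..<\<epsilon>} (\<lambda>t. f (y + t *\<^sub>R v))"
proof (rule smooth_on_compose[OF _ assms(1)])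
  show "smooth_on {-\<epsilon><..<\<epsilon>} (\<lambda>t. y + t *\<^sub>R v)"
    by (intro smooth_on_add smooth_on_const smooth_on_bounded_linear[OF bounded_linear_scaleR_left]
        smooth_on_ident open_greaterThanLessThan)
qed (use assms(2) in auto)

lemma smooth_on_has_vector_derivative:
  fixes f :: "real \<Rightarrow> 'a::real_normed_vector"
  assumes "smooth_on U f" "t \<in> U"
  shows "(f has_vector_derivative vector_derivative f (at t)) (at t)"
  using has_dir_deriv[OF assms] differentiableI_vector vector_derivative_works differentiable_def by blast

lemma normal_part_eqI:
  assumes "subspace T" "n \<in> T\<^sup>\<bottom>" "v - n \<in> T"
  shows "normal_part T v = n"
  unfolding normal_part_def
proof (rule the_equality)
  show "n \<in> T\<^sup>\<bottom> \<and> v - n \<in> T" using assms by simp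
next
  fix m assume m: "m \<in> T\<^sup>\<bottom> \<and> v - m \<in> T"
  have "(v - m) - (v - n) \<in> T" using m assms(1,3) subspace_diff by blast
  then have "n - m \<in> T" by simp
  moreover have "n - m \<in> T\<^sup>\<bottom>" using m assms(2) subspace_diff[OF subspace_orthogonal_comp] by blast
  ultimately show "m = n" by (auto simp: orthogonal_comp_def orthogonal_self)
qed

lemma normal_part:
  assumes "subspace T"
  shows "normal_part T v \<in> T\<^sup>\<bottom>" "v - normal_part T v \<in> T"
proof -
  obtain y z where "y \<in> span T" "\<And>w. w \<in> span T \<Longrightarrow> orthogonal z w" "v = y + z"
    using orthogonal_subspace_decomp_exists[of T v] by metis
  then have "z \<in> T\<^sup>\<bottom>" "v - z \<in> T"
    using assms by (auto simp: orthogonal_comp_def orthogonal_commute span_eq_iff[THEN iffD2])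
  with normal_part_eqI[OF assms this]
  show "normal_part T v \<in> T\<^sup>\<bottom>" "v - normal_part T v \<in> T" by auto
qed

lemma normal_part_add_tangent:
  assumes "subspace T" "t \<in> T"
  shows "normal_part T (v + t) = normal_part T v"
proof (rule normal_part_eqI[OF assms(1) normal_part(1)[OF assms(1)]])
  have "v + t - normal_part T v = (v - normal_part T v) + t" by simp
  then show "v + t - normal_part T v \<in> T"
    using subspace_add[OF assms(1) normal_part(2)[OF assms(1)] assms(2)] by metis
qed

lemma inner_normal_part:
  assumes "subspace T" "n \<in> T\<^sup>\<bottom>"
  shows "normal_part T v \<bullet> n = v \<bullet> n"
proof -
  have "(v - normal_part T v) \<bullet> n = 0"
    using normal_part(2)[OF assms(1)] assms(2) by (simp add: orthogonal_comp_def orthogonal_def)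
  then show ?thesis by (simp add: inner_diff_left)
qed

lemma J_nth [simp]: "J v $ k = \<i> * v $ k"
  by (simp add: J_def)

lemma inner_J_J [simp]: "J u \<bullet> J v = u \<bullet> v"
  by (simp add: inner_vec_def inner_complex_def add.commute)

lemma inner_J_commute: "u \<bullet> J v = - (J u \<bullet> v)"
  by (simp add: inner_vec_def inner_complex_def flip: sum_negf)

text \<open>Turns the vanishing of \<open>omega\<close> on a tangent space into orthogonality of
  that space to its image under \<open>J\<close>, the form in which the Lagrangian condition enters
  the computations.\<close>

lemma omega_eq: "omega u v = - of_real (u \<bullet> J v)"
proof -
  have "\<i> / 2 * (u $ k * cnj (v $ k) - v $ k * cnj (u $ k)) = - of_real (u $ k \<bullet> J v $ k)" for k
    by (simp add: complex_eq_iff inner_complex_def field_simps)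
  then show ?thesis
    by (simp add: omega_def inner_vec_def sum_distrib_left sum_negf of_real_sum del: J_nth)
qed

section \<open>Tangent space and second fundamental form in a chart\<close>

context linear_chart
begin

lemma open_V: "open V"
  using smooth_chart by (rule smooth_on_open)

lemma chart_in: "y \<in> V \<Longrightarrow> \<Phi> y \<in> L"
  using open_image openin_imp_subset by blast

lemma bounded_linear_P: "bounded_linear P"
  using linear_P linear_conv_bounded_linear by blast

lemma linear_deriv: "y \<in> V \<Longrightarrow> linear (\<lambda>v. dir_deriv v \<Phi> y)"
  by (rule linear_dir_deriv[OF smooth_chart])

lemma P_deriv:
  assumes "y \<in> V"
  shows "P (dir_deriv v \<Phi> y) = v"
proof -
  have "((\<lambda>z. P (\<Phi> z)) has_derivative (\<lambda>v. v)) (at y)"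
    using has_derivative_transform_within_open[OF has_derivative_ident open_V assms] P_chart by metis
  moreover have "((\<lambda>z. P (\<Phi> z)) has_derivative (\<lambda>v. P (dir_deriv v \<Phi> y))) (at y)"
    by (rule bounded_linear.has_derivative[OF bounded_linear_P has_dir_deriv[OF smooth_chart assms]])
  ultimately show ?thesis using has_derivative_unique by metis
qed

text \<open>The chart image is open in \<open>L\<close>, so a continuous curve in \<open>L\<close>
  through one of its points stays there for short times and is recovered from its
  coordinates.\<close>

lemma curve_in_chart:
  assumes y: "y \<in> V" and \<gamma>: "smooth_on {-\<epsilon><..<\<epsilon>} \<gamma>" "\<gamma> ` {-\<epsilon><..<\<epsilon>} \<subseteq> L" "\<gamma> 0 = \<Phi> y" "0 < (\<epsilon>::real)"
  obtains \<delta> where "0 < \<delta>" "\<delta> \<le> \<epsilon>" "\<And>t. t \<in> {-\<delta><..<\<delta>} \<Longrightarrow> P (\<gamma> t) \<in> V \<and> \<gamma> t = \<Phi> (P (\<gamma> t))"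
proof -
  obtain O' where O': "open O'" "\<Phi> ` V = L \<inter> O'"
    using open_image by (auto simp: openin_open)
  have "open ({-\<epsilon><..<\<epsilon>} \<inter> \<gamma> -` O')"
    by (rule continuous_open_preimage[OF smooth_on_continuous[OF \<gamma>(1)] open_greaterThanLessThan O'(1)])
  moreover have "0 \<in> {-\<epsilon><..<\<epsilon>} \<inter> \<gamma> -` O'"
    using \<gamma>(3,4) y O'(2) by auto
  ultimately obtain \<delta> where \<delta>: "0 < \<delta>" "ball 0 \<delta> \<subseteq> {-\<epsilon><..<\<epsilon>} \<inter> \<gamma> -` O'"
    using open_contains_ball by metis
  have "P (\<gamma> t) \<in> V \<and> \<gamma> t = \<Phi> (P (\<gamma> t))" if "t \<in> {-(min \<delta> \<epsilon>)<..<min \<delta> \<epsilon>}" for t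
  proof -
    have "t \<in> ball 0 \<delta>" "t \<in> {-\<epsilon><..<\<epsilon>}" using that by (auto simp: dist_real_def)
    then have "\<gamma> t \<in> \<Phi> ` V" using \<delta>(2) \<gamma>(2) O'(2) by blast
    then show ?thesis using P_chart by auto
  qed
  then show ?thesis using \<delta>(1) \<gamma>(4) by (intro that[of "min \<delta> \<epsilon>"]) auto
qed

lemma curve_velocity:
  assumes y: "y \<in> V" and \<gamma>: "smooth_on {-\<epsilon><..<\<epsilon>} \<gamma>" "\<gamma> ` {-\<epsilon><..<\<epsilon>} \<subseteq> L" "\<gamma> 0 = \<Phi> y" "0 < (\<epsilon>::real)"
  shows "((\<lambda>t. P (\<gamma> t)) has_vector_derivative P (vector_derivative \<gamma> (at 0))) (at 0)"
    and "vector_derivative \<gamma> (at 0) = dir_deriv (P (vector_derivative \<gamma> (at 0))) \<Phi> y"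
proof -
  let ?a = "vector_derivative \<gamma> (at 0)"
  obtain \<delta> where \<delta>: "0 < \<delta>" "\<delta> \<le> \<epsilon>" "\<And>t. t \<in> {-\<delta><..<\<delta>} \<Longrightarrow> P (\<gamma> t) \<in> V \<and> \<gamma> t = \<Phi> (P (\<gamma> t))"
    using curve_in_chart[OF y \<gamma>] by metis
  have a: "(\<gamma> has_vector_derivative ?a) (at 0)"
    by (rule smooth_on_has_vector_derivative[OF \<gamma>(1)]) (use \<gamma>(4) in auto)
  show P: "((\<lambda>t. P (\<gamma> t)) has_vector_derivative P ?a) (at 0)"
    by (rule bounded_linear.has_vector_derivative[OF bounded_linear_P a])
  have y': "P (\<gamma> 0) = y" using \<gamma>(3) P_chart[OF y] by simp
  have "((\<Phi> \<circ> (\<lambda>t. P (\<gamma> t))) has_vector_derivative dir_deriv (P ?a) \<Phi> y) (at 0)"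
    by (rule vector_derivative_diff_chain_within[OF P])
       (use has_derivative_at_withinI[OF has_dir_deriv[OF smooth_chart y]] y' in auto)
  then have "(\<gamma> has_vector_derivative dir_deriv (P ?a) \<Phi> y) (at 0)"
    by (rule has_vector_derivative_transform_within_open[of _ _ _ "{-\<delta><..<\<delta>}"]) (use \<delta> in auto)
  then show "?a = dir_deriv (P ?a) \<Phi> y"
    by (rule vector_derivative_at)
qed

lemma chart_line_curve:
  assumes "y \<in> V"
  obtains \<epsilon> :: real where "0 < \<epsilon>" "smooth_on {-\<epsilon><..<\<epsilon>} (\<lambda>t. \<Phi> (y + t *\<^sub>R v))"
    "(\<lambda>t. \<Phi> (y + t *\<^sub>R v)) ` {-\<epsilon><..<\<epsilon>} \<subseteq> L" "\<And>t. t \<in> {-\<epsilon><..<\<epsilon>} \<Longrightarrow> y + t *\<^sub>R v \<in> V"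
    "vector_derivative (\<lambda>t. \<Phi> (y + t *\<^sub>R v)) (at 0) = dir_deriv v \<Phi> y"
proof -
  obtain \<epsilon> :: real where \<epsilon>: "0 < \<epsilon>" "\<And>t. t \<in> {-\<epsilon><..<\<epsilon>} \<Longrightarrow> y + t *\<^sub>R v \<in> V"
    using open_contains_line[OF open_V assms] by metis
  show ?thesis
  proof (rule that[OF \<epsilon>(1) smooth_on_line[OF smooth_chart \<epsilon>(2)] _ \<epsilon>(2)])
    show "vector_derivative (\<lambda>t. \<Phi> (y + t *\<^sub>R v)) (at 0) = dir_deriv v \<Phi> y"
      using has_vector_derivative_line[OF smooth_chart, of y 0 v] assms by (intro vector_derivative_at) simp
  qed (use \<epsilon>(2) chart_in in auto)
qed

lemma tangent_space_chart:
  assumes y: "y \<in> V"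
  shows "tangent_space L (\<Phi> y) = range (\<lambda>v. dir_deriv v \<Phi> y)"
proof
  show "tangent_space L (\<Phi> y) \<subseteq> range (\<lambda>v. dir_deriv v \<Phi> y)"
  proof
    fix a assume "a \<in> tangent_space L (\<Phi> y)"
    then obtain \<gamma> and \<epsilon> :: real where "a = vector_derivative \<gamma> (at 0)" "0 < \<epsilon>" "smooth_on {-\<epsilon><..<\<epsilon>} \<gamma>"
        "\<gamma> ` {-\<epsilon><..<\<epsilon>} \<subseteq> L" "\<gamma> 0 = \<Phi> y"
      by (auto simp: tangent_space_def)
    then have "a = dir_deriv (P a) \<Phi> y" using curve_velocity(2)[OF y] by metis
    then show "a \<in> range (\<lambda>v. dir_deriv v \<Phi> y)" by blast
  qed
  show "range (\<lambda>v. dir_deriv v \<Phi> y) \<subseteq> tangent_space L (\<Phi> y)"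
  proof
    fix a assume "a \<in> range (\<lambda>v. dir_deriv v \<Phi> y)"
    then obtain v where a: "a = dir_deriv v \<Phi> y" by blast
    obtain \<epsilon> :: real where "0 < \<epsilon>" "smooth_on {-\<epsilon><..<\<epsilon>} (\<lambda>t. \<Phi> (y + t *\<^sub>R v))"
      "(\<lambda>t. \<Phi> (y + t *\<^sub>R v)) ` {-\<epsilon><..<\<epsilon>} \<subseteq> L"
      "vector_derivative (\<lambda>t. \<Phi> (y + t *\<^sub>R v)) (at 0) = dir_deriv v \<Phi> y"
      using chart_line_curve[OF y, of v] by metis
    then show "a \<in> tangent_space L (\<Phi> y)"
      unfolding tangent_space_def a
      by (intro CollectI exI[of _ "\<lambda>t. \<Phi> (y + t *\<^sub>R v)"] exI[of _ \<epsilon>]) auto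
  qed
qed

lemma subspace_tangent_space: "y \<in> V \<Longrightarrow> subspace (tangent_space L (\<Phi> y))"
  unfolding tangent_space_chart
  using linear_subspace_image[OF linear_deriv subspace_UNIV] by simp

lemma tangent_eq_deriv:
  assumes "y \<in> V" "a \<in> tangent_space L (\<Phi> y)"
  shows "a = dir_deriv (P a) \<Phi> y"
  using assms P_deriv[OF assms(1)] by (auto simp: tangent_space_chart)

lemma deriv_expansion:
  assumes "y \<in> V"
  shows "dir_deriv w \<Phi> y = (\<Sum>i\<in>UNIV. w $ i *\<^sub>R dir_deriv (axis i 1) \<Phi> y)"
proof -
  have w: "w = (\<Sum>i\<in>UNIV. w $ i *\<^sub>R axis i 1)"
    using basis_expansion[of w] by (simp add: scalar_mult_eq_scaleR)
  show ?thesis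
    by (subst w) (simp add: linear_sum[OF linear_deriv[OF assms]] linear_scale[OF linear_deriv[OF assms]])
qed

text \<open>The flat derivative, in the direction with coordinates \<open>u\<close>, of the tangent
  field with constant coordinates \<open>w\<close>. The sum over axes matches the expansion of an
  arbitrary tangent field in coordinate fields.\<close>

definition hessian :: "real^3 \<Rightarrow> real^3 \<Rightarrow> real^3 \<Rightarrow> complex^3" where
  "hessian y u w = (\<Sum>i\<in>UNIV. w $ i *\<^sub>R dir_deriv u (dir_deriv (axis i 1) \<Phi>) y)"

text \<open>Product rule for a tangent field written in the coordinate fields. Differentiating its
  coefficients contributes only a tangent vector; the rest depends on the velocity of the curve and
  the value of the field alone, which is why the second fundamental form is well defined.\<close>

lemma tangent_field_derivative:
  assumes y: "y \<in> V" and \<gamma>: "smooth_on {-\<epsilon><..<\<epsilon>} \<gamma>" "\<gamma> ` {-\<epsilon><..<\<epsilon>} \<subseteq> L" "\<gamma> 0 = \<Phi> y" "0 < (\<epsilon>::real)"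
    and Y: "smooth_on {-\<epsilon><..<\<epsilon>} Y" "\<And>t. t \<in> {-\<epsilon><..<\<epsilon>} \<Longrightarrow> Y t \<in> tangent_space L (\<gamma> t)"
  shows "vector_derivative Y (at 0) = hessian y (P (vector_derivative \<gamma> (at 0))) (P (Y 0))
     + dir_deriv (P (vector_derivative Y (at 0))) \<Phi> y"
proof -
  let ?a = "vector_derivative \<gamma> (at 0)" and ?Y' = "vector_derivative Y (at 0)"
  obtain \<delta> where \<delta>: "0 < \<delta>" "\<delta> \<le> \<epsilon>" "\<And>t. t \<in> {-\<delta><..<\<delta>} \<Longrightarrow> P (\<gamma> t) \<in> V \<and> \<gamma> t = \<Phi> (P (\<gamma> t))"
    using curve_in_chart[OF y \<gamma>] by metis
  have y': "P (\<gamma> 0) = y" using \<gamma>(3) P_chart[OF y] by simp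
  have c: "((\<lambda>t. P (\<gamma> t)) has_vector_derivative P ?a) (at 0)"
    using curve_velocity(1)[OF y \<gamma>] .
  have Y': "(Y has_vector_derivative ?Y') (at 0)"
    by (rule smooth_on_has_vector_derivative[OF Y(1)]) (use \<gamma>(4) in auto)
  let ?Z = "\<lambda>t. \<Sum>i\<in>UNIV. (P (Y t) $ i) *\<^sub>R dir_deriv (axis i 1) \<Phi> (P (\<gamma> t))"
  have eq: "?Z t = Y t" if "t \<in> {-\<delta><..<\<delta>}" for t
  proof -
    have V: "P (\<gamma> t) \<in> V" "\<gamma> t = \<Phi> (P (\<gamma> t))" using \<delta>(3)[OF that] by auto
    have "Y t \<in> tangent_space L (\<Phi> (P (\<gamma> t)))" using Y(2)[of t] that \<delta>(2) V(2) by auto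
    then show ?thesis using tangent_eq_deriv[OF V(1)] deriv_expansion[OF V(1)] by metis
  qed
  have d: "((\<lambda>t. dir_deriv (axis i 1) \<Phi> (P (\<gamma> t))) has_vector_derivative
      dir_deriv (P ?a) (dir_deriv (axis i 1) \<Phi>) y) (at 0)" for i
    using vector_derivative_diff_chain_within[OF c has_derivative_at_withinI[OF
        has_dir_deriv[OF smooth_on_dir_deriv[OF smooth_chart]]], of "axis i 1"] y y'
    by (simp add: o_def)
  have p: "((\<lambda>t. P (Y t) $ i) has_field_derivative P ?Y' $ i) (at 0)" for i
    unfolding has_real_derivative_iff_has_vector_derivative
    by (rule bounded_linear.has_vector_derivative[OF bounded_linear_vec_nth
          bounded_linear.has_vector_derivative[OF bounded_linear_P Y']])
  have "(?Z has_vector_derivative (\<Sum>i\<in>UNIV. P (Y 0) $ i *\<^sub>R dir_deriv (P ?a) (dir_deriv (axis i 1) \<Phi>) y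
      + (P ?Y' $ i) *\<^sub>R dir_deriv (axis i 1) \<Phi> (P (\<gamma> 0)))) (at 0)"
    by (intro has_vector_derivative_sum has_vector_derivative_scaleR d p)
  then have "(Y has_vector_derivative (\<Sum>i\<in>UNIV. P (Y 0) $ i *\<^sub>R dir_deriv (P ?a) (dir_deriv (axis i 1) \<Phi>) y
      + (P ?Y' $ i) *\<^sub>R dir_deriv (axis i 1) \<Phi> (P (\<gamma> 0)))) (at 0)"
    by (rule has_vector_derivative_transform_within_open[of _ _ _ "{-\<delta><..<\<delta>}"]) (use \<delta>(1) eq in auto)
  then show ?thesis
    using vector_derivative_at by (simp add: hessian_def sum.distrib y' deriv_expansion[OF y, of "P ?Y'"])
qed

lemma second_fundamental_form_chart:
  assumes y: "y \<in> V" and a: "a \<in> tangent_space L (\<Phi> y)" and b: "b \<in> tangent_space L (\<Phi> y)"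
  shows "second_fundamental_form L (\<Phi> y) a b = normal_part (tangent_space L (\<Phi> y)) (hessian y (P a) (P b))"
    (is "_ = ?n")
proof -
  let ?T = "tangent_space L (\<Phi> y)"
  have T: "subspace ?T" using subspace_tangent_space[OF y] .
  have unique: "normal_part ?T (vector_derivative Y (at 0)) = ?n"
    if "0 < (\<epsilon>::real)" "smooth_on {-\<epsilon><..<\<epsilon>} \<gamma>" "\<gamma> ` {-\<epsilon><..<\<epsilon>} \<subseteq> L" "\<gamma> 0 = \<Phi> y"
      "vector_derivative \<gamma> (at 0) = a" "smooth_on {-\<epsilon><..<\<epsilon>} Y"
      "\<forall>t\<in>{-\<epsilon><..<\<epsilon>}. Y t \<in> tangent_space L (\<gamma> t)" "Y 0 = b" for \<gamma> Y \<epsilon>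
  proof -
    have "vector_derivative Y (at 0) = hessian y (P a) (P b) + dir_deriv (P (vector_derivative Y (at 0))) \<Phi> y"
      using tangent_field_derivative[OF y that(2,3,4,1,6)] that by auto
    moreover have "dir_deriv (P (vector_derivative Y (at 0))) \<Phi> y \<in> ?T"
      by (simp add: tangent_space_chart[OF y])
    ultimately show ?thesis using normal_part_add_tangent[OF T] by metis
  qed
  obtain \<epsilon> :: real where \<epsilon>: "0 < \<epsilon>" "smooth_on {-\<epsilon><..<\<epsilon>} (\<lambda>t. \<Phi> (y + t *\<^sub>R P a))"
    "(\<lambda>t. \<Phi> (y + t *\<^sub>R P a)) ` {-\<epsilon><..<\<epsilon>} \<subseteq> L" "\<And>t. t \<in> {-\<epsilon><..<\<epsilon>} \<Longrightarrow> y + t *\<^sub>R P a \<in> V"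
    "vector_derivative (\<lambda>t. \<Phi> (y + t *\<^sub>R P a)) (at 0) = dir_deriv (P a) \<Phi> y"
    using chart_line_curve[OF y, of "P a"] by metis
  \<comment> \<open>Witnesses for existence: a coordinate line with velocity \<open>a\<close> and,
    along it, the field with the constant coordinates of \<open>b\<close>.\<close>
  let ?\<gamma> = "\<lambda>t. \<Phi> (y + t *\<^sub>R P a)" and ?Y = "\<lambda>t. dir_deriv (P b) \<Phi> (y + t *\<^sub>R P a)"
  have 1: "smooth_on {-\<epsilon><..<\<epsilon>} ?Y"
    by (rule smooth_on_line[OF smooth_on_dir_deriv[OF smooth_chart] \<epsilon>(4)])
  have 2: "\<forall>t\<in>{-\<epsilon><..<\<epsilon>}. ?Y t \<in> tangent_space L (?\<gamma> t)"
    using tangent_space_chart[OF \<epsilon>(4)] by auto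
  have 3: "?\<gamma> 0 = \<Phi> y" "vector_derivative ?\<gamma> (at 0) = a" "?Y 0 = b"
    using \<epsilon>(5) tangent_eq_deriv[OF y a] tangent_eq_deriv[OF y b] by auto
  show ?thesis
    unfolding second_fundamental_form_def
  proof (rule the_equality)
    show "\<exists>\<gamma> Y \<epsilon>. 0 < (\<epsilon>::real) \<and>
        smooth_on {-\<epsilon><..<\<epsilon>} \<gamma> \<and> \<gamma> ` {-\<epsilon><..<\<epsilon>} \<subseteq> L \<and> \<gamma> 0 = \<Phi> y \<and>
        vector_derivative \<gamma> (at 0) = a \<and>
        smooth_on {-\<epsilon><..<\<epsilon>} Y \<and> (\<forall>t\<in>{-\<epsilon><..<\<epsilon>}. Y t \<in> tangent_space L (\<gamma> t)) \<and> Y 0 = b \<and>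
        ?n = normal_part (tangent_space L (\<Phi> y)) (vector_derivative Y (at 0))"
      using \<epsilon>(1,2,3) 1 2 3 unique[OF \<epsilon>(1,2,3) 3(1,2) 1 2 3(3)]
      by (intro exI[of _ ?\<gamma>] exI[of _ ?Y] exI[of _ \<epsilon>]) simp
  next
    fix n assume "\<exists>\<gamma> Y \<epsilon>. 0 < (\<epsilon>::real) \<and>
        smooth_on {-\<epsilon><..<\<epsilon>} \<gamma> \<and> \<gamma> ` {-\<epsilon><..<\<epsilon>} \<subseteq> L \<and> \<gamma> 0 = \<Phi> y \<and>
        vector_derivative \<gamma> (at 0) = a \<and>
        smooth_on {-\<epsilon><..<\<epsilon>} Y \<and> (\<forall>t\<in>{-\<epsilon><..<\<epsilon>}. Y t \<in> tangent_space L (\<gamma> t)) \<and> Y 0 = b \<and>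
        n = normal_part (tangent_space L (\<Phi> y)) (vector_derivative Y (at 0))"
    then show "n = ?n" by (elim exE conjE) (simp add: unique)
  qed
qed

text \<open>\<open>J\<close> sends tangent vectors to normal ones, so pairing with such a vector
  absorbs the normal projection in the second fundamental form.\<close>

lemma fundamental_cubic_chart:
  assumes L: "special_lagrangian L" and y: "y \<in> V"
  shows "fundamental_cubic L (\<Phi> y) (dir_deriv u \<Phi> y) (dir_deriv v \<Phi> y) (dir_deriv w \<Phi> y)
      = hessian y u v \<bullet> J (dir_deriv w \<Phi> y)"
proof -
  let ?T = "tangent_space L (\<Phi> y)"
  have T: "dir_deriv z \<Phi> y \<in> ?T" for z by (simp add: tangent_space_chart[OF y])
  have "J (dir_deriv w \<Phi> y) \<in> ?T\<^sup>\<bottom>"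
    using L chart_in[OF y] T[of w]
    by (auto simp: special_lagrangian_def omega_eq orthogonal_comp_def orthogonal_def)
  then show ?thesis
    unfolding fundamental_cubic_def second_fundamental_form_chart[OF y T T]
    by (simp add: inner_normal_part[OF subspace_tangent_space[OF y]] P_deriv[OF y])
qed

end

section \<open>The normal form of the cubic\<close>

text \<open>The witnesses are the double transpositions (1 2)(3 4) and (1 3)(2 4).\<close>

lemma alt_group_4_klein_four:
  obtains p q where "p \<in> carrier (alt_group 4)" "q \<in> carrier (alt_group 4)"
    "p \<circ> p = id" "q \<circ> q = id" "p \<circ> q = q \<circ> p" "p \<noteq> id" "q \<noteq> id" "p \<noteq> q"
proof
  let ?p = "Transposition.transpose 1 2 \<circ> Transposition.transpose 3 (4::nat)" and ?q = "Transposition.transpose 1 3 \<circ> Transposition.transpose 2 (4::nat)"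
  show "?p \<in> carrier (alt_group 4)" "?q \<in> carrier (alt_group 4)"
    by (auto simp: alt_group_carrier evenperm_comp permutation_swap_id evenperm_swap
        intro!: permutes_compose permutes_swap_id)
  show "?p \<circ> ?p = id" "?q \<circ> ?q = id" "?p \<circ> ?q = ?q \<circ> ?p"
    by (auto simp: fun_eq_iff Transposition.transpose_def)
  show "?p \<noteq> id" "?q \<noteq> id" "?p \<noteq> ?q"
    by (rule notI, drule fun_cong[where x = 1], simp add: Transposition.transpose_def)+
qed

lemma SO_groupD:
  assumes "h \<in> carrier (SO_group T)"
  shows "h \<in> Bij T" "\<And>u. u \<in> T \<Longrightarrow> h u \<in> T"
    "\<And>u v. u \<in> T \<Longrightarrow> v \<in> T \<Longrightarrow> h (u + v) = h u + h v"
    "\<And>r u. u \<in> T \<Longrightarrow> h (r *\<^sub>R u) = r *\<^sub>R h u"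
    "\<And>u v. u \<in> T \<Longrightarrow> v \<in> T \<Longrightarrow> h u \<bullet> h v = u \<bullet> v"
    "\<And>e :: 3 \<Rightarrow> complex^3. (\<And>i j. e i \<bullet> e j = (if i = j then 1 else 0)) \<Longrightarrow> span (range e) = T \<Longrightarrow>
        det (\<chi> i j. e i \<bullet> h (e j) :: real^3^3) = 1"
  using assms Bij_imp_funcset[of h T] by (auto simp: SO_group_def)

lemma SO_group_mult:
  assumes "g \<in> carrier (SO_group T)" "h \<in> carrier (SO_group T)"
  shows "g \<otimes>\<^bsub>SO_group T\<^esub> h = compose T g h"
  using SO_groupD(1)[OF assms(1)] SO_groupD(1)[OF assms(2)] by (simp add: SO_group_def BijGroup_def)

text \<open>The isomorphism pulls the Klein four-group back to \<open>H\<close>. Elements of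
  \<open>SO_group T\<close> are extensional, so distinct ones already differ at a point of
  \<open>T\<close>; this is how the three inequalities survive the transfer.\<close>

lemma commuting_involutions:
  assumes H: "subgroup H (SO_group T)"
    and iso: "(SO_group T)\<lparr>carrier := H\<rparr> \<cong> alt_group 4"
  obtains a b where "a \<in> H" "b \<in> H" "\<And>x. x \<in> T \<Longrightarrow> a (a x) = x" "\<And>x. x \<in> T \<Longrightarrow> b (b x) = x"
    "\<And>x. x \<in> T \<Longrightarrow> a (b x) = b (a x)"
    "\<exists>x\<in>T. a x \<noteq> x" "\<exists>x\<in>T. b x \<noteq> x" "\<exists>x\<in>T. a x \<noteq> b x"
proof -
  let ?S = "SO_group T"
  have HS: "H \<subseteq> carrier ?S" using H by (rule subgroup.subset)
  obtain f where f: "f \<in> hom (?S\<lparr>carrier := H\<rparr>) (alt_group 4)" "bij_betw f H (carrier (alt_group 4))"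
    using iso by (auto simp: is_iso_def iso_def)
  have mult: "f (compose T g h) = f g \<circ> f h" if "g \<in> H" "h \<in> H" for g h
  proof -
    have "f (g \<otimes>\<^bsub>?S\<^esub> h) = f g \<circ> f h"
      using hom_mult[OF f(1), of g h] that by (simp add: alt_group_mult)
    moreover have "g \<otimes>\<^bsub>?S\<^esub> h = compose T g h" using SO_group_mult[of g T h] that HS by auto
    ultimately show ?thesis by simp
  qed
  have closed: "compose T g h \<in> H" if "g \<in> H" "h \<in> H" for g h
    using subgroup.m_closed[OF H that] SO_group_mult[of g T h] that HS by (simp add: subsetD)
  have inj: "g = h" if "f g = f h" "g \<in> H" "h \<in> H" for g h
    using that bij_betw_imp_inj_on[OF f(2)] by (auto dest: inj_onD)
  define I where "I = (\<lambda>x\<in>T. x)"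
  have I: "I \<in> H" using subgroup.one_closed[OF H] by (simp add: I_def SO_group_def BijGroup_def)
  have fI: "f I = id"
  proof -
    have "compose T I I = I" by (auto simp: I_def compose_def fun_eq_iff)
    then have eq: "f I \<circ> f I = f I" using mult[OF I I] by simp
    have "f I permutes {1..4}" using bij_betwE[OF f(2)] I by (auto simp: alt_group_carrier)
    then have "bij (f I)" by (rule permutes_bij)
    then show ?thesis using eq by (metis bij_is_inj comp_id fun.inj_map_strong inj_eq comp_apply eq_id_iff)
  qed
  have ext: "g x = h x" if "g = h" for g h :: "complex^3 \<Rightarrow> complex^3" and x using that by simp
  obtain p q where pq: "p \<in> carrier (alt_group 4)" "q \<in> carrier (alt_group 4)"
    "p \<circ> p = id" "q \<circ> q = id" "p \<circ> q = q \<circ> p" "p \<noteq> id" "q \<noteq> id" "p \<noteq> q"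
    by (rule alt_group_4_klein_four)
  obtain a b where ab: "a \<in> H" "b \<in> H" "f a = p" "f b = q"
    using pq(1,2) f(2) by (metis bij_betw_imp_surj_on imageE)
  have "compose T a a = I" "compose T b b = I" "compose T a b = compose T b a"
    using pq ab closed I by (auto intro!: inj simp: mult fI)
  then have *: "compose T a a x = I x" "compose T b b x = I x" "compose T a b x = compose T b a x" for x
    by simp_all
  have ne: "\<exists>x\<in>T. g x \<noteq> h x" if "g \<noteq> h" "g \<in> H" "h \<in> H" for g h
  proof (rule ccontr)
    assume "\<not> ?thesis"
    moreover have "g \<in> extensional T" "h \<in> extensional T"
      using that HS SO_groupD(1) Bij_imp_extensional by blast+
    ultimately show False using that(1) by (auto intro: extensionalityI)
  qed
  show ?thesis
  proof (rule that[OF ab(1,2)])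
    show "a (a x) = x" "b (b x) = x" "a (b x) = b (a x)" if "x \<in> T" for x
      using *[of x] that by (simp_all add: compose_def I_def)
    show "\<exists>x\<in>T. a x \<noteq> x" "\<exists>x\<in>T. b x \<noteq> x" "\<exists>x\<in>T. a x \<noteq> b x"
      using ne[of a I] ne[of b I] ne[of a b] ab pq I fI by (auto simp: I_def)
  qed
qed

lemma finite_card_3_enumerate:
  assumes "finite S" "card S = 3"
  obtains e :: "3 \<Rightarrow> 'a" where "bij_betw e UNIV S"
  using finite_same_card_bij[of "UNIV :: 3 set" S] assms by auto

text \<open>Simultaneous diagonalization: the joint eigenspaces \<open>E p\<close>, indexed by pairs
  of signs, are mutually orthogonal and span \<open>T\<close>, so orthonormal bases of them combine
  to one of \<open>T\<close>.\<close>

lemma simultaneous_eigenframe: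
  fixes a b :: "complex^3 \<Rightarrow> complex^3"
  assumes T: "subspace T" "dim T = 3" and a: "a \<in> carrier (SO_group T)" and b: "b \<in> carrier (SO_group T)"
    and inv: "\<And>x. x \<in> T \<Longrightarrow> a (a x) = x" "\<And>x. x \<in> T \<Longrightarrow> b (b x) = x" "\<And>x. x \<in> T \<Longrightarrow> a (b x) = b (a x)"
  obtains e s t where "\<And>i j. e i \<bullet> e j = (if i = j then 1 else 0)" "span (range e) = T"
    "\<And>i::3. a (e i) = s i *\<^sub>R e i" "\<And>i. b (e i) = t i *\<^sub>R e i" "\<And>i. s i \<in> {1, -1}" "\<And>i. t i \<in> {1, -1}"
proof -
  note A = SO_groupD[OF a] and B = SO_groupD[OF b]
  define S where "S = {1, - 1 :: real} \<times> {1, - 1 :: real}"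
  define E where "E p = {x \<in> T. a x = fst p *\<^sub>R x \<and> b x = snd p *\<^sub>R x}" for p
  have a0: "a 0 = 0" "b 0 = 0"
    using A(4)[of 0 0] B(4)[of 0 0] T(1) by (simp_all add: subspace_0)
  have sub: "subspace (E p)" for p
    unfolding subspace_def E_def using T(1) a0 A(3,4) B(3,4)
    by (auto simp: subspace_0 subspace_add subspace_scale scaleR_add_right mult.commute)
  have "\<exists>B. B \<subseteq> E p \<and> pairwise orthogonal B \<and> (\<forall>x\<in>B. norm x = 1) \<and> span B = E p" for p
    using orthonormal_basis_subspace[OF sub[of p]] by metis
  then obtain W where W: "\<And>p. W p \<subseteq> E p" "\<And>p. pairwise orthogonal (W p)"
      "\<And>p x. x \<in> W p \<Longrightarrow> norm x = 1" "\<And>p. span (W p) = E p"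
    by metis
  have orthE: "x \<bullet> y = 0" if "x \<in> E p" "y \<in> E p'" "p \<in> S" "p' \<in> S" "p \<noteq> p'" for x y p p'
  proof -
    have "a x \<bullet> a y = (fst p * fst p') * (x \<bullet> y)" "b x \<bullet> b y = (snd p * snd p') * (x \<bullet> y)"
      using that(1,2) by (auto simp: E_def)
    moreover have "a x \<bullet> a y = x \<bullet> y" "b x \<bullet> b y = x \<bullet> y"
      using that(1,2) A(5)[of x y] B(5)[of x y] by (auto simp: E_def)
    \<comment> \<open>For different pairs of signs one of the two isometries also reverses the inner
      product, which must then vanish.\<close>
    moreover have "fst p * fst p' = -1 \<or> snd p * snd p' = -1"
      using that(3,4,5) by (auto simp: S_def)
    ultimately show ?thesis by auto
  qed
  define Z where "Z = (\<Union>p\<in>S. W p)"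
  have norm1: "norm x = 1" if "x \<in> Z" for x using that W(3) by (auto simp: Z_def)
  have orth: "pairwise orthogonal Z"
  proof (rule pairwiseI)
    fix x y assume xy: "x \<in> Z" "y \<in> Z" "x \<noteq> y"
    then obtain p p' where p: "p \<in> S" "p' \<in> S" "x \<in> W p" "y \<in> W p'" by (auto simp: Z_def)
    show "orthogonal x y"
    proof (cases "p = p'")
      case True
      then show ?thesis using W(2)[of p] p xy(3) by (auto simp: pairwise_def)
    next
      case False
      have "x \<in> E p" "y \<in> E p'" using p(3,4) W(1) by blast+
      then show ?thesis using orthE p(1,2) False unfolding orthogonal_def by blast
    qed
  qed
  have ZT: "Z \<subseteq> T" using W(1) by (auto simp: Z_def E_def)
  have indep: "independent Z"
    using norm1 by (intro pairwise_orthogonal_independent[OF orth]) force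
  have "T \<subseteq> span Z"
  proof
    fix x assume x: "x \<in> T"
    \<comment> \<open>\<open>Q p\<close> is the projection (1 + s a)(1 + t b)/4 onto the joint
      eigenspace for \<open>p = (s, t)\<close>. The four projections add up to the identity, so the
      eigenspaces span \<open>T\<close>.\<close>
    define Q where "Q p = (1/4) *\<^sub>R (x + fst p *\<^sub>R a x + snd p *\<^sub>R b x + (fst p * snd p) *\<^sub>R a (b x))" for p :: "real \<times> real"
    have t: "a x \<in> T" "b x \<in> T" "a (b x) \<in> T" using x A(2) B(2) by auto
    have tt: "r *\<^sub>R u \<in> T" "u + v \<in> T" if "u \<in> T" "v \<in> T" for r u v
      using T(1) that by (auto simp: subspace_scale subspace_add)
    have "Q p \<in> E p" if p: "p \<in> S" for p
    proof -
      have sq: "fst p * fst p = 1" "snd p * snd p = 1" using p by (auto simp: S_def)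
      have "a (Q p) = (1/4) *\<^sub>R (a x + fst p *\<^sub>R x + snd p *\<^sub>R a (b x) + (fst p * snd p) *\<^sub>R b x)"
        using x t by (simp add: Q_def A(3,4) tt inv)
      also have "\<dots> = fst p *\<^sub>R Q p" by (simp add: Q_def algebra_simps sq flip: mult.assoc)
      finally have 1: "a (Q p) = fst p *\<^sub>R Q p" .
      have "b (Q p) = (1/4) *\<^sub>R (b x + fst p *\<^sub>R a (b x) + snd p *\<^sub>R x + (fst p * snd p) *\<^sub>R a x)"
        using x t by (simp add: Q_def B(3,4) tt inv flip: inv(3))
      also have "\<dots> = snd p *\<^sub>R Q p"
        using sq by (simp add: Q_def algebra_simps mult.left_commute[of "snd p" "fst p" "snd p"])
      finally have 2: "b (Q p) = snd p *\<^sub>R Q p" .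
      have "Q p \<in> T" unfolding Q_def
        by (intro subspace_scale[OF T(1)] subspace_add[OF T(1)] x t)
      with 1 2 show ?thesis by (simp add: E_def)
    qed
    moreover have "E p \<subseteq> span Z" if "p \<in> S" for p
      using span_mono[of "W p" Z] W(4)[of p] that by (auto simp: Z_def)
    ultimately have Q: "Q p \<in> span Z" if "p \<in> S" for p using that by blast
    have "x = Q (1,1) + Q (1,-1) + Q (-1,1) + Q (-1,-1)"
      by (simp add: Q_def vec_eq_iff complex_eq_iff field_simps)
    moreover have "Q (1,1) + Q (1,-1) + Q (-1,1) + Q (-1,-1) \<in> span Z"
      by (intro span_add Q) (auto simp: S_def)
    ultimately show "x \<in> span Z" by simp
  qed
  then have span: "span Z = T"
    using ZT T(1) by (metis span_eq span_eq_iff span_mono subset_antisym)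
  have fin: "finite Z" using indep by (rule independent_imp_finite)
  have "card Z = 3" using T(2) dim_eq_card_independent[OF indep] span dim_span by metis
  then obtain e :: "3 \<Rightarrow> complex^3" where e: "bij_betw e UNIV Z"
    using finite_card_3_enumerate[OF fin] by metis
  have eZ: "e i \<in> Z" for i using e by (auto simp: bij_betw_def)
  have "\<exists>p\<in>S. a (e i) = fst p *\<^sub>R e i \<and> b (e i) = snd p *\<^sub>R e i" for i
    using eZ[of i] W(1) by (auto simp: Z_def E_def)
  then obtain r where r: "\<And>i. r i \<in> S" "\<And>i. a (e i) = fst (r i) *\<^sub>R e i" "\<And>i. b (e i) = snd (r i) *\<^sub>R e i"
    by metis
  show ?thesis
  proof (rule that[of e "\<lambda>i. fst (r i)" "\<lambda>i. snd (r i)"])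
    show "e i \<bullet> e j = (if i = j then 1 else 0)" for i j
    proof (cases "i = j")
      case True
      then show ?thesis using norm1[OF eZ[of j]] by (simp add: norm_eq_1)
    next
      case False
      then have "e i \<noteq> e j" using e by (auto simp: bij_betw_def inj_eq)
      then show ?thesis using orth eZ False by (auto simp: pairwise_def orthogonal_def)
    qed
    show "span (range e) = T" using e span by (simp add: bij_betw_def)
    show "fst (r i) \<in> {1, -1}" "snd (r i) \<in> {1, -1}" for i using r(1)[of i] by (auto simp: S_def)
  qed (use r in auto)
qed

lemma prod_3: "prod f (UNIV :: 3 set) = f 1 * f 2 * f 3"
  unfolding UNIV_3 by (simp add: ac_simps)

lemma signs_with_product_1:
  fixes s :: "3 \<Rightarrow> real"
  assumes "\<And>i. s i \<in> {1, -1}" "prod s UNIV = 1" "\<exists>i. s i \<noteq> 1"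
  shows "(s 1, s 2, s 3) \<in> {(1, -1, -1), (-1, 1, -1), (-1, -1, 1)}"
proof -
  have "s 1 \<noteq> 1 \<or> s 2 \<noteq> 1 \<or> s 3 \<noteq> 1" using assms(3) exhaust_3 by metis
  then show ?thesis using assms(1)[of 1] assms(1)[of 2] assms(1)[of 3] assms(2) by (auto simp: prod_3)
qed

text \<open>A nontrivial sign vector of product 1 has exactly one positive entry. Two different such
  vectors have it in different places, so no coordinate is fixed by both.\<close>

lemma klein_four_signs:
  fixes s t :: "3 \<Rightarrow> real"
  assumes "\<And>i. s i \<in> {1, -1}" "\<And>i. t i \<in> {1, -1}" "prod s UNIV = 1" "prod t UNIV = 1"
    "\<exists>i. s i \<noteq> 1" "\<exists>i. t i \<noteq> 1" "\<exists>i. s i \<noteq> t i"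
  shows "s k \<noteq> 1 \<or> t k \<noteq> 1"
proof -
  have "s 1 \<noteq> t 1 \<or> s 2 \<noteq> t 2 \<or> s 3 \<noteq> t 3"
    using assms(7) exhaust_3 by metis
  then have "(s 1 \<noteq> 1 \<or> t 1 \<noteq> 1) \<and> (s 2 \<noteq> 1 \<or> t 2 \<noteq> 1) \<and> (s 3 \<noteq> 1 \<or> t 3 \<noteq> 1)"
    using signs_with_product_1[OF assms(1,3,5)] signs_with_product_1[OF assms(2,4,6)] by auto
  then show ?thesis using exhaust_3[of k] by auto
qed

text \<open>Already the Klein four-group in \<open>A\<^sub>4\<close> forces the cubic to be a multiple of \<open>x\<^sub>1 x\<^sub>2 x\<^sub>3\<close>
  in a suitable orthonormal frame.\<close>

lemma cubic_normal_form:
  fixes C :: "complex^3 \<Rightarrow> complex^3 \<Rightarrow> complex^3 \<Rightarrow> real"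
  assumes T: "subspace T" "dim T = 3" and H: "subgroup H (SO_group T)" "H \<subseteq> cubic_stabilizer T C"
    and iso: "(SO_group T)\<lparr>carrier := H\<rparr> \<cong> alt_group 4"
    and C: "\<And>r s t u v w. u \<in> T \<Longrightarrow> v \<in> T \<Longrightarrow> w \<in> T \<Longrightarrow> C (r *\<^sub>R u) (s *\<^sub>R v) (t *\<^sub>R w) = r * s * t * C u v w"
  obtains e where "\<And>i j :: 3. e i \<bullet> e j = (if i = j then 1 else 0)" "span (range e) = T"
    "\<And>i j k. i = j \<or> j = k \<or> i = k \<Longrightarrow> C (e i) (e j) (e k) = 0"
proof -
  obtain a b where ab: "a \<in> H" "b \<in> H" "\<And>x. x \<in> T \<Longrightarrow> a (a x) = x" "\<And>x. x \<in> T \<Longrightarrow> b (b x) = x"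
    "\<And>x. x \<in> T \<Longrightarrow> a (b x) = b (a x)"
    "\<exists>x\<in>T. a x \<noteq> x" "\<exists>x\<in>T. b x \<noteq> x" "\<exists>x\<in>T. a x \<noteq> b x"
    by (rule commuting_involutions[OF H(1) iso]) (rule that; assumption)
  have SO: "a \<in> carrier (SO_group T)" "b \<in> carrier (SO_group T)"
    using ab(1,2) subgroup.subset[OF H(1)] by auto
  note A = SO_groupD[OF SO(1)] and B = SO_groupD[OF SO(2)]
  obtain e s t where e: "\<And>i j. e i \<bullet> e j = (if i = j then 1 else 0)" "span (range e) = T"
    and st: "\<And>i::3. a (e i) = s i *\<^sub>R e i" "\<And>i. b (e i) = t i *\<^sub>R e i" "\<And>i. s i \<in> {1, -1}" "\<And>i. t i \<in> {1, -1}"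
    by (rule simultaneous_eigenframe[OF T SO ab(3-5)]) (assumption | rule that)+
  have eT: "e i \<in> T" for i using e(2) span_superset[of "range e"] by auto
  have det: "prod r UNIV = 1"
    if "h \<in> carrier (SO_group T)" "\<And>i. h (e i) = r i *\<^sub>R e i" for h and r :: "3 \<Rightarrow> real"
  proof -
    have "det (\<chi> i j. e i \<bullet> h (e j) :: real^3^3) = prod r UNIV"
      by (subst det_diagonal) (simp_all add: that(2) e(1))
    then show ?thesis using SO_groupD(6)[OF that(1) e] by simp
  qed
  \<comment> \<open>A rotation is determined on \<open>T\<close> by its values on the frame. Hence
    the inequalities between \<open>a\<close>, \<open>b\<close> and the identity become inequalities
    between sign vectors.\<close>
  have agree: "g x = h x"
    if "g \<in> carrier (SO_group T)" "\<And>u v. u \<in> T \<Longrightarrow> v \<in> T \<Longrightarrow> h (u + v) = h u + h v"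
      "\<And>r u. u \<in> T \<Longrightarrow> h (r *\<^sub>R u) = r *\<^sub>R h u" "\<And>i. g (e i) = h (e i)" "x \<in> T"
    for g h :: "complex^3 \<Rightarrow> complex^3" and x
  proof -
    note G = SO_groupD[OF that(1)]
    have "g 0 = h 0" using G(4)[of 0 0] that(3)[of 0 0] T(1) by (simp add: subspace_0)
    then have "subspace {x \<in> T. g x = h x}"
      unfolding subspace_def using T(1) G(3,4) that(2,3) by (auto simp: subspace_0 subspace_add subspace_scale)
    moreover have "range e \<subseteq> {x \<in> T. g x = h x}" using eT that(4) by auto
    ultimately have "span (range e) \<subseteq> {x \<in> T. g x = h x}" by (rule span_minimal[rotated])
    then show ?thesis using e(2) that(5) by auto
  qed
  have "\<exists>i. s i \<noteq> 1"
  proof (rule ccontr)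
    assume "\<not> ?thesis"
    then have "a (e i) = e i" for i using st(1) by simp
    then show False using agree[OF SO(1), of "\<lambda>x. x"] ab(6) by auto
  qed
  moreover have "\<exists>i. t i \<noteq> 1"
  proof (rule ccontr)
    assume "\<not> ?thesis"
    then have "b (e i) = e i" for i using st(2) by simp
    then show False using agree[OF SO(2), of "\<lambda>x. x"] ab(7) by auto
  qed
  moreover have "\<exists>i. s i \<noteq> t i"
  proof (rule ccontr)
    assume "\<not> ?thesis"
    then have "a (e i) = b (e i)" for i using st(1,2) by simp
    then show False using agree[OF SO(1), of b] ab(8) B(3,4) by auto
  qed
  ultimately have sgn: "s k \<noteq> 1 \<or> t k \<noteq> 1" for k
    using klein_four_signs[OF st(3,4) det[OF SO(1) st(1)] det[OF SO(2) st(2)]] by blast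
  have stab: "C (e i) (e j) (e k) = r i * r j * r k * C (e i) (e j) (e k)"
    if "h \<in> H" "\<And>i. h (e i) = r i *\<^sub>R e i" for h r i j k
  proof -
    have "C (h (e i)) (h (e j)) (h (e k)) = C (e i) (e j) (e k)"
      using H(2) that(1) eT by (auto simp: cubic_stabilizer_def)
    then show ?thesis using C[OF eT eT eT] by (simp add: that(2))
  qed
  have "C (e i) (e j) (e k) = 0" if "i = j \<or> j = k \<or> i = k" for i j k
  proof (rule ccontr)
    assume "C (e i) (e j) (e k) \<noteq> 0"
    then have "s i * s j * s k = 1" "t i * t j * t k = 1"
      using stab[OF ab(1) st(1), of i j k] stab[OF ab(2) st(2), of i j k] by auto
    moreover have "s l * s l = 1" "t l * t l = 1" for l using st(3,4)[of l] by auto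
    \<comment> \<open>When two of the three indices agree, their signs cancel, and the remaining
      index carries the sign 1 for both involutions, contrary to \<open>sgn\<close>.\<close>
    ultimately have "\<exists>l. s l = 1 \<and> t l = 1" using that by (metis mult.commute mult.left_neutral mult.assoc)
    then show False using sgn by auto
  qed
  with e that show ?thesis by blast
qed

section \<open>Second-order jets of functions of one variable\<close>

text \<open>A Peano expansion: \<open>c\<close> is the coefficient of the square, hence half the
  second derivative of a smooth function. Neither differentiability nor the value at 0 enters, so
  the notion also covers functions whose values are chosen separately for each parameter.\<close>

definition jet2 :: "(real \<Rightarrow> real) \<Rightarrow> real \<Rightarrow> real \<Rightarrow> real \<Rightarrow> bool" where
  "jet2 f a b c \<longleftrightarrow> ((\<lambda>t. (f t - (a + b * t + c * t\<^sup>2)) / t\<^sup>2) \<longlongrightarrow> 0) (at 0)"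

lemma jet2_const: "jet2 (\<lambda>t. a) a 0 0"
  by (simp add: jet2_def)

lemma jet2_cong:
  assumes "jet2 f a b c" "\<forall>\<^sub>F t in at 0. f t = g t"
  shows "jet2 g a b c"
  using assms(1) unfolding jet2_def
  by (rule Lim_transform_eventually) (use assms(2) in \<open>auto elim: eventually_mono\<close>)

lemma jet2_add:
  assumes "jet2 f a b c" "jet2 g a' b' c'"
  shows "jet2 (\<lambda>t. f t + g t) (a + a') (b + b') (c + c')"
  using tendsto_add[OF assms[unfolded jet2_def]] unfolding jet2_def
  by (simp add: algebra_simps flip: add_divide_distrib diff_divide_distrib)

lemma jet2_minus:
  assumes "jet2 f a b c"
  shows "jet2 (\<lambda>t. - f t) (- a) (- b) (- c)"
proof -
  have "(- f t - (- a + - b * t + - c * t\<^sup>2)) / t\<^sup>2 = - ((f t - (a + b * t + c * t\<^sup>2)) / t\<^sup>2)" for t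
    unfolding minus_divide_left by (rule arg_cong[where f = "\<lambda>z. z / t\<^sup>2"]) simp
  then show ?thesis
    using tendsto_minus[OF assms[unfolded jet2_def]] by (simp add: jet2_def)
qed

lemma jet2_mult:
  assumes "jet2 f a b c" "jet2 g a' b' c'"
  shows "jet2 (\<lambda>t. f t * g t) (a * a') (a * b' + b * a') (a * c' + b * b' + c * a')"
proof -
  define R where "R t = (f t - (a + b * t + c * t\<^sup>2)) / t\<^sup>2" for t
  define S where "S t = (g t - (a' + b' * t + c' * t\<^sup>2)) / t\<^sup>2" for t
  have R: "(R \<longlongrightarrow> 0) (at 0)" and S: "(S \<longlongrightarrow> 0) (at 0)"
    using assms by (simp_all add: jet2_def R_def[abs_def] S_def[abs_def])
  let ?E = "\<lambda>t. R t * (a' + b' * t + c' * t\<^sup>2) + (a + b * t + c * t\<^sup>2) * S t + t\<^sup>2 * (R t * S t)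
      + t * (b * c' + c * b') + t\<^sup>2 * (c * c')"
  have "(?E \<longlongrightarrow> 0 * (a' + b' * 0 + c' * 0\<^sup>2) + (a + b * 0 + c * 0\<^sup>2) * 0 + 0\<^sup>2 * (0 * 0)
      + 0 * (b * c' + c * b') + 0\<^sup>2 * (c * c')) (at 0)"
    by (intro tendsto_intros R S)
  then have "(?E \<longlongrightarrow> 0) (at 0)" by simp
  moreover have "?E t = (f t * g t - (a * a' + (a * b' + b * a') * t + (a * c' + b * b' + c * a') * t\<^sup>2)) / t\<^sup>2"
    if "t \<noteq> 0" for t
  proof -
    have f: "f t = a + b * t + c * t\<^sup>2 + t\<^sup>2 * R t" and g: "g t = a' + b' * t + c' * t\<^sup>2 + t\<^sup>2 * S t"
      using that by (simp_all add: R_def S_def)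
    show ?thesis
      unfolding f g using that by (simp add: field_simps power2_eq_square)
  qed
  then have "\<forall>\<^sub>F t in at 0. ?E t = (f t * g t - (a * a' + (a * b' + b * a') * t + (a * c' + b * b' + c * a') * t\<^sup>2)) / t\<^sup>2"
    by (auto simp: eventually_at_filter)
  ultimately show ?thesis
    unfolding jet2_def by (rule Lim_transform_eventually)
qed

lemma jet2_sum:
  assumes "\<And>i. i \<in> I \<Longrightarrow> jet2 (f i) (a i) (b i) (c i)"
  shows "jet2 (\<lambda>t. \<Sum>i\<in>I. f i t) (\<Sum>i\<in>I. a i) (\<Sum>i\<in>I. b i) (\<Sum>i\<in>I. c i)"
  using assms
  by (induction I rule: infinite_finite_induct) (auto intro: jet2_add jet2_const)

text \<open>Meant for \<open>h\<close> an entry of an inverse metric, of which a bound is known but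
  no regularity.\<close>

lemma jet2_bounded_mult:
  assumes "jet2 f 0 0 0" "\<forall>\<^sub>F t in at 0. \<bar>h t\<bar> \<le> K"
  shows "jet2 (\<lambda>t. h t * f t) 0 0 0"
proof -
  have 0: "((\<lambda>t. K * norm (f t / t\<^sup>2)) \<longlongrightarrow> 0) (at 0)"
    using tendsto_mult[OF tendsto_const[of K] tendsto_norm_zero[of "\<lambda>t. f t / t\<^sup>2"]] assms(1)
    by (simp add: jet2_def)
  have "\<forall>\<^sub>F t in at 0. norm (h t * f t / t\<^sup>2) \<le> K * norm (f t / t\<^sup>2)"
    using assms(2) by eventually_elim (simp add: abs_mult mult_right_mono divide_right_mono)
  then have "((\<lambda>t. h t * f t / t\<^sup>2) \<longlongrightarrow> 0) (at 0)"
    using 0 by (rule Lim_null_comparison)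
  then show ?thesis by (simp add: jet2_def)
qed

text \<open>The coefficients are recovered one after the other as limits, after multiplying the
  quotient by the square of \<open>t\<close>, by \<open>t\<close>, and by 1.\<close>

lemma jet2_zero_unique:
  assumes "jet2 (\<lambda>t. 0) a b c"
  shows "a = 0" "b = 0" "c = 0"
proof -
  have q: "((\<lambda>t. (a + b * t + c * t\<^sup>2) / t\<^sup>2) \<longlongrightarrow> 0) (at 0)"
    using jet2_minus[OF assms] unfolding jet2_def by (simp add: algebra_simps)
  have "((\<lambda>t. (a + b * t + c * t\<^sup>2) / t\<^sup>2 * t\<^sup>2) \<longlongrightarrow> 0 * 0\<^sup>2) (at 0)"
    by (intro tendsto_intros q)
  then have "((\<lambda>t. (a + b * t + c * t\<^sup>2) / t\<^sup>2 * t\<^sup>2) \<longlongrightarrow> 0) (at 0)" by simp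
  then have "((\<lambda>t. a + b * t + c * t\<^sup>2) \<longlongrightarrow> 0) (at 0)"
    by (rule Lim_transform_eventually) (auto simp: eventually_at_filter)
  moreover have "((\<lambda>t. a + b * t + c * t\<^sup>2) \<longlongrightarrow> a + b * 0 + c * 0\<^sup>2) (at 0)"
    by (intro tendsto_intros)
  ultimately show a: "a = 0" using tendsto_unique[of "at (0::real)"] by fastforce
  have "((\<lambda>t. (a + b * t + c * t\<^sup>2) / t\<^sup>2 * t) \<longlongrightarrow> 0 * 0) (at 0)"
    by (intro tendsto_intros q)
  then have "((\<lambda>t. (a + b * t + c * t\<^sup>2) / t\<^sup>2 * t) \<longlongrightarrow> 0) (at 0)" by simp
  then have "((\<lambda>t. b + c * t) \<longlongrightarrow> 0) (at 0)"
    by (rule Lim_transform_eventually) (auto simp: eventually_at_filter a field_simps power2_eq_square)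
  moreover have "((\<lambda>t. b + c * t) \<longlongrightarrow> b + c * 0) (at 0)"
    by (intro tendsto_intros)
  ultimately show b: "b = 0" using tendsto_unique[of "at (0::real)"] by fastforce
  have "((\<lambda>t. c) \<longlongrightarrow> 0) (at (0::real))"
    using q by (rule Lim_transform_eventually) (auto simp: eventually_at_filter a b)
  then show "c = 0" by (simp add: tendsto_const_iff)
qed

lemma jet2_unique:
  assumes "jet2 f a b c" "jet2 g a' b' c'" "\<forall>\<^sub>F t in at 0. f t = g t"
  shows "a = a'" "b = b'" "c = c'"
proof -
  have "jet2 (\<lambda>t. f t + - g t) (a + - a') (b + - b') (c + - c')"
    by (intro jet2_add jet2_minus assms)
  then have "jet2 (\<lambda>t. 0) (a + - a') (b + - b') (c + - c')"
    by (rule jet2_cong) (use assms(3) in \<open>auto elim: eventually_mono\<close>)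
  from jet2_zero_unique[OF this] show "a = a'" "b = b'" "c = c'" by auto
qed

text \<open>One application of L'Hopital's rule reduces the remainder to the difference quotient of
  \<open>f'\<close> at 0, so it is enough that \<open>f'\<close> is differentiable at that
  point.\<close>

lemma jet2_Taylor:
  assumes "\<forall>\<^sub>F t in nhds 0. (f has_field_derivative f' t) (at t)" "(f' has_field_derivative c) (at 0)"
  shows "jet2 f (f 0) (f' 0) (c / 2)"
proof -
  let ?r = "\<lambda>t. f t - (f 0 + f' 0 * t + c / 2 * t\<^sup>2)"
  have d0: "(f has_field_derivative f' 0) (at 0)"
    using assms(1) by (rule eventually_nhds_x_imp_x)
  have "((\<lambda>t. (f' t - f' 0) / t - c) \<longlongrightarrow> c - c) (at 0)"
    using assms(2) by (intro tendsto_intros) (simp add: has_field_derivative_iff)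
  then have "((\<lambda>t. ((f' t - f' 0) / t - c) / 2) \<longlongrightarrow> 0 / 2) (at 0)"
    by (intro tendsto_intros) auto
  then have "((\<lambda>t. (f' t - (0 + f' 0 * 1 + c / 2 * (2 * t))) / (2 * t)) \<longlongrightarrow> 0) (at 0)"
    by (simp) (rule Lim_transform_eventually, auto simp: eventually_at_filter field_simps)
  moreover have "(?r \<longlongrightarrow> 0) (at 0)"
  proof -
    have "(f \<longlongrightarrow> f 0) (at 0)" using DERIV_isCont[OF d0] by (simp add: isCont_def)
    then have "(?r \<longlongrightarrow> f 0 - (f 0 + f' 0 * 0 + c / 2 * 0\<^sup>2)) (at 0)"
      by (intro tendsto_intros)
    then show ?thesis by simp
  qed
  moreover have "((\<lambda>t. t\<^sup>2) \<longlongrightarrow> 0) (at (0::real))"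
    using tendsto_power[OF tendsto_ident_at[of "0::real" UNIV], of 2] by simp
  ultimately have "((\<lambda>t. ?r t / t\<^sup>2) \<longlongrightarrow> 0) (at 0)"
  proof (intro lhopital[where f = ?r and g = "\<lambda>t. t\<^sup>2"
        and f' = "\<lambda>t. f' t - (0 + f' 0 * 1 + c / 2 * (2 * t))" and g' = "\<lambda>t. 2 * t"])
    show "\<forall>\<^sub>F t in at 0. (?r has_field_derivative f' t - (0 + f' 0 * 1 + c / 2 * (2 * t))) (at t)"
      using assms(1) unfolding eventually_at_filter
      by eventually_elim (auto intro!: derivative_eq_intros)
    show "\<forall>\<^sub>F t in at (0::real). ((\<lambda>t. t\<^sup>2) has_field_derivative 2 * t) (at t)"
      by (auto intro!: derivative_eq_intros always_eventually)
  qed (auto simp: eventually_at_filter)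
  then show ?thesis by (simp add: jet2_def)
qed

lemma jet2_line:
  fixes f :: "'a::euclidean_space \<Rightarrow> real"
  assumes f: "smooth_on U f" and y: "y \<in> U"
  shows "jet2 (\<lambda>t. f (y + t *\<^sub>R v)) (f y) (dir_deriv v f y) (dir_deriv v (dir_deriv v f) y / 2)"
proof -
  obtain \<epsilon> :: real where \<epsilon>: "0 < \<epsilon>" "\<And>t. t \<in> {-\<epsilon><..<\<epsilon>} \<Longrightarrow> y + t *\<^sub>R v \<in> U"
    using open_contains_line[OF smooth_on_open[OF f] y, of v] by metis
  have "\<forall>\<^sub>F t in nhds 0. t \<in> {-\<epsilon><..<\<epsilon>}"
    using \<epsilon>(1) by (intro eventually_nhds_in_open) auto
  then have "\<forall>\<^sub>F t in nhds 0. ((\<lambda>t. f (y + t *\<^sub>R v)) has_field_derivative dir_deriv v f (y + t *\<^sub>R v)) (at t)"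
    by eventually_elim (rule DERIV_line[OF f \<epsilon>(2)])
  moreover have "((\<lambda>t. dir_deriv v f (y + t *\<^sub>R v)) has_field_derivative dir_deriv v (dir_deriv v f) y) (at 0)"
    using DERIV_line[OF smooth_on_dir_deriv[OF f], of y 0 v v] y by simp
  ultimately show ?thesis using jet2_Taylor by fastforce
qed

text \<open>If \<open>G (1 + E) = 1\<close> with \<open>E = t\<^sup>2 n + o(t\<^sup>2)\<close>, then \<open>G = 1 - E + G E\<^sup>2\<close>,
  so boundedness of \<open>G\<close> determines its 2-jet.\<close>

lemma jet2_inverse_matrix:
  fixes G g :: "3 \<Rightarrow> 3 \<Rightarrow> real \<Rightarrow> real"
  assumes inv: "\<And>i l. \<forall>\<^sub>F t in at 0. (\<Sum>j\<in>UNIV. G i j t * g j l t) = (if i = l then 1 else 0)"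
    and bound: "\<And>i j. \<forall>\<^sub>F t in at 0. \<bar>G i j t\<bar> \<le> K"
    and g: "\<And>i j. jet2 (g i j) (if i = j then 1 else 0) 0 (n i j)"
  shows "jet2 (G i l) (if i = l then 1 else 0) 0 (- n i l)"
proof -
  define d where "d i j = (if i = j then 1 else 0 :: real)" for i j :: 3
  define E where "E i j t = g i j t + - d i j" for i j t
  have E: "jet2 (E i j) 0 0 (n i j)" for i j
    using jet2_add[OF g[of i j] jet2_const[of "- d i j"]] by (auto simp: E_def[abs_def] d_def)
  define Q where "Q j l t = (\<Sum>m\<in>UNIV. E j m t * E m l t)" for j l t
  have "jet2 (\<lambda>t. E j m t * E m l t) 0 0 0" for j m l
    using jet2_mult[OF E E, of j m m l] by simp
  then have "jet2 (Q j l) 0 0 0" for j l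
    using jet2_sum[of UNIV "\<lambda>m t. E j m t * E m l t" "\<lambda>_. 0" "\<lambda>_. 0" "\<lambda>_. 0"]
    by (simp add: Q_def[abs_def])
  then have GQ: "jet2 (\<lambda>t. \<Sum>j\<in>UNIV. G i j t * Q j l t) 0 0 0" for i l
    using jet2_sum[of UNIV "\<lambda>j t. G i j t * Q j l t" "\<lambda>_. 0" "\<lambda>_. 0" "\<lambda>_. 0"]
      jet2_bounded_mult[OF _ bound] by simp
  have "jet2 (\<lambda>t. d i l + - E i l t + (\<Sum>j\<in>UNIV. G i j t * Q j l t)) (d i l + - 0 + 0) (0 + - 0 + 0) (0 + - n i l + 0)"
    by (intro jet2_add jet2_minus jet2_const E GQ)
  moreover have "\<forall>\<^sub>F t in at 0. d i l + - E i l t + (\<Sum>j\<in>UNIV. G i j t * Q j l t) = G i l t"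
  proof -
    have "\<forall>\<^sub>F t in at 0. \<forall>m. (\<Sum>j\<in>UNIV. G i j t * g j m t) = d i m"
      using inv by (intro eventually_all_finite) (simp add: d_def)
    then show ?thesis
    proof eventually_elim
      case (elim t)
      have GE: "(\<Sum>j\<in>UNIV. G i j t * E j m t) = d i m - G i m t" for m
      proof -
        have "(\<Sum>j\<in>UNIV. G i j t * E j m t) = (\<Sum>j\<in>UNIV. G i j t * g j m t) - (\<Sum>j\<in>UNIV. G i j t * d j m)"
          by (simp add: E_def algebra_simps sum_subtractf)
        also have "(\<Sum>j\<in>UNIV. G i j t * d j m) = G i m t"
          by (simp add: d_def if_distrib cong: if_cong)
        finally show ?thesis using elim by simp
      qed
      have "(\<Sum>j\<in>UNIV. G i j t * Q j l t) = (\<Sum>m\<in>UNIV. (\<Sum>j\<in>UNIV. G i j t * E j m t) * E m l t)"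
        unfolding Q_def sum_distrib_left sum_distrib_right by (subst sum.swap) (simp add: mult.assoc)
      also have "\<dots> = (\<Sum>m\<in>UNIV. (d i m - G i m t) * E m l t)"
        by (simp only: GE)
      also have "\<dots> = (\<Sum>m\<in>UNIV. d i m * E m l t) - (\<Sum>m\<in>UNIV. G i m t * E m l t)"
        by (simp add: left_diff_distrib sum_subtractf)
      also have "(\<Sum>m\<in>UNIV. d i m * E m l t) = E i l t"
        by (simp add: d_def if_distrib[of "\<lambda>z. z * _"] cong: if_cong)
      also have "(\<Sum>m\<in>UNIV. G i m t * E m l t) = d i l - G i l t"
        by (rule GE)
      finally show ?case by simp
    qed
  qed
  ultimately have "jet2 (G i l) (d i l + - 0 + 0) (0 + - 0 + 0) (0 + - n i l + 0)"
    by (rule jet2_cong)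
  then show ?thesis by (simp add: d_def)
qed

section \<open>The jet equations of the normal form\<close>

lemma sum_prod_assoc:
  fixes A :: "'i \<Rightarrow> real"
  shows "(\<Sum>j\<in>K. (\<Sum>a\<in>I. A a * B a j) * c j) = (\<Sum>a\<in>I. A a * (\<Sum>j\<in>K. B a j * c j))"
  unfolding sum_distrib_left sum_distrib_right by (subst sum.swap) (simp add: mult.assoc)

lemma sum_delta_mult:
  fixes f :: "'i::finite \<Rightarrow> real"
  shows "(\<Sum>j\<in>UNIV. (if i = j then 1 else 0) * f j) = f i"
  by (simp add: if_distrib[of "\<lambda>z. z * _"] cong: if_cong)

text \<open>The symmetric trilinear form whose cubic is \<open>6 * r\<close> times the monomial x1
  x2 x3, each of the six orderings of distinct indices contributing \<open>r\<close>.\<close>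

definition xyz :: "real \<Rightarrow> 3 \<Rightarrow> 3 \<Rightarrow> 3 \<Rightarrow> real" where
  "xyz r i j k = (if i \<noteq> j \<and> j \<noteq> k \<and> i \<noteq> k then r else 0)"

lemma symmetric_cubic_eq_xyz:
  assumes sym: "\<And>i j k. X i j k = X j i k" "\<And>i j k. X i j k = X i k j"
    and 0: "\<And>i j k. i = j \<or> j = k \<or> i = k \<Longrightarrow> X i j k = 0"
  shows "X = xyz (X 1 2 3)"
proof (intro ext)
  fix i j k
  have "X 1 3 2 = X 1 2 3" "X 2 1 3 = X 1 2 3" "X 2 3 1 = X 1 2 3" "X 3 1 2 = X 1 2 3" "X 3 2 1 = X 1 2 3"
    using sym by metis+
  then show "X i j k = xyz (X 1 2 3) i j k"
    using exhaust_3[of i] exhaust_3[of j] exhaust_3[of k] 0 by (auto simp: xyz_def)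
qed

text \<open>With \<open>W\<close> the components of an orthonormal frame and \<open>p\<close> the inverse matrix, \<open>G = W\<^sup>T W\<close> is
  the inverse of the metric \<open>p p\<^sup>T\<close>.\<close>

lemma inverse_metric_contractions:
  fixes X :: "3 \<Rightarrow> 3 \<Rightarrow> 3 \<Rightarrow> real" and W p :: "3 \<Rightarrow> 3 \<Rightarrow> real"
  assumes sym: "\<And>i j k. X i j k = X j i k" "\<And>i j k. X i j k = X i k j"
    and pW: "\<And>i j. (\<Sum>c\<in>UNIV. p i c * W c j) = (if i = j then 1 else 0)"
    and nf: "\<And>a b c. (\<Sum>m\<in>UNIV. W c m * (\<Sum>j\<in>UNIV. (\<Sum>k\<in>UNIV. X m j k * W b k) * W a j)) = xyz r c a b"
    and G: "\<And>i j. G i j = (\<Sum>a\<in>UNIV. W a i * W a j)"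
  shows "(\<Sum>i\<in>UNIV. \<Sum>j\<in>UNIV. G i j * X i j k) = 0"
    and "(\<Sum>j\<in>UNIV. \<Sum>k\<in>UNIV. X i j k * (\<Sum>k'\<in>UNIV. G k k' * (\<Sum>j'\<in>UNIV. G j j' * X l j' k')))
       = 2 * r\<^sup>2 * (\<Sum>c\<in>UNIV. p i c * p l c)"
proof -
  define Y where "Y i j b = (\<Sum>k\<in>UNIV. X i j k * W b k)" for i j b
  \<comment> \<open>Two slots of \<open>X\<close> are converted to the orthonormal frame and the
    first is left in coordinates. Undoing \<open>W\<close> by \<open>p\<close> in that slot
    expresses \<open>R\<close> through the normal form.\<close>
  define R where "R i a b = (\<Sum>j\<in>UNIV. Y i j b * W a j)" for i a b
  have Rp: "R i a b = (\<Sum>c\<in>UNIV. p i c * xyz r c a b)" for i a b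
  proof -
    have "(\<Sum>c\<in>UNIV. p i c * xyz r c a b) = (\<Sum>c\<in>UNIV. p i c * (\<Sum>m\<in>UNIV. W c m * R m a b))"
      using nf by (simp add: R_def Y_def)
    also have "\<dots> = (\<Sum>m\<in>UNIV. (\<Sum>c\<in>UNIV. p i c * W c m) * R m a b)"
      by (rule sum_prod_assoc[symmetric])
    also have "\<dots> = R i a b" by (simp only: pW sum_delta_mult)
    finally show ?thesis by simp
  qed
  have "(\<Sum>i\<in>UNIV. \<Sum>j\<in>UNIV. G i j * X i j k) = (\<Sum>i\<in>UNIV. \<Sum>a\<in>UNIV. W a i * (\<Sum>j\<in>UNIV. W a j * X i j k))"
    unfolding G sum_prod_assoc ..
  also have "\<dots> = (\<Sum>a\<in>UNIV. \<Sum>i\<in>UNIV. W a i * (\<Sum>j\<in>UNIV. W a j * X i j k))"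
    by (rule sum.swap)
  also have "\<dots> = (\<Sum>a\<in>UNIV. R k a a)"
  proof (rule sum.cong[OF refl])
    fix a
    have "X i j k = X k i j" for i j using sym by metis
    then show "(\<Sum>i\<in>UNIV. W a i * (\<Sum>j\<in>UNIV. W a j * X i j k)) = R k a a"
      by (simp add: R_def Y_def mult.commute)
  qed
  also have "\<dots> = 0" by (simp add: Rp xyz_def)
  finally show "(\<Sum>i\<in>UNIV. \<Sum>j\<in>UNIV. G i j * X i j k) = 0" .
  have inner: "(\<Sum>k'\<in>UNIV. G k k' * (\<Sum>j'\<in>UNIV. G j j' * X l j' k')) = (\<Sum>b\<in>UNIV. W b k * (\<Sum>a\<in>UNIV. R l a b * W a j))" for j k
  proof -
    have "(\<Sum>k'\<in>UNIV. G k k' * (\<Sum>j'\<in>UNIV. G j j' * X l j' k'))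
      = (\<Sum>b\<in>UNIV. W b k * (\<Sum>k'\<in>UNIV. W b k' * (\<Sum>j'\<in>UNIV. G j j' * X l j' k')))"
      by (subst (1) G) (rule sum_prod_assoc)
    moreover have "(\<Sum>k'\<in>UNIV. W b k' * (\<Sum>j'\<in>UNIV. G j j' * X l j' k')) = (\<Sum>a\<in>UNIV. R l a b * W a j)" for b
    proof -
      have "(\<Sum>k'\<in>UNIV. W b k' * (\<Sum>j'\<in>UNIV. G j j' * X l j' k')) = (\<Sum>j'\<in>UNIV. G j j' * Y l j' b)"
        unfolding Y_def sum_distrib_left by (subst sum.swap) (simp add: mult_ac)
      also have "\<dots> = (\<Sum>a\<in>UNIV. W a j * (\<Sum>j'\<in>UNIV. W a j' * Y l j' b))"
        by (subst G) (rule sum_prod_assoc)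
      finally show ?thesis by (simp add: R_def mult.commute)
    qed
    ultimately show ?thesis by simp
  qed
  have "(\<Sum>j\<in>UNIV. \<Sum>k\<in>UNIV. X i j k * (\<Sum>k'\<in>UNIV. G k k' * (\<Sum>j'\<in>UNIV. G j j' * X l j' k')))
    = (\<Sum>j\<in>UNIV. \<Sum>b\<in>UNIV. Y i j b * (\<Sum>a\<in>UNIV. R l a b * W a j))"
    unfolding inner Y_def sum_prod_assoc[symmetric] by (simp add: sum_prod_assoc)
  also have "\<dots> = (\<Sum>b\<in>UNIV. \<Sum>j\<in>UNIV. Y i j b * (\<Sum>a\<in>UNIV. R l a b * W a j))"
    by (rule sum.swap)
  also have "\<dots> = (\<Sum>b\<in>UNIV. \<Sum>a\<in>UNIV. R l a b * R i a b)"
  proof (rule sum.cong[OF refl])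
    fix b
    have "(\<Sum>j\<in>UNIV. (\<Sum>a\<in>UNIV. R l a b * W a j) * Y i j b) = (\<Sum>a\<in>UNIV. R l a b * (\<Sum>j\<in>UNIV. W a j * Y i j b))"
      by (rule sum_prod_assoc)
    then show "(\<Sum>j\<in>UNIV. Y i j b * (\<Sum>a\<in>UNIV. R l a b * W a j)) = (\<Sum>a\<in>UNIV. R l a b * R i a b)"
      by (simp add: R_def mult.commute)
  qed
  \<comment> \<open>In the frame, components with different first indices have disjoint supports;
    for equal first indices exactly two ordered pairs of remaining indices contribute, whence the
    factor 2.\<close>
  also have "\<dots> = 2 * r\<^sup>2 * (\<Sum>c\<in>UNIV. p i c * p l c)"
    by (simp add: Rp sum_3 xyz_def power2_eq_square algebra_simps)
  finally show "(\<Sum>j\<in>UNIV. \<Sum>k\<in>UNIV. X i j k * (\<Sum>k'\<in>UNIV. G k k' * (\<Sum>j'\<in>UNIV. G j j' * X l j' k')))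
       = 2 * r\<^sup>2 * (\<Sum>c\<in>UNIV. p i c * p l c)" .
qed

lemma jet2_contract:
  fixes G :: "3 \<Rightarrow> 3 \<Rightarrow> real \<Rightarrow> real"
  assumes G: "\<And>i j. jet2 (G i j) (if i = j then 1 else 0) 0 (- n i j)"
    and f: "\<And>j. jet2 (f j) (a j) (b j) (c j)"
  shows "jet2 (\<lambda>t. \<Sum>j\<in>UNIV. G i j t * f j t) (a i) (b i) (c i - (\<Sum>j\<in>UNIV. n i j * a j))"
proof -
  have "jet2 (\<lambda>t. \<Sum>j\<in>UNIV. G i j t * f j t) (\<Sum>j\<in>UNIV. (if i = j then 1 else 0) * a j)
     (\<Sum>j\<in>UNIV. (if i = j then 1 else 0) * b j + 0 * a j)
     (\<Sum>j\<in>UNIV. (if i = j then 1 else 0) * c j + 0 * b j + - n i j * a j)"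
    by (intro jet2_sum jet2_mult G f)
  then show ?thesis
    by (simp add: sum.distrib sum_subtractf sum_delta_mult)
qed

text \<open>The two contraction identities are expanded in \<open>t\<close>. As \<open>G\<close> and
  \<open>g\<close> have no first-order term, the metric is invisible at first order, and at second
  order each contraction with \<open>G\<close> costs one term in \<open>n\<close>.\<close>

lemma jet_equations:
  fixes G :: "3 \<Rightarrow> 3 \<Rightarrow> real \<Rightarrow> real" and X :: "3 \<Rightarrow> 3 \<Rightarrow> 3 \<Rightarrow> real \<Rightarrow> real"
  assumes G: "\<And>i j. jet2 (G i j) (if i = j then 1 else 0) 0 (- n i j)"
    and g: "\<And>i j. jet2 (g i j) (if i = j then 1 else 0) 0 (n i j)"
    and X: "\<And>i j k. jet2 (X i j k) (x i j k) (x1 i j k) (x2 i j k)"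
    and tr: "\<And>k. \<forall>\<^sub>F t in at 0. (\<Sum>i\<in>UNIV. \<Sum>j\<in>UNIV. G i j t * X i j k t) = 0"
    and ei: "\<forall>\<^sub>F t in at 0. \<exists>c. \<forall>i l. (\<Sum>j\<in>UNIV. \<Sum>k\<in>UNIV. X i j k t *
        (\<Sum>k'\<in>UNIV. G k k' t * (\<Sum>j'\<in>UNIV. G j j' t * X l j' k' t))) = c * g i l t"
  shows "(\<Sum>i\<in>UNIV. x1 i i k) = 0"
    and "(\<Sum>i\<in>UNIV. x2 i i k - (\<Sum>j\<in>UNIV. n i j * x i j k)) = 0"
    and "i \<noteq> l \<Longrightarrow> (\<Sum>j\<in>UNIV. \<Sum>k\<in>UNIV. x i j k * x1 l j k + x1 i j k * x l j k) = 0"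
    and "i \<noteq> l \<Longrightarrow> (\<Sum>j\<in>UNIV. \<Sum>k\<in>UNIV. x i j k * (x2 l j k - (\<Sum>j'\<in>UNIV. n j j' * x l j' k) - (\<Sum>k'\<in>UNIV. n k k' * x l j k'))
       + x1 i j k * x1 l j k + x2 i j k * x l j k) = (\<Sum>j\<in>UNIV. \<Sum>k\<in>UNIV. x l j k * x l j k) * n i l"
proof -
  have "jet2 (\<lambda>t. \<Sum>i\<in>UNIV. \<Sum>j\<in>UNIV. G i j t * X i j k t) (\<Sum>i\<in>UNIV. x i i k) (\<Sum>i\<in>UNIV. x1 i i k)
     (\<Sum>i\<in>UNIV. x2 i i k - (\<Sum>j\<in>UNIV. n i j * x i j k))"
    by (intro jet2_sum jet2_contract G X)
  then have "jet2 (\<lambda>t. 0) (\<Sum>i\<in>UNIV. x i i k) (\<Sum>i\<in>UNIV. x1 i i k)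
     (\<Sum>i\<in>UNIV. x2 i i k - (\<Sum>j\<in>UNIV. n i j * x i j k))"
    by (rule jet2_cong) (rule tr)
  from jet2_zero_unique[OF this]
  show "(\<Sum>i\<in>UNIV. x1 i i k) = 0" "(\<Sum>i\<in>UNIV. x2 i i k - (\<Sum>j\<in>UNIV. n i j * x i j k)) = 0"
    by auto
next
  assume il: "i \<noteq> l"
  define M where "M i l t = (\<Sum>j\<in>UNIV. \<Sum>k\<in>UNIV. X i j k t *
        (\<Sum>k'\<in>UNIV. G k k' t * (\<Sum>j'\<in>UNIV. G j j' t * X l j' k' t)))" for i l t
  let ?m0 = "\<lambda>i l. \<Sum>j\<in>UNIV. \<Sum>k\<in>UNIV. x i j k * x l j k"
  let ?m1 = "\<lambda>i l. \<Sum>j\<in>UNIV. \<Sum>k\<in>UNIV. x i j k * x1 l j k + x1 i j k * x l j k"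
  let ?m2 = "\<lambda>i l. \<Sum>j\<in>UNIV. \<Sum>k\<in>UNIV. x i j k * (x2 l j k - (\<Sum>j'\<in>UNIV. n j j' * x l j' k) - (\<Sum>k'\<in>UNIV. n k k' * x l j k'))
       + x1 i j k * x1 l j k + x2 i j k * x l j k"
  have M: "jet2 (M i l) (?m0 i l) (?m1 i l) (?m2 i l)" for i l
    unfolding M_def[abs_def]
    by (intro jet2_sum jet2_mult[OF X] jet2_contract[OF G] X)
  have "\<forall>\<^sub>F t in at 0. M i l t * g l l t = M l l t * g i l t"
    using ei unfolding M_def[symmetric] by eventually_elim (auto simp: mult_ac)
  \<comment> \<open>The factor \<open>c\<close> may vary with \<open>t\<close> without any
    regularity, so it is eliminated by cross multiplication. For \<open>i \<noteq> l\<close> the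
    entry \<open>g i l\<close> starts at second order, which isolates the coefficients of
    \<open>M i l\<close>.\<close>
  from jet2_unique[OF jet2_mult[OF M g] jet2_mult[OF M g] this] il
  have "?m0 i l = 0" "?m1 i l = 0" "?m0 i l * n l l + ?m2 i l = ?m0 l l * n i l"
    by simp_all
  then show "?m1 i l = 0" "?m2 i l = ?m0 l l * n i l" by auto
qed

text \<open>The off-diagonal equations are relations such as
  \<open>y 1 1 3 m + y 2 2 3 m = 0\<close>. Together with the trace they kill every component with
  an index occurring three times. By symmetry the relations then become vanishing pairwise sums of
  the three components with two doubled indices, and the trace disposes of those with one doubled
  index.\<close>

lemma quartic_eq_0:
  fixes y :: "3 \<Rightarrow> 3 \<Rightarrow> 3 \<Rightarrow> 3 \<Rightarrow> real"
  assumes sym: "\<And>i j k m. y i j k m = y j i k m" "\<And>i j k m. y i j k m = y i k j m" "\<And>i j k m. y i j k m = y i j m k"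
    and r: "r \<noteq> 0"
    and tr: "\<And>k m. (\<Sum>i\<in>UNIV. y i i k m) = 0"
    and ei: "\<And>i l m. i \<noteq> l \<Longrightarrow> (\<Sum>j\<in>UNIV. \<Sum>k\<in>UNIV. xyz r i j k * y l j k m + y i j k m * xyz r l j k) = 0"
  shows "y i j k m = 0"
proof -
  have e: "y 1 1 3 m + y 2 2 3 m = 0" "y 1 1 2 m + y 2 3 3 m = 0" "y 1 2 2 m + y 1 3 3 m = 0" for m
  proof -
    have "2 * (r * y 1 1 3 m) + 2 * (r * y 2 2 3 m) = 0" "2 * (r * y 2 3 3 m) + 2 * (r * y 1 1 2 m) = 0"
      "2 * (r * y 1 3 3 m) + 2 * (r * y 1 2 2 m) = 0"
      using ei[of 1 2 m] ei[of 1 3 m] ei[of 2 3 m] sym(1,2) by (simp_all add: sum_3 xyz_def)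
    then have "r * (y 1 1 3 m + y 2 2 3 m) = 0" "r * (y 1 1 2 m + y 2 3 3 m) = 0" "r * (y 1 2 2 m + y 1 3 3 m) = 0"
      by (simp_all add: distrib_left)
    then show "y 1 1 3 m + y 2 2 3 m = 0" "y 1 1 2 m + y 2 3 3 m = 0" "y 1 2 2 m + y 1 3 3 m = 0"
      using r by simp_all
  qed
  have t: "y 1 1 1 m + y 1 2 2 m + y 1 3 3 m = 0" "y 1 1 2 m + y 2 2 2 m + y 2 3 3 m = 0"
    "y 1 1 3 m + y 2 2 3 m + y 3 3 3 m = 0" for m
    using tr[of 1 m] tr[of 2 m] tr[of 3 m] sym(1,2) by (simp_all add: sum_3)
  have c: "y 1 1 1 m = 0" "y 2 2 2 m = 0" "y 3 3 3 m = 0" for m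
    using e[of m] t[of m] by auto
  have c': "y 1 2 2 2 = 0" "y 1 3 3 3 = 0" "y 2 3 3 3 = 0"
    using c(2)[of 1] c(3)[of 1] c(3)[of 2] sym by metis+
  have d: "y 1 1 3 3 + y 2 2 3 3 = 0" "y 1 1 2 2 + y 2 2 3 3 = 0" "y 1 1 2 2 + y 1 1 3 3 = 0"
    using e(1)[of 3] e(2)[of 2] e(3)[of 1] sym by simp_all
  then have d: "y 1 1 2 2 = 0" "y 1 1 3 3 = 0" "y 2 2 3 3 = 0" by linarith+
  have f: "y 1 1 2 3 = 0" "y 1 2 2 3 = 0" "y 1 2 3 3 = 0"
    using t(2)[of 3] t(1)[of 3] t(1)[of 2] c c' sym by simp_all
  show ?thesis
    using exhaust_3[of i] exhaust_3[of j] exhaust_3[of k] exhaust_3[of m]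
    by (elim disjE) (simp_all add: c c' d f sym)
qed

text \<open>Here \<open>z\<close> stands for the second derivatives of \<open>X\<close> at the
  centre. Along the direction formed by the \<open>m\<close>-th axis plus \<open>s\<close> times the
  \<open>n\<close>-th, \<open>h\<close> is the derivative of \<open>F\<close>, \<open>N\<close> the
  second-order term of the metric and \<open>x2\<close> that of the cubic. Comparing
  \<open>s = 1\<close> with \<open>s = -1\<close> isolates the mixed derivative in \<open>m\<close>
  and \<open>n\<close>.\<close>

lemma quintic_eq_0:
  fixes z :: "3 \<Rightarrow> 3 \<Rightarrow> 3 \<Rightarrow> 3 \<Rightarrow> 3 \<Rightarrow> real"
  assumes sym: "\<And>i j k m n. z i j k m n = z j i k m n" "\<And>i j k m n. z i j k m n = z i k j m n"
      "\<And>i j k m n. z i j k m n = z i j m k n" "\<And>i j k m n. z i j k m n = z i j k n m"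
    and h: "\<And>s m n i j. h s m n i j = xyz r i j m + s * xyz r i j n"
    and N: "\<And>s m n i j. N s m n i j = (\<Sum>k\<in>UNIV. h s m n k i * h s m n k j)"
    and x2: "\<And>s m n i j k. x2 s m n i j k = (z i j k m m + 2 * s * z i j k m n + s * s * z i j k n n) / 2"
    and tr: "\<And>s m n k. (\<Sum>i\<in>UNIV. x2 s m n i i k - (\<Sum>j\<in>UNIV. N s m n i j * xyz r i j k)) = 0"
    and ei: "\<And>s m n i l. i \<noteq> l \<Longrightarrow>
       (\<Sum>j\<in>UNIV. \<Sum>k\<in>UNIV. xyz r i j k * (x2 s m n l j k - (\<Sum>j'\<in>UNIV. N s m n j j' * xyz r l j' k)
          - (\<Sum>k'\<in>UNIV. N s m n k k' * xyz r l j k')) + x2 s m n i j k * xyz r l j k)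
       = (\<Sum>j\<in>UNIV. \<Sum>k\<in>UNIV. xyz r l j k * xyz r l j k) * N s m n i l"
  shows "r = 0"
proof (rule ccontr)
  assume r: "r \<noteq> 0"
  \<comment> \<open>The difference of the two instances keeps the terms odd in \<open>s\<close>. The
    right-hand side comes from contracting the metric term \<open>N\<close> with the cubic.\<close>
  have 0: "z 1 1 1 2 3 + z 1 2 2 2 3 + z 1 2 3 3 3 = 2 * r^3"
    using tr[of 1 1 2 3] tr[of "-1" 1 2 3] sym
    by (simp add: sum_3 N h x2 xyz_def power3_eq_cube add_divide_distrib diff_divide_distrib algebra_simps del: mult_cancel_left mult_eq_0_iff, linarith?)
  \<comment> \<open>Differentiating along the two axes of the off-diagonal position confines the
    unknowns to the three that occur in the trace equation.\<close>
  have 1: "r * (z 1 1 1 2 3 + z 1 2 2 2 3) = r * (2 * r^3)"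
    using ei[of 1 2 1 1 2] ei[of 1 2 "-1" 1 2] sym
    by (simp add: sum_3 N h x2 xyz_def power3_eq_cube algebra_simps del: mult_cancel_left mult_eq_0_iff, linarith?)
  have 2: "r * (z 1 2 2 2 3 + z 1 2 3 3 3) = r * (2 * r^3)"
    using ei[of 2 3 1 2 3] ei[of 2 3 "-1" 2 3] sym
    by (simp add: sum_3 N h x2 xyz_def power3_eq_cube algebra_simps del: mult_cancel_left mult_eq_0_iff, linarith?)
  have 3: "r * (z 1 1 1 2 3 + z 1 2 3 3 3) = r * (2 * r^3)"
    using ei[of 1 3 1 1 3] ei[of 1 3 "-1" 1 3] sym
    by (simp add: sum_3 N h x2 xyz_def power3_eq_cube algebra_simps del: mult_cancel_left mult_eq_0_iff, linarith?)
  \<comment> \<open>Adding the pairwise relations gives the total \<open>3 * r^3\<close>, while the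
    trace gives \<open>2 * r^3\<close>.\<close>
  have "r^3 = 0" using 0 1 2 3 r by simp
  then show False using r by simp
qed

section \<open>Orthonormal families\<close>

lemma orthonormal_expansion:
  fixes e :: "'i::finite \<Rightarrow> 'a::euclidean_space"
  assumes "\<And>i j. e i \<bullet> e j = (if i = j then 1 else 0)" "v \<in> span (range e)"
  shows "v = (\<Sum>i\<in>UNIV. (v \<bullet> e i) *\<^sub>R e i)"
  using assms(2)
proof (induction rule: span_induct)
  show "subspace {v. v = (\<Sum>i\<in>UNIV. (v \<bullet> e i) *\<^sub>R e i)}"
  proof (rule subspaceI)
    fix c and x assume x: "x \<in> {v. v = (\<Sum>i\<in>UNIV. (v \<bullet> e i) *\<^sub>R e i)}"
    have "(\<Sum>i\<in>UNIV. (c *\<^sub>R x \<bullet> e i) *\<^sub>R e i) = c *\<^sub>R (\<Sum>i\<in>UNIV. (x \<bullet> e i) *\<^sub>R e i)"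
      by (simp add: scaleR_sum_right)
    then show "c *\<^sub>R x \<in> {v. v = (\<Sum>i\<in>UNIV. (v \<bullet> e i) *\<^sub>R e i)}" using x by simp
  qed (simp_all add: inner_add_left scaleR_add_left sum.distrib)
next
  fix v assume "v \<in> range e"
  then show "v = (\<Sum>i\<in>UNIV. (v \<bullet> e i) *\<^sub>R e i)"
    using assms(1) by (auto simp: if_distrib[of "\<lambda>r. r *\<^sub>R _"] cong: if_cong)
qed

lemma orthonormal_inner_expansion:
  fixes e :: "'i::finite \<Rightarrow> 'a::euclidean_space"
  assumes "\<And>i j. e i \<bullet> e j = (if i = j then 1 else 0)" "v \<in> span (range e)"
  shows "v \<bullet> w = (\<Sum>i\<in>UNIV. (v \<bullet> e i) * (w \<bullet> e i))"
proof -
  have "v \<bullet> w = (\<Sum>i\<in>UNIV. (v \<bullet> e i) *\<^sub>R e i) \<bullet> w"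
    using orthonormal_expansion[OF assms] by simp
  then show ?thesis by (simp add: inner_sum_left inner_commute[of "e _" w])
qed

lemma orthonormal_span_UNIV:
  fixes e :: "'i::finite \<Rightarrow> 'a::euclidean_space"
  assumes on: "\<And>i j. e i \<bullet> e j = (if i = j then 1 else 0)" and card: "CARD('i) = DIM('a)"
  shows "span (range e) = UNIV"
proof -
  have inj: "inj e"
  proof (rule injI)
    fix i j assume "e i = e j"
    then show "i = j" using on[of i i] on[of i j] by (auto split: if_splits)
  qed
  have "pairwise orthogonal (range e)" using on by (auto simp: pairwise_def orthogonal_def)
  moreover have "0 \<notin> range e"
  proof
    assume "0 \<in> range e"
    then obtain i where "e i = 0" by force
    then show False using on[of i i] by simp
  qed
  ultimately have "independent (range e)" by (rule pairwise_orthogonal_independent)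
  then have "UNIV \<subseteq> span (range e)"
    by (intro card_ge_dim_independent) (simp_all add: card_image[OF inj] card)
  then show ?thesis by blast
qed

text \<open>The vectors \<open>e i\<close> and \<open>J (e i)\<close> form an orthonormal family of
  six vectors in real dimension six, hence a basis.\<close>

lemma lagrangian_inner_expansion:
  fixes e :: "3 \<Rightarrow> complex^3"
  assumes on: "\<And>i j. e i \<bullet> e j = (if i = j then 1 else 0)" and J0: "\<And>i j. e i \<bullet> J (e j) = 0"
  shows "a \<bullet> b = (\<Sum>i\<in>UNIV. (a \<bullet> e i) * (b \<bullet> e i)) + (\<Sum>i\<in>UNIV. (a \<bullet> J (e i)) * (b \<bullet> J (e i)))"
proof -
  let ?b = "case_sum e (\<lambda>i. J (e i)) :: 3 + 3 \<Rightarrow> complex^3"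
  have on': "?b i \<bullet> ?b j = (if i = j then 1 else 0)" for i j
    using on J0 by (auto split: sum.splits simp: inner_commute)
  have "span (range ?b) = UNIV"
    by (rule orthonormal_span_UNIV[OF on']) simp
  then have "a \<bullet> b = (\<Sum>i\<in>UNIV. (a \<bullet> ?b i) * (b \<bullet> ?b i))"
    by (intro orthonormal_inner_expansion[OF on']) simp
  then show ?thesis
    by (simp add: sum.Plus flip: UNIV_Plus_UNIV)
qed

section \<open>Charts over the tangent plane\<close>

lemma dir_deriv_cong:
  assumes "open U" "y \<in> U" "\<And>x. x \<in> U \<Longrightarrow> f x = g x"
  shows "dir_deriv v f y = dir_deriv v g y"
proof -
  have "frechet_derivative f (at y) = frechet_derivative g (at y)"
    unfolding frechet_derivative_def using has_derivative_cong_open[OF assms] by simp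
  then show ?thesis by (simp add: dir_deriv_def)
qed

lemma dir_deriv_add_scale:
  fixes f g :: "'a::euclidean_space \<Rightarrow> real"
  assumes "smooth_on U f" "smooth_on U g" "y \<in> U"
  shows "dir_deriv v (\<lambda>y. f y + s * g y) y = dir_deriv v f y + s * dir_deriv v g y"
  by (rule dir_deriv_unique[of _ "\<lambda>v. dir_deriv v f y + s * dir_deriv v g y"])
     (intro has_derivative_add has_derivative_mult_right has_dir_deriv[OF assms(1,3)] has_dir_deriv[OF assms(2,3)])

lemma dir_deriv_inner_const:
  assumes "smooth_on U f" "y \<in> U"
  shows "dir_deriv v (\<lambda>y. f y \<bullet> a) y = dir_deriv v f y \<bullet> a"
  by (rule dir_deriv_unique[of _ "\<lambda>v. dir_deriv v f y \<bullet> a"])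
     (rule has_derivative_inner_left[OF has_dir_deriv[OF assms]])

lemma dir_deriv_coordinates:
  fixes f :: "real^'n \<Rightarrow> real"
  assumes "smooth_on U f" "y \<in> U"
  shows "dir_deriv v f y = (\<Sum>i\<in>UNIV. v $ i * dir_deriv (axis i 1) f y)"
proof -
  have v: "v = (\<Sum>i\<in>UNIV. v $ i *\<^sub>R axis i 1)"
    using basis_expansion[of v] by (simp add: scalar_mult_eq_scaleR)
  show ?thesis
    by (subst v) (simp add: linear_sum[OF linear_dir_deriv[OF assms]] linear_scale[OF linear_dir_deriv[OF assms]])
qed

text \<open>Near \<open>\<Phi> y0\<close>, \<open>L\<close> is a graph over its tangent plane there,
  with normal components \<open>f i\<close>. The frame \<open>e\<close> is adapted to the tangent
  space at this centre only.\<close>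

locale frame_chart = linear_chart L "\<lambda>z. \<chi> i. z \<bullet> e i" V \<Phi>
  for L and e :: "3 \<Rightarrow> complex^3" and V \<Phi> +
  fixes y0
  assumes sl: "special_lagrangian L"
    and e_orthonormal: "\<And>i j. e i \<bullet> e j = (if i = j then 1 else 0)"
    and y0: "y0 \<in> V"
    and tangent_y0: "tangent_space L (\<Phi> y0) = span (range e)"
begin

definition f :: "3 \<Rightarrow> real^3 \<Rightarrow> real" where
  "f i y = \<Phi> y \<bullet> J (e i)"

definition F :: "3 \<Rightarrow> 3 \<Rightarrow> real^3 \<Rightarrow> real" where
  "F i j = dir_deriv (axis j 1) (f i)"

definition X :: "3 \<Rightarrow> 3 \<Rightarrow> 3 \<Rightarrow> real^3 \<Rightarrow> real" where
  "X i j k = dir_deriv (axis k 1) (F i j)"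

definition metric :: "3 \<Rightarrow> 3 \<Rightarrow> real^3 \<Rightarrow> real" where
  "metric i l y = dir_deriv (axis i 1) \<Phi> y \<bullet> dir_deriv (axis l 1) \<Phi> y"

lemma tangent_inner_J:
  assumes "y \<in> V" "a \<in> tangent_space L (\<Phi> y)" "b \<in> tangent_space L (\<Phi> y)"
  shows "a \<bullet> J b = 0"
  using sl chart_in[OF assms(1)] assms(2,3) by (auto simp: special_lagrangian_def omega_eq)

lemma e_J: "e i \<bullet> J (e j) = 0"
  by (rule tangent_inner_J[OF y0]) (auto simp: tangent_y0 span_base)

lemmas inner_expansion = lagrangian_inner_expansion[of e, OF e_orthonormal e_J]

lemma smooth_f: "smooth_on V (f i)"
  unfolding f_def[abs_def] by (rule smooth_on_bounded_linear[OF bounded_linear_inner_left smooth_chart])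

lemma smooth_F: "smooth_on V (F i j)"
  unfolding F_def by (rule smooth_on_dir_deriv[OF smooth_f])

lemma smooth_X: "smooth_on V (X i j k)"
  unfolding X_def by (rule smooth_on_dir_deriv[OF smooth_F])

lemma deriv_e:
  assumes "y \<in> V"
  shows "dir_deriv v \<Phi> y \<bullet> e i = v $ i"
  using arg_cong[OF P_deriv[OF assms, of v], of "\<lambda>w. w $ i"] by simp

lemma deriv_Je: "y \<in> V \<Longrightarrow> dir_deriv v \<Phi> y \<bullet> J (e i) = dir_deriv v (f i) y"
  unfolding f_def[abs_def] by (rule dir_deriv_inner_const[OF smooth_chart, symmetric])

lemma deriv_tangent: "y \<in> V \<Longrightarrow> dir_deriv v \<Phi> y \<in> tangent_space L (\<Phi> y)"
  by (simp add: tangent_space_chart)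

text \<open>The \<open>i\<close>-th coordinate vector is \<open>e i\<close> plus the sum over
  \<open>k\<close> of \<open>F k i y\<close> times \<open>J (e k)\<close>; the Lagrangian condition
  for two of them is exactly this symmetry. It makes \<open>f\<close> locally a gradient, the source
  of the total symmetry of \<open>X\<close> and its derivatives.\<close>

lemma F_sym:
  assumes y: "y \<in> V"
  shows "F i j y = F j i y"
proof -
  have "0 = dir_deriv (axis i 1) \<Phi> y \<bullet> J (dir_deriv (axis j 1) \<Phi> y)"
    using tangent_inner_J[OF y deriv_tangent[OF y] deriv_tangent[OF y]] by simp
  also have "\<dots> = (\<Sum>k\<in>UNIV. (dir_deriv (axis i 1) \<Phi> y \<bullet> e k) * (J (dir_deriv (axis j 1) \<Phi> y) \<bullet> e k))
     + (\<Sum>k\<in>UNIV. (dir_deriv (axis i 1) \<Phi> y \<bullet> J (e k)) * (J (dir_deriv (axis j 1) \<Phi> y) \<bullet> J (e k)))"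
    by (rule inner_expansion)
  also have "\<dots> = (\<Sum>k\<in>UNIV. axis i 1 $ k * - F k j y) + (\<Sum>k\<in>UNIV. F k i y * axis j 1 $ k)"
    by (simp add: deriv_e[OF y] deriv_Je[OF y] F_def inner_commute[of "J _" "e _"] inner_J_commute[of "e _"]
        inner_commute[of "J (e _)"])
  also have "\<dots> = F j i y - F i j y"
    by (simp add: axis_def sum_negf if_distrib[of "\<lambda>z. z * _"] if_distrib[of "\<lambda>z. _ * z"] cong: if_cong)
  finally show ?thesis by simp
qed

lemma X_sym:
  assumes y: "y \<in> V"
  shows "X i j k y = X j i k y" "X i j k y = X i k j y"
proof -
  show "X i j k y = X j i k y"
    unfolding X_def by (rule dir_deriv_cong[OF open_V y F_sym])
  show "X i j k y = X i k j y"
    unfolding X_def F_def by (rule dir_deriv_commute[OF smooth_f y])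
qed

lemma metric_eq:
  assumes y: "y \<in> V"
  shows "metric i l y = (if i = l then 1 else 0) + (\<Sum>k\<in>UNIV. F k i y * F k l y)"
  unfolding metric_def inner_expansion[of "dir_deriv (axis i 1) \<Phi> y" "dir_deriv (axis l 1) \<Phi> y"]
  by (simp add: deriv_e[OF y] deriv_Je[OF y] F_def axis_def if_distrib[of "\<lambda>z. z * _"] cong: if_cong)

text \<open>The tangential coordinates are linear in this chart, so second derivatives of
  \<open>\<Phi>\<close> lie in the span of the \<open>J (e k)\<close>, where
  \<open>J (dir_deriv w \<Phi> y)\<close> has the components \<open>w $ k\<close>. Hence
  \<open>X\<close> represents the cubic at every point of the chart, with no correction by the
  metric.\<close>

lemma cubic_coordinates:
  assumes y: "y \<in> V"
  shows "fundamental_cubic L (\<Phi> y) (dir_deriv u \<Phi> y) (dir_deriv v \<Phi> y) (dir_deriv w \<Phi> y)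
    = (\<Sum>k\<in>UNIV. w $ k * (\<Sum>i\<in>UNIV. v $ i * (\<Sum>a\<in>UNIV. X k i a y * u $ a)))"
proof -
  have 1: "hessian y u v \<bullet> a = (\<Sum>i\<in>UNIV. v $ i * dir_deriv u (\<lambda>y. dir_deriv (axis i 1) \<Phi> y \<bullet> a) y)" for a
    by (simp add: hessian_def inner_sum_left dir_deriv_inner_const[OF smooth_on_dir_deriv[OF smooth_chart] y])
  have "dir_deriv u (\<lambda>y. dir_deriv (axis i 1) \<Phi> y \<bullet> e k) y = 0" for i k
  proof -
    have "dir_deriv u (\<lambda>y. dir_deriv (axis i 1) \<Phi> y \<bullet> e k) y = dir_deriv u (\<lambda>y. axis i (1::real) $ k) y"
      by (rule dir_deriv_cong[OF open_V y deriv_e])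
    also have "\<dots> = 0" by (rule dir_deriv_unique[OF has_derivative_const])
    finally show ?thesis .
  qed
  then have he: "hessian y u v \<bullet> e k = 0" for k by (simp add: 1)
  have hJ: "hessian y u v \<bullet> J (e k) = (\<Sum>i\<in>UNIV. v $ i * (\<Sum>a\<in>UNIV. X k i a y * u $ a))" for k
  proof -
    have "dir_deriv u (\<lambda>y. dir_deriv (axis i 1) \<Phi> y \<bullet> J (e k)) y = (\<Sum>a\<in>UNIV. X k i a y * u $ a)" for i
    proof -
      have "dir_deriv u (\<lambda>y. dir_deriv (axis i 1) \<Phi> y \<bullet> J (e k)) y = dir_deriv u (F k i) y"
        unfolding F_def by (rule dir_deriv_cong[OF open_V y deriv_Je])
      then show ?thesis
        by (simp add: dir_deriv_coordinates[OF smooth_F y, of u] X_def mult.commute)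
    qed
    then show ?thesis by (simp add: 1)
  qed
  show ?thesis
    unfolding fundamental_cubic_chart[OF sl y]
    using inner_expansion[of "hessian y u v" "J (dir_deriv w \<Phi> y)"]
    by (simp add: he hJ deriv_e[OF y] mult.commute)
qed

lemma deriv_y0: "dir_deriv (axis i 1) \<Phi> y0 = e i"
proof -
  have "dir_deriv (axis i 1) \<Phi> y0 \<in> span (range e)"
    using deriv_tangent[OF y0] by (simp add: tangent_y0)
  from orthonormal_expansion[OF e_orthonormal this]
  show ?thesis by (simp add: deriv_e[OF y0] axis_def if_distrib[of "\<lambda>r. r *\<^sub>R _"] cong: if_cong)
qed

lemma F_y0: "F i j y0 = 0"
  using deriv_Je[OF y0, of "axis j 1" i] e_J by (simp add: deriv_y0 F_def)

lemma dim_tangent_space: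
  assumes y: "y \<in> V"
  shows "dim (tangent_space L (\<Phi> y)) = 3"
proof -
  have "inj (\<lambda>v. dir_deriv v \<Phi> y)"
    by (rule inj_on_inverseI) (rule P_deriv[OF y])
  then have "dim (range (\<lambda>v. dir_deriv v \<Phi> y)) = dim (UNIV :: (real^3) set)"
    using linear_deriv[OF y] by (intro dim_image_eq) auto
  then show ?thesis by (simp add: tangent_space_chart[OF y])
qed

lemma cubic_homogeneous:
  assumes y: "y \<in> V" and "u \<in> tangent_space L (\<Phi> y)" "v \<in> tangent_space L (\<Phi> y)" "w \<in> tangent_space L (\<Phi> y)"
  shows "fundamental_cubic L (\<Phi> y) (r *\<^sub>R u) (s *\<^sub>R v) (t *\<^sub>R w) = r * s * t * fundamental_cubic L (\<Phi> y) u v w"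
proof -
  obtain u' v' w' where [simp]: "u = dir_deriv u' \<Phi> y" "v = dir_deriv v' \<Phi> y" "w = dir_deriv w' \<Phi> y"
    using assms(2-4) tangent_space_chart[OF y] by auto
  have sc: "c *\<^sub>R dir_deriv z \<Phi> y = dir_deriv (c *\<^sub>R z) \<Phi> y" for c z
    by (simp add: linear_scale[OF linear_deriv[OF y]])
  show ?thesis
    by (simp add: sc cubic_coordinates[OF y]) (simp add: sum_distrib_left mult_ac)
qed

end

section \<open>The symmetry conditions expanded at the centre\<close>

locale A4_frame_chart = frame_chart +
  assumes A4: "\<And>x. x \<in> L \<Longrightarrow> \<exists>H. subgroup H (SO_group (tangent_space L x)) \<and>
           H \<subseteq> cubic_stabilizer (tangent_space L x) (fundamental_cubic L x) \<and>
           (SO_group (tangent_space L x))\<lparr>carrier := H\<rparr> \<cong> alt_group 4"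
begin

lemma normal_frame:
  assumes y: "y \<in> V"
  obtains E where "\<And>i j :: 3. E i \<bullet> E j = (if i = j then 1 else 0)" "span (range E) = tangent_space L (\<Phi> y)"
    "\<And>i j k. i = j \<or> j = k \<or> i = k \<Longrightarrow> fundamental_cubic L (\<Phi> y) (E i) (E j) (E k) = 0"
proof -
  obtain H where H: "subgroup H (SO_group (tangent_space L (\<Phi> y)))"
    "H \<subseteq> cubic_stabilizer (tangent_space L (\<Phi> y)) (fundamental_cubic L (\<Phi> y))"
    "(SO_group (tangent_space L (\<Phi> y)))\<lparr>carrier := H\<rparr> \<cong> alt_group 4"
    using A4[OF chart_in[OF y]] by blast
  show ?thesis
    using cubic_normal_form[OF subspace_tangent_space[OF y] dim_tangent_space[OF y] H cubic_homogeneous[OF y]] that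
    by blast
qed

text \<open>Collects what the normal form at \<open>y\<close> says without naming the frame or
  \<open>r\<close>. The bound stands in for regularity of \<open>G\<close>: an entry of
  \<open>G\<close> is a sum of three products of numbers of absolute value at most 1, whence
  3.\<close>

definition bounded_inverse :: "real^3 \<Rightarrow> (3 \<Rightarrow> 3 \<Rightarrow> real) \<Rightarrow> bool" where
  "bounded_inverse y G \<longleftrightarrow>
    (\<forall>i j. \<bar>G i j\<bar> \<le> 3) \<and> (\<forall>i l. (\<Sum>j\<in>UNIV. G i j * metric j l y) = (if i = l then 1 else 0)) \<and>
    (\<forall>k. (\<Sum>i\<in>UNIV. \<Sum>j\<in>UNIV. G i j * X i j k y) = 0) \<and>
    (\<exists>c. \<forall>i l. (\<Sum>j\<in>UNIV. \<Sum>k\<in>UNIV. X i j k y *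
        (\<Sum>k'\<in>UNIV. G k k' * (\<Sum>j'\<in>UNIV. G j j' * X l j' k' y))) = c * metric i l y)"

lemma bounded_inverse_exists:
  assumes y: "y \<in> V"
  shows "\<exists>G. bounded_inverse y G"
proof -
  let ?C = "fundamental_cubic L (\<Phi> y)"
  obtain E where E: "\<And>i j :: 3. E i \<bullet> E j = (if i = j then 1 else 0)" "span (range E) = tangent_space L (\<Phi> y)"
    "\<And>i j k. i = j \<or> j = k \<or> i = k \<Longrightarrow> ?C (E i) (E j) (E k) = 0"
    using normal_frame[OF y] by metis
  have ET: "E a \<in> tangent_space L (\<Phi> y)" for a using E(2) span_superset[of "range E"] by auto
  have E_expand: "u \<bullet> v = (\<Sum>c\<in>UNIV. (u \<bullet> E c) * (v \<bullet> E c))" if "u \<in> tangent_space L (\<Phi> y)" for u v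
    using orthonormal_inner_expansion[OF E(1)] that E(2) by simp
  \<comment> \<open>\<open>W\<close> holds the chart coordinates of the orthonormal frame, and
    \<open>p\<close> the components of the coordinate vectors in that frame. They are inverse
    matrices, so \<open>G\<close> inverts the metric.\<close>
  define W where "W a i = E a \<bullet> e i" for a i
  define p where "p i c = dir_deriv (axis i 1) \<Phi> y \<bullet> E c" for i c
  define G where "G i j = (\<Sum>a\<in>UNIV. W a i * W a j)" for i j
  have EW: "E a = dir_deriv (\<chi> i. W a i) \<Phi> y" for a
    using tangent_eq_deriv[OF y ET] by (simp add: W_def)
  define K where "K c a b = (\<Sum>m\<in>UNIV. W c m * (\<Sum>j\<in>UNIV. (\<Sum>k\<in>UNIV. X m j k y * W b k) * W a j))" for c a b
  have CK: "?C (E b) (E a) (E c) = K c a b" for a b c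
    unfolding EW cubic_coordinates[OF y] by (simp add: K_def mult.commute)
  have Ksym2: "K c a b = K c b a" for a b c
  proof -
    have "(\<Sum>j\<in>UNIV. (\<Sum>k\<in>UNIV. X m j k y * W b k) * W a j) = (\<Sum>j\<in>UNIV. (\<Sum>k\<in>UNIV. X m j k y * W a k) * W b j)" for m
      unfolding sum_distrib_right by (subst sum.swap) (simp add: X_sym(2)[OF y, of m] mult_ac)
    then show ?thesis by (simp add: K_def)
  qed
  have Ksym1: "K c a b = K a c b" for a b c
  proof -
    have "K c a b = (\<Sum>m\<in>UNIV. \<Sum>j\<in>UNIV. W c m * ((\<Sum>k\<in>UNIV. X m j k y * W b k) * W a j))" for c a
      by (simp add: K_def sum_distrib_left)
    moreover have "(\<Sum>m\<in>UNIV. \<Sum>j\<in>UNIV. W c m * ((\<Sum>k\<in>UNIV. X m j k y * W b k) * W a j))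
      = (\<Sum>m\<in>UNIV. \<Sum>j\<in>UNIV. W a m * ((\<Sum>k\<in>UNIV. X m j k y * W b k) * W c j))"
      by (subst sum.swap) (simp add: X_sym(1)[OF y, of _ _ k for k] mult_ac)
    ultimately show ?thesis by simp
  qed
  have "K c a b = 0" if "c = a \<or> a = b \<or> c = b" for a b c
    using E(3)[of b a c] that CK by auto
  then have "K = xyz (K 1 2 3)"
    by (intro symmetric_cubic_eq_xyz Ksym1 Ksym2)
  then have nf: "(\<Sum>m\<in>UNIV. W c m * (\<Sum>j\<in>UNIV. (\<Sum>k\<in>UNIV. X m j k y * W b k) * W a j)) = xyz (K 1 2 3) c a b" for c a b
    unfolding K_def[symmetric] by metis
  have pW: "(\<Sum>c\<in>UNIV. p i c * W c j) = (if i = j then 1 else 0)" for i j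
  proof -
    have "(\<Sum>c\<in>UNIV. p i c * W c j) = dir_deriv (axis i 1) \<Phi> y \<bullet> e j"
      using E_expand[OF deriv_tangent[OF y], of "axis i 1" "e j"]
      by (simp add: p_def W_def inner_commute[of "e j" "E _"])
    then show ?thesis by (simp add: deriv_e[OF y] axis_def)
  qed
  have Wp: "(\<Sum>j\<in>UNIV. W a j * p j c) = (if a = c then 1 else 0)" for a c
  proof -
    have "E a \<bullet> E c = (\<Sum>j\<in>UNIV. W a j *\<^sub>R dir_deriv (axis j 1) \<Phi> y) \<bullet> E c"
      by (subst EW) (simp add: deriv_expansion[OF y, of "\<chi> i. W a i"])
    then show ?thesis by (simp add: inner_sum_left p_def E(1))
  qed
  have metric: "metric i l y = (\<Sum>c\<in>UNIV. p i c * p l c)" for i l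
    unfolding metric_def p_def by (rule E_expand[OF deriv_tangent[OF y]])
  have Wle: "\<bar>W a i\<bar> \<le> 1" for a i
    using Cauchy_Schwarz_ineq2[of "E a" "e i"] E(1)[of a a] e_orthonormal[of i i]
    by (simp add: W_def norm_eq_1[THEN iffD2])
  have "\<bar>G i j\<bar> \<le> 3" for i j
  proof -
    have "\<bar>G i j\<bar> \<le> (\<Sum>a\<in>UNIV. \<bar>W a i * W a j\<bar>)" unfolding G_def by (rule sum_abs)
    also have "\<dots> \<le> (\<Sum>a\<in>(UNIV :: 3 set). 1)"
      using mult_mono[OF Wle Wle] by (intro sum_mono) (simp add: abs_mult)
    finally show ?thesis by simp
  qed
  moreover have "(\<Sum>j\<in>UNIV. G i j * metric j l y) = (if i = l then 1 else 0)" for i l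
  proof -
    have "(\<Sum>j\<in>UNIV. G i j * metric j l y) = (\<Sum>a\<in>UNIV. W a i * (\<Sum>j\<in>UNIV. W a j * metric j l y))"
      unfolding G_def by (rule sum_prod_assoc)
    moreover have "(\<Sum>j\<in>UNIV. W a j * metric j l y) = p l a" for a
    proof -
      have "(\<Sum>j\<in>UNIV. W a j * metric j l y) = (\<Sum>c\<in>UNIV. (\<Sum>j\<in>UNIV. W a j * p j c) * p l c)"
        unfolding metric by (rule sum_prod_assoc[symmetric])
      then show ?thesis by (simp only: Wp sum_delta_mult)
    qed
    ultimately show ?thesis using pW[of l i] by (simp add: mult.commute eq_commute[of l])
  qed
  moreover have "(\<Sum>i\<in>UNIV. \<Sum>j\<in>UNIV. G i j * X i j k y) = 0" for k
    by (rule inverse_metric_contractions(1)[OF X_sym[OF y] pW nf G_def])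
  moreover have "(\<Sum>j\<in>UNIV. \<Sum>k\<in>UNIV. X i j k y * (\<Sum>k'\<in>UNIV. G k k' * (\<Sum>j'\<in>UNIV. G j j' * X l j' k' y)))
      = 2 * (K 1 2 3)\<^sup>2 * metric i l y" for i l
    unfolding metric by (rule inverse_metric_contractions(2)[OF X_sym[OF y] pW nf G_def])
  ultimately have "bounded_inverse y G" unfolding bounded_inverse_def by blast
  then show ?thesis by blast
qed

lemma line_equations:
  fixes v :: "real^3"
  defines "n \<equiv> \<lambda>i j. \<Sum>k\<in>UNIV. dir_deriv v (F k i) y0 * dir_deriv v (F k j) y0"
    and "x \<equiv> \<lambda>i j k. X i j k y0" and "x1 \<equiv> \<lambda>i j k. dir_deriv v (X i j k) y0"
    and "x2 \<equiv> \<lambda>i j k. dir_deriv v (dir_deriv v (X i j k)) y0 / 2"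
  shows "(\<Sum>i\<in>UNIV. x1 i i k) = 0"
    and "(\<Sum>i\<in>UNIV. x2 i i k - (\<Sum>j\<in>UNIV. n i j * x i j k)) = 0"
    and "i \<noteq> l \<Longrightarrow> (\<Sum>j\<in>UNIV. \<Sum>k\<in>UNIV. x i j k * x1 l j k + x1 i j k * x l j k) = 0"
    and "i \<noteq> l \<Longrightarrow> (\<Sum>j\<in>UNIV. \<Sum>k\<in>UNIV. x i j k * (x2 l j k - (\<Sum>j'\<in>UNIV. n j j' * x l j' k) - (\<Sum>k'\<in>UNIV. n k k' * x l j k'))
       + x1 i j k * x1 l j k + x2 i j k * x l j k) = (\<Sum>j\<in>UNIV. \<Sum>k\<in>UNIV. x l j k * x l j k) * n i l"
proof -
  obtain \<epsilon> :: real where \<epsilon>: "0 < \<epsilon>" "\<And>t. t \<in> {-\<epsilon><..<\<epsilon>} \<Longrightarrow> y0 + t *\<^sub>R v \<in> V"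
    using open_contains_line[OF open_V y0] by metis
  have ev: "\<forall>\<^sub>F t in at 0. y0 + t *\<^sub>R v \<in> V"
    unfolding eventually_at using \<epsilon>(1)
    by (intro exI[of _ \<epsilon>] conjI ballI impI \<epsilon>(2)) (auto simp: dist_real_def)
  \<comment> \<open>The choice is made separately for each \<open>t\<close>;
    \<open>jet2_inverse_matrix\<close> nevertheless yields its second-order expansion.\<close>
  define G where "G i j t = (SOME G. bounded_inverse (y0 + t *\<^sub>R v) G) i j" for i j t
  have "\<forall>\<^sub>F t in at 0. bounded_inverse (y0 + t *\<^sub>R v) (\<lambda>i j. G i j t)"
    using ev by eventually_elim (simp add: G_def someI_ex[OF bounded_inverse_exists])
  then have Q: "\<forall>\<^sub>F t in at 0. (\<forall>i j. \<bar>G i j t\<bar> \<le> 3) \<and> (\<forall>i l. (\<Sum>j\<in>UNIV. G i j t * metric j l (y0 + t *\<^sub>R v)) = (if i = l then 1 else 0)) \<and>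
    (\<forall>k. (\<Sum>i\<in>UNIV. \<Sum>j\<in>UNIV. G i j t * X i j k (y0 + t *\<^sub>R v)) = 0) \<and>
    (\<exists>c. \<forall>i l. (\<Sum>j\<in>UNIV. \<Sum>k\<in>UNIV. X i j k (y0 + t *\<^sub>R v) *
        (\<Sum>k'\<in>UNIV. G k k' t * (\<Sum>j'\<in>UNIV. G j j' t * X l j' k' (y0 + t *\<^sub>R v)))) = c * metric i l (y0 + t *\<^sub>R v))"
    by (simp only: bounded_inverse_def)
  have jF: "jet2 (\<lambda>t. F i j (y0 + t *\<^sub>R v)) 0 (dir_deriv v (F i j) y0) (dir_deriv v (dir_deriv v (F i j)) y0 / 2)" for i j
    using jet2_line[OF smooth_F y0, of i j v] by (simp add: F_y0)
  \<comment> \<open>Both factors vanish at the centre, so their product starts with a square term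
    made of first derivatives.\<close>
  have "jet2 (\<lambda>t. F k i (y0 + t *\<^sub>R v) * F k j (y0 + t *\<^sub>R v)) 0 0 (dir_deriv v (F k i) y0 * dir_deriv v (F k j) y0)" for i j k
    using jet2_mult[OF jF jF, of k i k j] by simp
  then have "jet2 (\<lambda>t. (if i = j then 1 else 0) + (\<Sum>k\<in>UNIV. F k i (y0 + t *\<^sub>R v) * F k j (y0 + t *\<^sub>R v)))
      ((if i = j then 1 else 0) + (\<Sum>k\<in>(UNIV :: 3 set). 0)) (0 + (\<Sum>k\<in>(UNIV :: 3 set). 0)) (0 + n i j)" for i j
    unfolding n_def by (intro jet2_add jet2_const jet2_sum)
  then have "jet2 (\<lambda>t. (if i = j then 1 else 0) + (\<Sum>k\<in>UNIV. F k i (y0 + t *\<^sub>R v) * F k j (y0 + t *\<^sub>R v)))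
      (if i = j then 1 else 0) 0 (n i j)" for i j by simp
  then have jg: "jet2 (\<lambda>t. metric i j (y0 + t *\<^sub>R v)) (if i = j then 1 else 0) 0 (n i j)" for i j
  proof (rule jet2_cong)
    show "\<forall>\<^sub>F t in at 0. (if i = j then 1 else 0) + (\<Sum>k\<in>UNIV. F k i (y0 + t *\<^sub>R v) * F k j (y0 + t *\<^sub>R v))
        = metric i j (y0 + t *\<^sub>R v)"
      using ev by eventually_elim (simp only: metric_eq)
  qed
  have jG: "jet2 (G i j) (if i = j then 1 else 0) 0 (- n i j)" for i j
    by (rule jet2_inverse_matrix[where K = 3 and g = "\<lambda>i j t. metric i j (y0 + t *\<^sub>R v)", OF _ _ jg])
       (rule eventually_mono[OF Q], blast)+
  have jX: "jet2 (\<lambda>t. X i j k (y0 + t *\<^sub>R v)) (x i j k) (x1 i j k) (x2 i j k)" for i j k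
    unfolding x_def x1_def x2_def by (rule jet2_line[OF smooth_X y0])
  have tr: "\<forall>\<^sub>F t in at 0. (\<Sum>i\<in>UNIV. \<Sum>j\<in>UNIV. G i j t * X i j k (y0 + t *\<^sub>R v)) = 0" for k
    by (rule eventually_mono[OF Q]) blast
  have ei: "\<forall>\<^sub>F t in at 0. \<exists>c. \<forall>i l. (\<Sum>j\<in>UNIV. \<Sum>k\<in>UNIV. X i j k (y0 + t *\<^sub>R v) *
        (\<Sum>k'\<in>UNIV. G k k' t * (\<Sum>j'\<in>UNIV. G j j' t * X l j' k' (y0 + t *\<^sub>R v)))) = c * metric i l (y0 + t *\<^sub>R v)"
    by (rule eventually_mono[OF Q]) blast
  note eqs = jet_equations[OF jG jg jX tr ei]
  show "(\<Sum>i\<in>UNIV. x1 i i k) = 0" by (rule eqs(1))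
  show "(\<Sum>i\<in>UNIV. x2 i i k - (\<Sum>j\<in>UNIV. n i j * x i j k)) = 0" by (rule eqs(2))
  show "i \<noteq> l \<Longrightarrow> (\<Sum>j\<in>UNIV. \<Sum>k\<in>UNIV. x i j k * x1 l j k + x1 i j k * x l j k) = 0" by (rule eqs(3))
  show "i \<noteq> l \<Longrightarrow> (\<Sum>j\<in>UNIV. \<Sum>k\<in>UNIV. x i j k * (x2 l j k - (\<Sum>j'\<in>UNIV. n j j' * x l j' k) - (\<Sum>k'\<in>UNIV. n k k' * x l j k'))
       + x1 i j k * x1 l j k + x2 i j k * x l j k) = (\<Sum>j\<in>UNIV. \<Sum>k\<in>UNIV. x l j k * x l j k) * n i l" by (rule eqs(4))
qed

text \<open>The chart frame \<open>e\<close> is at the same time a frame in which the cubic at the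
  centre has its normal form, so \<open>X\<close> is \<open>xyz r\<close> there. Once the first
  derivatives of \<open>X\<close> are known to vanish, the second-order equations lose the terms
  quadratic in them.\<close>

lemma cubic_vanishes:
  assumes nf: "\<And>i j k. i = j \<or> j = k \<or> i = k \<Longrightarrow> fundamental_cubic L (\<Phi> y0) (e i) (e j) (e k) = 0"
    and abc: "a \<in> tangent_space L (\<Phi> y0)" "b \<in> tangent_space L (\<Phi> y0)" "c \<in> tangent_space L (\<Phi> y0)"
  shows "fundamental_cubic L (\<Phi> y0) a b c = 0"
proof -
  have C: "fundamental_cubic L (\<Phi> y0) (e a) (e b) (e c) = X c b a y0" for a b c
    using cubic_coordinates[OF y0, of "axis a 1" "axis b 1" "axis c 1", unfolded deriv_y0]
    by (simp add: axis_def if_distrib[of "\<lambda>z. z * _"] if_distrib[of "\<lambda>z. _ * z"] cong: if_cong)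
  define r where "r = X 1 2 3 y0"
  have "(\<lambda>i j k. X i j k y0) = xyz r"
    unfolding r_def
    by (rule symmetric_cubic_eq_xyz[OF X_sym[OF y0]]) (use nf C in auto)
  then have x: "X i j k y0 = xyz r i j k" for i j k by metis
  have "r = 0"
  proof (rule ccontr)
    assume r: "r \<noteq> 0"
    define y where "y i j k m = dir_deriv (axis m 1) (X i j k) y0" for i j k m
    define z where "z i j k m n = dir_deriv (axis n 1) (dir_deriv (axis m 1) (X i j k)) y0" for i j k m n
    have y1: "y i j k m = y j i k m" "y i j k m = y i k j m" for i j k m
      unfolding y_def by (rule dir_deriv_cong[OF open_V y0 X_sym(1)], assumption)
        (rule dir_deriv_cong[OF open_V y0 X_sym(2)], assumption)
    have y2: "y i j k m = y i j m k" for i j k m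
      unfolding y_def X_def by (rule dir_deriv_commute[OF smooth_F y0])
    have "dir_deriv (axis m 1) (X i j k) q = dir_deriv (axis m 1) (X j i k) q"
      "dir_deriv (axis m 1) (X i j k) q = dir_deriv (axis m 1) (X i k j) q"
      "dir_deriv (axis m 1) (X i j k) q = dir_deriv (axis k 1) (X i j m) q" if "q \<in> V" for i j k m q
      by (rule dir_deriv_cong[OF open_V that X_sym(1)], assumption)
        (rule dir_deriv_cong[OF open_V that X_sym(2)], assumption, unfold X_def, rule dir_deriv_commute[OF smooth_F that])
    then have z1: "z i j k m n = z j i k m n" "z i j k m n = z i k j m n" "z i j k m n = z i j m k n" for i j k m n
      unfolding z_def by (blast intro: dir_deriv_cong[OF open_V y0])+
    have z2: "z i j k m n = z i j k n m" for i j k m n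
      unfolding z_def by (rule dir_deriv_commute[OF smooth_X y0])
    have "y i j k m = 0" for i j k m
    proof (rule quartic_eq_0[OF y1 y2 r])
      show "(\<Sum>i\<in>UNIV. y i i k m) = 0" for k m
        unfolding y_def by (rule line_equations(1))
      show "(\<Sum>j\<in>UNIV. \<Sum>k\<in>UNIV. xyz r i j k * y l j k m + y i j k m * xyz r l j k) = 0" if "i \<noteq> l" for i l m
        using line_equations(3)[OF that, of "axis m 1"] by (simp add: y_def x)
    qed
    then have y0': "dir_deriv v (X i j k) y0 = 0" for v i j k
      unfolding dir_deriv_coordinates[OF smooth_X y0, of v] by (simp add: y_def)
    \<comment> \<open>Equations along a line see only the second derivative in its direction. Lines
      in the directions \<open>v s m n\<close> give access to mixed derivatives.\<close>
    define v :: "real \<Rightarrow> 3 \<Rightarrow> 3 \<Rightarrow> real^3" where "v s m n = axis m 1 + s *\<^sub>R axis n 1" for s m n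
    have dv: "dir_deriv (v s m n) g q = dir_deriv (axis m 1) g q + s * dir_deriv (axis n 1) g q"
      if "smooth_on V g" "q \<in> V" for s m n g q
      by (simp add: v_def linear_add[OF linear_dir_deriv[OF that]] linear_scale[OF linear_dir_deriv[OF that]])
    have h: "dir_deriv (v s m n) (F i j) y0 = xyz r i j m + s * xyz r i j n" for s m n i j
      by (simp add: dv[OF smooth_F y0] x flip: X_def)
    have zz: "dir_deriv (v s m n) (dir_deriv (v s m n) (X i j k)) y0
        = z i j k m m + 2 * s * z i j k m n + s * s * z i j k n n" for s m n i j k
    proof -
      have sX: "smooth_on V (dir_deriv (axis m 1) (X i j k))" for m
        by (rule smooth_on_dir_deriv[OF smooth_X])
      have "dir_deriv (v s m n) (dir_deriv (v s m n) (X i j k)) y0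
        = dir_deriv (v s m n) (\<lambda>q. dir_deriv (axis m 1) (X i j k) q + s * dir_deriv (axis n 1) (X i j k) q) y0"
        by (rule dir_deriv_cong[OF open_V y0 dv[OF smooth_X]])
      also have "\<dots> = dir_deriv (v s m n) (dir_deriv (axis m 1) (X i j k)) y0
          + s * dir_deriv (v s m n) (dir_deriv (axis n 1) (X i j k)) y0"
        by (rule dir_deriv_add_scale[OF sX sX y0])
      also have "\<dots> = z i j k m m + 2 * s * z i j k m n + s * s * z i j k n n"
        using z2[of i j k n m] by (simp add: dv[OF sX y0] z_def[symmetric] algebra_simps)
      finally show ?thesis .
    qed
    have "r = 0"
    \<comment> \<open>The three \<open>refl\<close> instantiate \<open>h\<close>, \<open>N\<close>
      and \<open>x2\<close> by their defining formulas.\<close>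
    proof (rule quintic_eq_0[OF z1 z2 refl refl refl])
      show "(\<Sum>i\<in>UNIV. (z i i k m m + 2 * s * z i i k m n + s * s * z i i k n n) / 2
          - (\<Sum>j\<in>UNIV. (\<Sum>l\<in>UNIV. (xyz r l i m + s * xyz r l i n) * (xyz r l j m + s * xyz r l j n)) * xyz r i j k)) = 0" for s m n k
        using line_equations(2)[where v = "v s m n" and k = k] unfolding x h zz .
      show "(\<Sum>j\<in>UNIV. \<Sum>k\<in>UNIV. xyz r i j k * ((z l j k m m + 2 * s * z l j k m n + s * s * z l j k n n) / 2
          - (\<Sum>j'\<in>UNIV. (\<Sum>l\<in>UNIV. (xyz r l j m + s * xyz r l j n) * (xyz r l j' m + s * xyz r l j' n)) * xyz r l j' k)
          - (\<Sum>k'\<in>UNIV. (\<Sum>l\<in>UNIV. (xyz r l k m + s * xyz r l k n) * (xyz r l k' m + s * xyz r l k' n)) * xyz r l j k'))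
          + (z i j k m m + 2 * s * z i j k m n + s * s * z i j k n n) / 2 * xyz r l j k)
        = (\<Sum>j\<in>UNIV. \<Sum>k\<in>UNIV. xyz r l j k * xyz r l j k)
          * (\<Sum>k\<in>UNIV. (xyz r k i m + s * xyz r k i n) * (xyz r k l m + s * xyz r k l n))" if "i \<noteq> l" for s m n i l
        using line_equations(4)[OF that, where v = "v s m n"] unfolding x h zz y0' by simp
    qed
    then show False using r by simp
  qed
  then have "X i j k y0 = 0" for i j k by (simp add: x xyz_def)
  then show ?thesis
    using abc cubic_coordinates[OF y0] by (auto simp: tangent_space_chart[OF y0])
qed

end

section \<open>Flatness\<close>

context frame_chart
begin

lemma openin_image:
  assumes "open B" "B \<subseteq> V"
  shows "openin (top_of_set L) (\<Phi> ` B)"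
proof -
  have "\<Phi> ` B = \<Phi> ` V \<inter> (\<lambda>z. \<chi> i. z \<bullet> e i) -` B"
    using assms(2) P_chart by force
  moreover have "open ((\<lambda>z. \<chi> i. z \<bullet> e i) -` B)"
    by (intro open_vimage assms(1) linear_continuous_on bounded_linear_P)
  ultimately show ?thesis using open_image by (auto intro: openin_Int_open)
qed

text \<open>If \<open>X\<close> vanishes, \<open>F\<close> is constant and equal to its value 0 at
  the centre, so the derivative of \<open>\<Phi>\<close> is constant and \<open>\<Phi>\<close> is
  affine. Working on a ball provides the convexity that turns zero derivatives into
  constancy.\<close>

lemma flat_near_y0:
  assumes flat: "\<And>x a b c. x \<in> L \<Longrightarrow> a \<in> tangent_space L x \<Longrightarrow> b \<in> tangent_space L x \<Longrightarrow> c \<in> tangent_space L x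
      \<Longrightarrow> fundamental_cubic L x a b c = 0"
  obtains W where "\<Phi> y0 \<in> W" "openin (top_of_set L) W"
    "openin (top_of_set ((+) (\<Phi> y0) ` span (range e))) W" "\<And>x. x \<in> W \<Longrightarrow> tangent_space L x = span (range e)"
proof -
  obtain d where d: "d > 0" "ball y0 d \<subseteq> V"
    using open_V y0 open_contains_ball by blast
  let ?B = "ball y0 d" and ?P = "\<lambda>z. \<chi> i. z \<bullet> e i"
  let ?A = "\<lambda>y. \<Sum>i\<in>UNIV. y $ i *\<^sub>R e i"
  have X0: "X i j k y = 0" if y: "y \<in> V" for i j k y
  proof -
    have "fundamental_cubic L (\<Phi> y) (dir_deriv (axis k 1) \<Phi> y) (dir_deriv (axis j 1) \<Phi> y) (dir_deriv (axis i 1) \<Phi> y) = 0"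
      using flat[OF chart_in[OF y]] deriv_tangent[OF y] by blast
    then show ?thesis
      unfolding cubic_coordinates[OF y]
      by (simp add: axis_def if_distrib[of "\<lambda>z. z * _"] if_distrib[of "\<lambda>z. _ * z"] cong: if_cong)
  qed
  have F0: "F i j y = 0" if "y \<in> ?B" for i j y
  proof -
    have "F i j y = F i j y0"
    proof (rule has_derivative_zero_unique[OF convex_ball _ that])
      fix q assume "q \<in> ?B"
      then have q: "q \<in> V" using d(2) by blast
      have "dir_deriv v (F i j) q = 0" for v
        using dir_deriv_coordinates[OF smooth_F q, of v i j] X0[OF q] by (simp add: X_def)
      then have "(F i j has_derivative (\<lambda>h. 0)) (at q)"
        using has_dir_deriv[OF smooth_F q, of i j] by simp
      then show "(F i j has_derivative (\<lambda>h. 0)) (at q within ?B)"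
        by (rule has_derivative_at_withinI)
    qed (use d in simp)
    then show ?thesis by (simp add: F_y0)
  qed
  have D: "dir_deriv v \<Phi> y = ?A v" if y: "y \<in> ?B" for v y
  proof (rule vector_eq_ldot[THEN iffD1], rule allI)
    fix z
    have yV: "y \<in> V" using y d(2) by blast
    have "dir_deriv v (f i) y = 0" for i
      using dir_deriv_coordinates[OF smooth_f yV, of v i] F0[OF y] by (simp add: F_def)
    then have "dir_deriv v \<Phi> y \<bullet> z = (\<Sum>i\<in>UNIV. v $ i * (z \<bullet> e i))"
      using inner_expansion[of "dir_deriv v \<Phi> y" z] by (simp add: deriv_e[OF yV] deriv_Je[OF yV])
    then show "z \<bullet> dir_deriv v \<Phi> y = z \<bullet> ?A v"
      by (simp add: inner_sum_right inner_commute[of z "dir_deriv v \<Phi> y"])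
  qed
  have blA: "bounded_linear ?A"
    by (intro bounded_linear_sum bounded_linear_compose[OF bounded_linear_scaleR_left bounded_linear_vec_nth])
  have affine: "\<Phi> y = \<Phi> y0 + ?A (y - y0)" if "y \<in> ?B" for y
  proof -
    have "\<Phi> y - ?A y = \<Phi> y0 - ?A y0"
    proof (rule has_derivative_zero_unique[OF convex_ball _ that])
      fix q assume q: "q \<in> ?B"
      then have "q \<in> V" using d(2) by blast
      from has_derivative_diff[OF has_dir_deriv[OF smooth_chart this] bounded_linear_imp_has_derivative[OF blA]]
      have "((\<lambda>y. \<Phi> y - ?A y) has_derivative (\<lambda>v. 0)) (at q)" by (simp add: D[OF q])
      then show "((\<lambda>y. \<Phi> y - ?A y) has_derivative (\<lambda>v. 0)) (at q within ?B)"
        by (rule has_derivative_at_withinI)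
    qed (use d in simp)
    then show ?thesis
      by (simp add: algebra_simps sum_subtractf)
  qed
  have A_span: "?A u \<in> span (range e)" for u
    by (intro span_sum span_scale span_base) auto
  have range_A: "range ?A = span (range e)"
  proof
    show "span (range e) \<subseteq> range ?A"
    proof
      fix v assume "v \<in> span (range e)"
      from orthonormal_expansion[OF e_orthonormal this] have "v = ?A (?P v)" by simp
      then show "v \<in> range ?A" by blast
    qed
  qed (use A_span in auto)
  \<comment> \<open>The chart image is cut out of the affine plane by an open condition, hence open
    in the plane and not merely contained in it.\<close>
  have W: "\<Phi> ` ?B = (+) (\<Phi> y0) ` span (range e) \<inter> ?P -` ?B"
  proof
    show "\<Phi> ` ?B \<subseteq> (+) (\<Phi> y0) ` span (range e) \<inter> ?P -` ?B"
    proof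
      fix z assume "z \<in> \<Phi> ` ?B"
      then obtain y where y: "y \<in> ?B" "z = \<Phi> y" by blast
      then have "z \<in> (+) (\<Phi> y0) ` span (range e)" using affine[OF y(1)] A_span[of "y - y0"] by blast
      moreover have "?P z = y" using y d(2) P_chart by blast
      ultimately show "z \<in> (+) (\<Phi> y0) ` span (range e) \<inter> ?P -` ?B" using y(1) by simp
    qed
  next
    show "(+) (\<Phi> y0) ` span (range e) \<inter> ?P -` ?B \<subseteq> \<Phi> ` ?B"
    proof
      fix z assume z: "z \<in> (+) (\<Phi> y0) ` span (range e) \<inter> ?P -` ?B"
      then obtain t where t: "t \<in> span (range e)" "z = \<Phi> y0 + t" by blast
      then have "t \<in> range ?A" using range_A by simp
      then obtain u where u: "z = \<Phi> y0 + ?A u" using t(2) by blast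
      have "?P (?A u) = u"
        by (simp add: vec_eq_iff inner_sum_left e_orthonormal if_distrib[of "\<lambda>z. _ * z"] cong: if_cong)
      then have "?P z = y0 + u"
        using P_chart[OF y0] by (simp add: u vec_eq_iff inner_add_left)
      then have "y0 + u \<in> ?B" using z by simp
      then show "z \<in> \<Phi> ` ?B" using affine[of "y0 + u"] u by force
    qed
  qed
  show ?thesis
  proof (rule that[of "\<Phi> ` ?B"])
    show "\<Phi> y0 \<in> \<Phi> ` ?B" using d(1) by simp
    show "openin (top_of_set L) (\<Phi> ` ?B)" by (rule openin_image[OF open_ball d(2)])
    have "open (?P -` ?B)"
      by (intro open_vimage open_ball linear_continuous_on bounded_linear_P)
    then show "openin (top_of_set ((+) (\<Phi> y0) ` span (range e))) (\<Phi> ` ?B)"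
      unfolding W by (rule openin_open_Int)
    show "tangent_space L x = span (range e)" if x: "x \<in> \<Phi> ` ?B" for x
    proof -
      obtain y where y: "y \<in> ?B" "x = \<Phi> y" using x by blast
      then have "y \<in> V" using d(2) by blast
      from tangent_space_chart[OF this] show ?thesis
        using D[OF y(1)] range_A y(2) by simp
    qed
  qed
qed

end

section \<open>Adapted frames and charts at every point\<close>

lemma orthonormal_basis_3:
  fixes T :: "(complex^3) set"
  assumes "subspace T" "dim T = 3"
  obtains e :: "3 \<Rightarrow> complex^3" where "\<And>i j. e i \<bullet> e j = (if i = j then 1 else 0)" "span (range e) = T"
proof -
  obtain B where B: "pairwise orthogonal B" "\<And>x. x \<in> B \<Longrightarrow> norm x = 1" "independent B" "card B = dim T" "span B = T"
    using orthonormal_basis_subspace[OF assms(1)] by metis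
  obtain e :: "3 \<Rightarrow> complex^3" where e: "bij_betw e UNIV B"
    using finite_card_3_enumerate[OF independent_imp_finite[OF B(3)]] B(4) assms(2) by metis
  have eB: "e i \<in> B" for i using e by (auto simp: bij_betw_def)
  show ?thesis
  proof (rule that[of e])
    show "e i \<bullet> e j = (if i = j then 1 else 0)" for i j
    proof (cases "i = j")
      case True
      then show ?thesis using B(2)[OF eB[of j]] by (simp add: norm_eq_1)
    next
      case False
      then have "e i \<noteq> e j" using e by (auto simp: bij_betw_def inj_eq)
      then show ?thesis using B(1) eB False by (auto simp: pairwise_def orthogonal_def)
    qed
    show "span (range e) = T" using e B(5) by (simp add: bij_betw_def)
  qed
qed

lemma tangent_space_submanifold:
  assumes L: "submanifold3 L" and x: "x \<in> L"
  shows "subspace (tangent_space L x)" "dim (tangent_space L x) = 3"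
    "\<And>P. linear P \<Longrightarrow> (\<And>a. a \<in> tangent_space L x \<Longrightarrow> P a = 0 \<Longrightarrow> a = 0) \<Longrightarrow>
       \<exists>V \<Phi> y. linear_chart L P V \<Phi> \<and> y \<in> V \<and> \<Phi> y = x"
proof -
  obtain D :: "real^3 \<Rightarrow> complex^3" where D: "linear D" "inj D"
    and ch: "\<And>P. linear P \<Longrightarrow> inj (\<lambda>v. P (D v)) \<Longrightarrow>
       \<exists>V \<Phi> y. linear_chart L P V \<Phi> \<and> y \<in> V \<and> \<Phi> y = x \<and> range (\<lambda>v. dir_deriv v \<Phi> y) = range D"
    using linear_chart_exists[OF L x] by blast
  obtain P where P: "linear P" "P \<circ> D = id"
    using linear_injective_left_inverse[OF D] by blast
  have "inj (\<lambda>v. P (D v))" using P(2) by (metis comp_apply id_apply injI)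
  then obtain V \<Phi> y where *: "linear_chart L P V \<Phi>" "y \<in> V" "\<Phi> y = x" "range (\<lambda>v. dir_deriv v \<Phi> y) = range D"
    using ch[OF P(1)] by blast
  have T: "tangent_space L x = range D"
    using linear_chart.tangent_space_chart[OF *(1,2)] *(3,4) by simp
  show "subspace (tangent_space L x)"
    unfolding T using linear_subspace_image[OF D(1) subspace_UNIV] .
  show "dim (tangent_space L x) = 3"
    unfolding T using dim_image_eq[OF D(1), of UNIV] D(2) by simp
  show "\<exists>V \<Phi> y. linear_chart L P V \<Phi> \<and> y \<in> V \<and> \<Phi> y = x"
    if "linear P" and P0: "\<And>a. a \<in> tangent_space L x \<Longrightarrow> P a = 0 \<Longrightarrow> a = 0" for P :: "complex^3 \<Rightarrow> real^3"
  proof -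
    have "linear (\<lambda>v. P (D v))" using linear_compose[OF D(1) that(1)] by (simp add: o_def)
    moreover have "v = 0" if "P (D v) = 0" for v
      using P0[of "D v"] that T linear_injective_0[OF D(1)] D(2) by auto
    ultimately have "inj (\<lambda>v. P (D v))" by (simp add: linear_injective_0)
    then show ?thesis using ch[OF that(1)] by blast
  qed
qed

lemma frame_chart_exists:
  assumes L: "special_lagrangian L" and x: "x \<in> L"
    and e: "\<And>i j. e i \<bullet> e j = (if i = j then 1 else 0)" "span (range e) = tangent_space L x"
  obtains V \<Phi> y0 where "frame_chart L e V \<Phi> y0" "\<Phi> y0 = x"
proof -
  have sub: "submanifold3 L" using L by (simp add: special_lagrangian_def)
  have "linear (\<lambda>z. \<chi> i. z \<bullet> e i)"
    by (rule linearI) (simp_all add: vec_eq_iff inner_add_left)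
  moreover have "a = 0" if "a \<in> tangent_space L x" "(\<chi> i. a \<bullet> e i) = 0" for a
    using orthonormal_expansion[of e a] e that by (simp add: vec_eq_iff)
  ultimately have "\<exists>V \<Phi> y. linear_chart L (\<lambda>z. \<chi> i. z \<bullet> e i) V \<Phi> \<and> y \<in> V \<and> \<Phi> y = x"
    by (rule tangent_space_submanifold(3)[OF sub x])
  then obtain V \<Phi> y where "linear_chart L (\<lambda>z. \<chi> i. z \<bullet> e i) V \<Phi>" "y \<in> V" "\<Phi> y = x"
    by blast
  then show ?thesis
    using L e by (intro that[of V \<Phi> y] frame_chart.intro frame_chart_axioms.intro) auto
qed

text \<open>Two charts centred at \<open>x\<close> are used. The first, over an arbitrary
  orthonormal tangent basis, serves to produce a frame \<open>E\<close> in which the cubic has its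
  normal form; the second is built over \<open>E\<close>, as \<open>cubic_vanishes\<close>
  requires.\<close>

lemma cubic_eq_0:
  assumes L: "special_lagrangian L" and A4: "\<And>x. x \<in> L \<Longrightarrow> \<exists>H. subgroup H (SO_group (tangent_space L x)) \<and>
           H \<subseteq> cubic_stabilizer (tangent_space L x) (fundamental_cubic L x) \<and>
           (SO_group (tangent_space L x))\<lparr>carrier := H\<rparr> \<cong> alt_group 4"
    and x: "x \<in> L" and abc: "a \<in> tangent_space L x" "b \<in> tangent_space L x" "c \<in> tangent_space L x"
  shows "fundamental_cubic L x a b c = 0"
proof -
  have sub: "submanifold3 L" using L by (simp add: special_lagrangian_def)
  have chart: "\<exists>V \<Phi> y0. A4_frame_chart L e V \<Phi> y0 \<and> \<Phi> y0 = x"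
    if "\<And>i j. e i \<bullet> e j = (if i = j then 1 else 0)" "span (range e) = tangent_space L x" for e :: "3 \<Rightarrow> complex^3"
    using frame_chart_exists[OF L x that] A4
    by (metis A4_frame_chart.intro A4_frame_chart_axioms.intro)
  obtain e :: "3 \<Rightarrow> complex^3" where "\<And>i j. e i \<bullet> e j = (if i = j then 1 else 0)" "span (range e) = tangent_space L x"
    using orthonormal_basis_3[OF tangent_space_submanifold(1,2)[OF sub x]] by blast
  from chart[OF this] obtain V \<Phi> y0 where 1: "A4_frame_chart L e V \<Phi> y0" "\<Phi> y0 = x" by blast
  have "y0 \<in> V" using 1(1) by (simp add: A4_frame_chart_def frame_chart_def frame_chart_axioms_def)
  then obtain E where E: "\<And>i j :: 3. E i \<bullet> E j = (if i = j then 1 else 0)" "span (range E) = tangent_space L x"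
    "\<And>i j k. i = j \<or> j = k \<or> i = k \<Longrightarrow> fundamental_cubic L x (E i) (E j) (E k) = 0"
    using A4_frame_chart.normal_frame[OF 1(1), of y0] 1(2) by metis
  from chart[OF E(1,2)] obtain V \<Phi> y0 where 2: "A4_frame_chart L E V \<Phi> y0" "\<Phi> y0 = x" by blast
  show ?thesis using A4_frame_chart.cubic_vanishes[OF 2(1), unfolded 2(2), OF E(3) abc] .
qed

section \<open>Special Lagrangian planes\<close>

lemma special_lagrangian_plane:
  fixes e :: "3 \<Rightarrow> complex^3"
  assumes e: "\<And>i j. e i \<bullet> e j = (if i = j then 1 else 0)"
    and om: "\<And>u v. u \<in> span (range e) \<Longrightarrow> v \<in> span (range e) \<Longrightarrow> omega u v = 0"
    and up: "\<And>u v w. u \<in> span (range e) \<Longrightarrow> v \<in> span (range e) \<Longrightarrow> w \<in> span (range e) \<Longrightarrow> Im (Upsilon u v w) = 0"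
  shows "special_lagrangian ((+) x ` span (range e))" "affine ((+) x ` span (range e))"
    "aff_dim ((+) x ` span (range e)) = 3"
proof -
  let ?T = "span (range e)" and ?P = "\<lambda>z. \<chi> i. z \<bullet> e i" and ?A = "\<lambda>y :: real^3. \<Sum>i\<in>UNIV. y $ i *\<^sub>R e i"
  \<comment> \<open>\<open>c\<close> is the component of \<open>x\<close> orthogonal to the plane
    directions. A parametrization based at \<open>c\<close> is inverted by the linear map
    \<open>?P\<close>, as \<open>linear_chart\<close> demands, and not by an affine one.\<close>
  define c where "c = x - ?A (?P x)"
  have A_span: "?A u \<in> ?T" for u
    by (intro span_sum span_scale span_base) auto
  have blA: "bounded_linear ?A"
    by (intro bounded_linear_sum bounded_linear_compose[OF bounded_linear_scaleR_left bounded_linear_vec_nth])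
  have PA: "?P (?A u) = u" for u
    by (simp add: vec_eq_iff inner_sum_left e if_distrib[of "\<lambda>z. _ * z"] cong: if_cong)
  have linP: "linear ?P"
    by (rule linearI) (simp_all add: vec_eq_iff inner_add_left)
  have Pc: "?P c = 0"
    unfolding c_def using linear_diff[OF linP, of x "?A (?P x)"] PA[of "?P x"] by simp
  have AP: "?A (?P v) = v" if "v \<in> ?T" for v
    using orthonormal_expansion[OF e that] by simp
  define \<Phi> where "\<Phi> y = c + ?A y" for y
  have P\<Phi>: "?P (\<Phi> y) = y" for y
    unfolding \<Phi>_def using linear_add[OF linP, of c "?A y"] PA[of y] Pc by simp
  have range_A: "range ?A = ?T"
  proof
    show "?T \<subseteq> range ?A"
    proof
      fix v assume "v \<in> ?T"
      from AP[OF this, symmetric] show "v \<in> range ?A" by (rule range_eqI)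
    qed
  qed (use A_span in auto)
  have range: "range \<Phi> = (+) x ` ?T"
  proof -
    have "range \<Phi> = (+) c ` ?T"
      unfolding range_A[symmetric] by (auto simp: \<Phi>_def)
    also have "\<dots> = (+) x ` ?T"
    proof
      show "(+) c ` ?T \<subseteq> (+) x ` ?T"
      proof
        fix z assume "z \<in> (+) c ` ?T"
        then obtain t where "t \<in> ?T" "z = x + (t - ?A (?P x))" by (auto simp: c_def)
        then show "z \<in> (+) x ` ?T" using span_diff[OF _ A_span] by blast
      qed
      show "(+) x ` ?T \<subseteq> (+) c ` ?T"
      proof
        fix z assume "z \<in> (+) x ` ?T"
        then obtain t where "t \<in> ?T" "z = c + (t + ?A (?P x))" by (auto simp: c_def)
        then show "z \<in> (+) c ` ?T" using span_add[OF _ A_span] by blast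
      qed
    qed
    finally show ?thesis .
  qed
  have s: "smooth_on UNIV \<Phi>"
    unfolding \<Phi>_def[abs_def]
    by (intro smooth_on_add smooth_on_const smooth_on_bounded_linear[OF blA] smooth_on_ident open_UNIV)
  interpret linear_chart "(+) x ` ?T" ?P UNIV \<Phi>
    by (rule linear_chart.intro[OF linP s P\<Phi>]) (simp add: range)
  have der: "(\<Phi> has_derivative ?A) (at y)" for y
    unfolding \<Phi>_def[abs_def] using has_derivative_add[OF has_derivative_const bounded_linear_imp_has_derivative[OF blA]]
    by simp
  have T: "tangent_space ((+) x ` ?T) z = ?T" if z: "z \<in> (+) x ` ?T" for z
  proof -
    obtain y where "z = \<Phi> y" using z unfolding range[symmetric] by blast
    then show ?thesis using tangent_space_chart[of y] dir_deriv_unique[OF der] range_A by simp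
  qed
  have inj: "inj ?A" by (rule inj_on_inverseI) (rule PA)
  then have "inj (frechet_derivative \<Phi> (at q))" for q
    using frechet_derivative_at[OF der[of q]] by simp
  moreover have "homeomorphism UNIV ((+) x ` ?T) \<Phi> ?P"
  proof (rule homeomorphismI)
    show "continuous_on UNIV \<Phi>" by (rule smooth_on_continuous[OF s])
    show "continuous_on ((+) x ` ?T) ?P" by (rule linear_continuous_on[OF bounded_linear_P])
    show "\<Phi> (?P z) = z" if "z \<in> (+) x ` ?T" for z
      using that P\<Phi> unfolding range[symmetric] by auto
  qed (use range P\<Phi> in auto)
  ultimately have "submanifold3 ((+) x ` ?T)"
    unfolding submanifold3_def using s
    by (intro ballI exI[of _ "(+) x ` ?T"] exI[of _ UNIV] exI[of _ \<Phi>] exI[of _ ?P]) auto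
  then show "special_lagrangian ((+) x ` ?T)"
    unfolding special_lagrangian_def using T om up by auto
  show "affine ((+) x ` ?T)"
    using affine_translation subspace_imp_affine subspace_span by blast
  have "dim ?T = 3"
    using inj dim_image_eq[OF bounded_linear.linear[OF blA], of UNIV] range_A by simp
  then show "aff_dim ((+) x ` ?T) = 3"
    by (simp add: aff_dim_translation_eq aff_dim_subspace)
qed

text \<open>The real points of \<open>complex^3\<close> are an example. It supplies the plane when
  \<open>L\<close> is empty.\<close>

lemma special_lagrangian_plane_exists: "\<exists>P. special_lagrangian P \<and> affine P \<and> aff_dim P = 3"
proof -
  define e :: "3 \<Rightarrow> complex^3" where "e i = axis i 1" for i
  have e: "e i \<bullet> e j = (if i = j then 1 else 0)" for i j
    by (simp add: e_def inner_axis_axis)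
  have real: "v $ k = of_real (v \<bullet> e k)" if "v \<in> span (range e)" for v k
  proof -
    have "v $ k = (\<Sum>i\<in>UNIV. (v \<bullet> e i) *\<^sub>R e i) $ k"
      using orthonormal_expansion[OF e that] by simp
    also have "\<dots> = (\<Sum>i\<in>UNIV. if k = i then of_real (v \<bullet> e i) else 0)"
      unfolding sum_component by (intro sum.cong refl) (simp add: e_def axis_def of_real_def)
    also have "\<dots> = of_real (v \<bullet> e k)" by simp
    finally show ?thesis .
  qed
  have im: "Im (v $ k) = 0" if "v \<in> span (range e)" for v k
    using real[OF that, of k] by (metis Im_complex_of_real)
  have "omega u v = 0" if "u \<in> span (range e)" "v \<in> span (range e)" for u v
    unfolding omega_eq using im[OF that(1)] im[OF that(2)] by (simp add: inner_vec_def inner_complex_def)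
  moreover have "Im (Upsilon u v w) = 0" if "u \<in> span (range e)" "v \<in> span (range e)" "w \<in> span (range e)" for u v w
    using im[OF that(1)] im[OF that(2)] im[OF that(3)] by (simp add: Upsilon_def det_3)
  ultimately show ?thesis using special_lagrangian_plane[OF e, of 0] by blast
qed

theorem theorem2:
  fixes L :: "(complex^3) set"
  assumes "special_lagrangian L" and "connected L"
    and "\<forall>x\<in>L. \<exists>H. subgroup H (SO_group (tangent_space L x)) \<and>
           H \<subseteq> cubic_stabilizer (tangent_space L x) (fundamental_cubic L x) \<and>
           (SO_group (tangent_space L x))\<lparr>carrier := H\<rparr> \<cong> alt_group 4"
  shows "\<exists>P. special_lagrangian P \<and> affine P \<and> aff_dim P = 3 \<and> openin (top_of_set P) L"
proof (cases "L = {}")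
  case True
  then show ?thesis using special_lagrangian_plane_exists by auto
next
  case False
  then obtain x0 where x0: "x0 \<in> L" by blast
  have sub: "submanifold3 L" using assms(1) by (simp add: special_lagrangian_def)
  have flat: "fundamental_cubic L x a b c = 0"
    if "x \<in> L" "a \<in> tangent_space L x" "b \<in> tangent_space L x" "c \<in> tangent_space L x" for x a b c
    using cubic_eq_0[OF assms(1) _ that] assms(3) by blast
  have frame: "\<exists>e :: 3 \<Rightarrow> complex^3. (\<forall>i j. e i \<bullet> e j = (if i = j then 1 else 0)) \<and> span (range e) = tangent_space L x"
    if "x \<in> L" for x
    using orthonormal_basis_3[OF tangent_space_submanifold(1,2)[OF sub that]] by metis
  \<comment> \<open>The affine tangent plane as a set-valued function on \<open>L\<close>: it
    records direction and position together, so that connectedness has to be applied only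
    once.\<close>
  define A where "A x = (+) x ` tangent_space L x" for x
  have local: "\<exists>W. x \<in> W \<and> openin (top_of_set L) W \<and> openin (top_of_set (A x)) W \<and>
      (\<forall>z\<in>W. tangent_space L z = tangent_space L x)" if x: "x \<in> L" for x
  proof -
    obtain e :: "3 \<Rightarrow> complex^3" where e: "\<And>i j. e i \<bullet> e j = (if i = j then 1 else 0)" "span (range e) = tangent_space L x"
      using frame[OF x] by blast
    obtain V \<Phi> y0 where "frame_chart L e V \<Phi> y0" "\<Phi> y0 = x"
      using frame_chart_exists[OF assms(1) x e] by blast
    then interpret frame_chart L e V \<Phi> y0 by simp
    obtain W where "\<Phi> y0 \<in> W" "openin (top_of_set L) W"
      "openin (top_of_set ((+) (\<Phi> y0) ` span (range e))) W" "\<And>x. x \<in> W \<Longrightarrow> tangent_space L x = span (range e)"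
      using flat_near_y0[OF flat] by blast
    then show ?thesis
      unfolding \<open>\<Phi> y0 = x\<close> e(2) A_def by blast
  qed
  \<comment> \<open>Equal tangent spaces only give parallel planes; these coincide because
    \<open>z\<close> lies on the plane of \<open>x\<close>.\<close>
  have A_eq: "A z = A x" if x: "x \<in> L" and z: "z \<in> A x" "tangent_space L z = tangent_space L x" for x z
  proof -
    have T: "subspace (tangent_space L x)" using tangent_space_submanifold(1)[OF sub x] .
    obtain t where t: "t \<in> tangent_space L x" "z = x + t" using z(1) by (auto simp: A_def)
    have "x + t + s \<in> (+) x ` tangent_space L x" "x + s \<in> (+) (x + t) ` tangent_space L x"
      if "s \<in> tangent_space L x" for s
    proof -
      show "x + t + s \<in> (+) x ` tangent_space L x"
        using subspace_add[OF T t(1) that] by (auto simp: add.assoc)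
      have "x + s = (x + t) + (s - t)" by simp
      then show "x + s \<in> (+) (x + t) ` tangent_space L x"
        using subspace_diff[OF T that t(1)] by blast
    qed
    then have "(+) (x + t) ` tangent_space L x = (+) x ` tangent_space L x" by auto
    then show ?thesis unfolding A_def z(2) by (simp add: t(2))
  qed
  have "A constant_on L"
  proof (rule locally_constant_imp_constant[OF assms(2)])
    fix x assume x: "x \<in> L"
    obtain W where W: "x \<in> W" "openin (top_of_set L) W" "openin (top_of_set (A x)) W"
      "\<forall>z\<in>W. tangent_space L z = tangent_space L x"
      using local[OF x] by blast
    then have "\<forall>z\<in>W. A z = A x" using A_eq[OF x] openin_imp_subset[OF W(3)] by blast
    then show "\<exists>T. openin (top_of_set L) T \<and> x \<in> T \<and> (\<forall>z\<in>T. A z = A x)" using W by blast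
  qed
  then have A: "A x = A x0" if "x \<in> L" for x using that x0 by (metis constant_on_def)
  \<comment> \<open>Each point of \<open>L\<close> has a neighbourhood within \<open>L\<close> that
    is open in its own tangent plane, and all these planes are now \<open>A x0\<close>.\<close>
  have "openin (top_of_set (A x0)) L"
  proof (subst openin_subopen, intro ballI)
    fix x assume x: "x \<in> L"
    then show "\<exists>W. openin (top_of_set (A x0)) W \<and> x \<in> W \<and> W \<subseteq> L"
      using local[OF x] A[OF x] openin_imp_subset by metis
  qed
  moreover obtain e :: "3 \<Rightarrow> complex^3" where e: "\<And>i j. e i \<bullet> e j = (if i = j then 1 else 0)"
    "span (range e) = tangent_space L x0"
    using frame[OF x0] by blast
  have "omega u v = 0" "Im (Upsilon u v w) = 0"
    if "u \<in> span (range e)" "v \<in> span (range e)" "w \<in> span (range e)" for u v w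
    using assms(1) x0 that unfolding e(2) special_lagrangian_def by blast+
  then have "special_lagrangian (A x0)" "affine (A x0)" "aff_dim (A x0) = 3"
    using special_lagrangian_plane[OF e(1), of x0] unfolding A_def e(2) by blast+
  ultimately show ?thesis by blast
qed

end
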